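(* Let $\alpha,\beta,u^*>0$ and assume that the precipitation threshold is supercritical, i.e. $u^*<\Psi(\alpha)$. Then there exists a time $T_{\mathrm{unique}}>0$ such that any two weak solutions $(u_1,p_1)$ and $(u_2,p_2)$ of the HHMO-model are identical on $D_{\mathrm{unique}}=\mathbb{R}\times[0,T_{\mathrm{unique}}]$, i.e. $u_1=u_2$ on $D_{\mathrm{unique}}$ and $p_1=p_2$ almost everywhere on $D_{\mathrm{unique}}$.
   Context: Fix parameters $\alpha,\beta,u^*>0$. The HHMO-model is, formally, $u_t=u_{xx}+\frac{\alpha\beta}{2\sqrt t}\,\delta(x-\alpha\sqrt t)-p\,u$ for $x>0$, with $u_x(0,t)=0$, $u(x,0)=0$, extended to $x\in\mathbb{R}$ by even reflection. Put $\psi(x,t)=\Psi(|x|/\sqrt t)$ for $t>0$ and $\psi(x,0)=0$ for $x\ne0$ (the single point $(0,0)$, where $\psi$ is not defined, is disregarded), where $\Psi(\eta)=\frac{\alpha\beta\sqrt\pi}{2}e^{\alpha^2/4}\,\mathrm{erfc}(\alpha/2)$ for $\eta\le\alpha$ and $\Psi(\eta)=\frac{\alpha\beta\sqrt\pi}{2}e^{\alpha^2/4}\,\mathrm{erfc}(\eta/2)$ for $\eta>\alpha$. A weak solution is a pair $(u,p)$ of functions on $\mathbb{R}\times[0,\infty)$ such that: (i) $u$ and $p$ are even in $x$; (ii) $u-\psi\in C^{1,0}(\mathbb{R}\times[0,T])\cap L^\infty(\mathbb{R}\times[0,T])$ for every $T>0$ ($C^{1,0}$: continuous together with the first $x$-derivative);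 (iii) $p$ is measurable, defined pointwise, and $p(x,t)=0$ if $\sup_{s\in[0,t]}u(x,s)<u^*$, $p(x,t)\in[0,1]$ if $\sup_{s\in[0,t]}u(x,s)=u^*$, $p(x,t)=1$ if $\sup_{s\in[0,t]}u(x,s)>u^*$; (iv) $p(x,t)$ is non-decreasing in $t$ for every $x$; (v) for every $T>0$, $\int_0^T\!\int_{\mathbb R}\varphi_t\,(u-\psi)\,dy\,ds=\int_0^T\!\int_{\mathbb R}\bigl(\varphi_x\,(u-\psi)_x+p\,u\,\varphi\bigr)\,dy\,ds$ for every $\varphi\in C^{1,1}(\mathbb{R}\times[0,T])$ (continuously differentiable once in $x$ and once in $t$) that vanishes for large $|x|$ and for $t=T$. *)

theory Defs
  imports "HOL-Analysis.Analysis"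
begin

definition erfc :: "real \<Rightarrow> real" where
  "erfc x = 2 / sqrt pi * (LBINT s:{x..}. exp (- s\<^sup>2))"

definition Psi :: "real \<Rightarrow> real \<Rightarrow> real \<Rightarrow> real" where
  "Psi \<alpha> \<beta> \<eta> =
     \<alpha> * \<beta> * sqrt pi / 2 * exp (\<alpha>\<^sup>2 / 4) * (if \<eta> \<le> \<alpha> then erfc (\<alpha> / 2) else erfc (\<eta> / 2))"

text \<open>Functions of space and time are curried, space first. Only times \<open>t \<ge> 0\<close> matter,
  and the origin is excluded from the domain of \<open>\<psi>\<close>, hence also from that of \<open>u\<close> and \<open>p\<close>;
  the values of the total functions below outside \<open>spacetime\<close> are irrelevant.\<close>

definition spacetime :: "(real \<times> real) set" where
  "spacetime = (UNIV \<times> {0..}) - {(0, 0)}"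

definition psi :: "real \<Rightarrow> real \<Rightarrow> real \<Rightarrow> real \<Rightarrow> real" where
  "psi \<alpha> \<beta> x t = (if t > 0 then Psi \<alpha> \<beta> (\<bar>x\<bar> / sqrt t) else 0)"

definition strip :: "real \<Rightarrow> (real \<times> real) set" where
  "strip T = UNIV \<times> {0..T}"

definition x_deriv :: "(real \<Rightarrow> real \<Rightarrow> real) \<Rightarrow> real \<Rightarrow> real \<Rightarrow> real" where
  "x_deriv f x t = deriv (\<lambda>y. f y t) x"

text \<open>The time derivative is one-sided at \<open>0\<close> and \<open>T\<close>.\<close>

definition t_deriv :: "real \<Rightarrow> (real \<Rightarrow> real \<Rightarrow> real) \<Rightarrow> real \<Rightarrow> real \<Rightarrow> real" where
  "t_deriv T f x t = vector_derivative (f x) (at t within {0..T})"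

definition C10 :: "real \<Rightarrow> (real \<Rightarrow> real \<Rightarrow> real) \<Rightarrow> bool" where
  "C10 T f \<longleftrightarrow>
     continuous_on (strip T) (\<lambda>(x, t). f x t) \<and>
     (\<forall>(x, t) \<in> strip T. (\<lambda>y. f y t) differentiable (at x)) \<and>
     continuous_on (strip T) (\<lambda>(x, t). x_deriv f x t)"

definition C11 :: "real \<Rightarrow> (real \<Rightarrow> real \<Rightarrow> real) \<Rightarrow> bool" where
  "C11 T f \<longleftrightarrow>
     C10 T f \<and>
     (\<forall>(x, t) \<in> strip T. f x differentiable (at t within {0..T})) \<and>
     continuous_on (strip T) (\<lambda>(x, t). t_deriv T f x t)"

definition Linfty :: "real \<Rightarrow> (real \<Rightarrow> real \<Rightarrow> real) \<Rightarrow> bool" where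
  "Linfty T f \<longleftrightarrow>
     (\<lambda>(x, t). f x t) \<in> borel_measurable (lebesgue_on (strip T)) \<and>
     (\<exists>M. AE (x, t) in lebesgue_on (strip T). \<bar>f x t\<bar> \<le> M)"

text \<open>Since \<open>u - \<psi>\<close> is not defined at the origin, being of class \<open>C\<^sup>1\<^sup>,\<^sup>0\<close> on the whole strip
  means that it extends to such a function.\<close>

definition regular_part :: "real \<Rightarrow> (real \<Rightarrow> real \<Rightarrow> real) \<Rightarrow> bool" where
  "regular_part T f \<longleftrightarrow>
     (\<exists>g. C10 T g \<and> Linfty T g \<and> (\<forall>(x, t) \<in> strip T \<inter> spacetime. f x t = g x t))"

definition past_sup :: "(real \<Rightarrow> real \<Rightarrow> real) \<Rightarrow> real \<Rightarrow> real \<Rightarrow> real" where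
  "past_sup u x t = (SUP s \<in> {s \<in> {0..t}. (x, s) \<in> spacetime}. u x s)"

definition test_function :: "real \<Rightarrow> (real \<Rightarrow> real \<Rightarrow> real) \<Rightarrow> bool" where
  "test_function T \<phi> \<longleftrightarrow>
     C11 T \<phi> \<and>
     (\<exists>R. \<forall>(x, t) \<in> strip T. \<bar>x\<bar> > R \<longrightarrow> \<phi> x t = 0) \<and>
     (\<forall>x. \<phi> x T = 0)"

definition weak_solution ::
  "real \<Rightarrow> real \<Rightarrow> real \<Rightarrow> (real \<Rightarrow> real \<Rightarrow> real) \<times> (real \<Rightarrow> real \<Rightarrow> real) \<Rightarrow> bool" where
  "weak_solution \<alpha> \<beta> ustar = (\<lambda>(u, p).
     let w = (\<lambda>x t. u x t - psi \<alpha> \<beta> x t) in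
     (\<forall>(x, t) \<in> spacetime. u (- x) t = u x t \<and> p (- x) t = p x t) \<and>
     (\<forall>T>0. regular_part T w) \<and>
     (\<lambda>(x, t). p x t) \<in> borel_measurable (lebesgue_on spacetime) \<and>
     (\<forall>(x, t) \<in> spacetime.
        (past_sup u x t < ustar \<longrightarrow> p x t = 0) \<and>
        (past_sup u x t = ustar \<longrightarrow> p x t \<in> {0..1}) \<and>
        (past_sup u x t > ustar \<longrightarrow> p x t = 1)) \<and>
     (\<forall>x s t. (x, s) \<in> spacetime \<and> s \<le> t \<longrightarrow> p x s \<le> p x t) \<and>
     (\<forall>T>0. \<forall>\<phi>. test_function T \<phi> \<longrightarrow>
        (LINT s:{0..T}|lebesgue. (LINT y|lebesgue. t_deriv T \<phi> y s * w y s)) =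
        (LINT s:{0..T}|lebesgue. (LINT y|lebesgue.
           x_deriv \<phi> y s * x_deriv w y s + p y s * u y s * \<phi> y s))))"

end

theory Submission
  imports Defs "HOL-Probability.Distributions"
begin

text \<open>Write \<open>U = \<Psi>(\<alpha>)\<close>. Testing the weak formulation with truncated backward heat kernels shows
  that \<open>w = u - \<psi>\<close> is the Duhamel integral of \<open>- p u\<close>. Hence for short times \<open>w\<close> is at most
  \<open>2 U t\<close> and has Lipschitz constant of order \<open>sqrt t\<close> in \<open>x\<close>, whereas \<open>\<psi>\<close> falls in \<open>x\<close> with slope
  of order \<open>1 / sqrt t\<close> where it crosses the threshold; supercriticality places this crossing
  strictly beyond the kink at \<open>x = \<alpha> sqrt t\<close>. If two solutions differ by at most \<open>\<delta>\<close>, then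
  \<open>p\<^sub>1\<close> and \<open>p\<^sub>2\<close> can disagree at time \<open>t\<close> only where the past supremum of \<open>u\<^sub>1\<close> is within \<open>\<delta>\<close> of
  \<open>u\<^sup>*\<close>, and by the transversality in \<open>x\<close> this set has measure of order \<open>\<delta> sqrt t\<close>. The heat kernel
  has height of order \<open>1 / sqrt (t - s)\<close>, so by Duhamel the solutions differ by at most a multiple
  of \<open>\<delta> t\<close>, which for small \<open>t\<close> forces \<open>\<delta> = 0\<close>.\<close>

subsection \<open>The heat kernel\<close>

text \<open>The obstacle is that \<open>p\<close> depends on the history of \<open>u\<close> through
  a jump, so \<open>p * u\<close> is not Lipschitz in \<open>u\<close> for the supremum norm. A
  Lipschitz estimate survives only after integration over space, where a mismatch of
  \<open>p1\<close> and \<open>p2\<close> counts as a bounded source on a short set. The heat kernel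
  turns such an integral bound back into a supremum bound, at the price of its height, whose
  singularity is integrable in time. On the flat part of the profile, up to \<alpha>, the size of a
  mismatch set would not be controlled by the distance of the solutions. One time has to serve all
  pairs of solutions, while each solution brings its own bound on \<open>u - psi\<close>; these
  bounds are therefore improved to ones that depend on the parameters only. Test functions must
  vanish at the final time, which rules out the plain backward kernel; a weight linear in time
  repairs this, and a formula at a single time is recovered by varying the final time.\<close>

definition heat_kernel :: "real \<Rightarrow> real \<Rightarrow> real" where
  "heat_kernel \<tau> z = exp (- z\<^sup>2 / (4 * \<tau>)) / sqrt (4 * pi * \<tau>)"

text \<open>The variance is \<open>2 * \<tau>\<close> because the equation is
  \<open>u_t = u_xx\<close> without a factor 1/2. Integrability and unit mass are then those of a
  normal density.\<close>

lemma heat_kernel_eq_normal_density: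
  assumes "\<tau> > 0"
  shows "heat_kernel \<tau> (x - y) = normal_density x (sqrt (2 * \<tau>)) y"
  using assms by (simp add: heat_kernel_def normal_density_def power2_commute mult.assoc)

lemma heat_kernel_pos: "\<tau> > 0 \<Longrightarrow> heat_kernel \<tau> z > 0"
  by (simp add: heat_kernel_def)

lemma heat_kernel_measurable [measurable (raw)]:
  assumes [measurable]: "f \<in> borel_measurable M" "g \<in> borel_measurable M"
  shows "(\<lambda>x. heat_kernel (f x) (g x)) \<in> borel_measurable M"
  unfolding heat_kernel_def by measurable

lemma integrable_heat_kernel:
  "\<tau> > 0 \<Longrightarrow> integrable lborel (\<lambda>y. heat_kernel \<tau> (x - y))"
  by (simp add: heat_kernel_eq_normal_density)

lemma integral_heat_kernel:
  "\<tau> > 0 \<Longrightarrow> (LINT y|lborel. heat_kernel \<tau> (x - y)) = 1"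
  by (simp add: heat_kernel_eq_normal_density)

lemma heat_kernel_le:
  assumes "\<tau> > 0"
  shows "heat_kernel \<tau> z \<le> 1 / sqrt \<tau>"
proof -
  have "heat_kernel \<tau> z \<le> 1 / sqrt (4 * pi * \<tau>)"
    using assms by (simp add: heat_kernel_def divide_right_mono)
  also have "\<dots> \<le> 1 / sqrt \<tau>"
    using assms pi_ge_two by (intro divide_left_mono real_sqrt_le_mono) auto
  finally show ?thesis .
qed

text \<open>Lets half of a Gaussian exponent absorb the linear factor that differentiation
  produces.\<close>

lemma abs_mult_exp_neg_square_le:
  fixes u :: real
  shows "\<bar>u\<bar> * exp (- u\<^sup>2 / 2) \<le> 1"
proof -
  have "0 \<le> (\<bar>u\<bar> - 1)\<^sup>2" by simp
  then have "\<bar>u\<bar> \<le> 1 + u\<^sup>2 / 2" by (simp add: power2_diff)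
  also have "\<dots> \<le> exp (u\<^sup>2 / 2)" by (rule exp_ge_add_one_self)
  finally show ?thesis by (simp add: exp_minus field_simps)
qed

lemma heat_kernel_deriv_space:
  assumes "\<tau> > 0"
  shows "(heat_kernel \<tau> has_real_derivative - z / (2 * \<tau>) * heat_kernel \<tau> z) (at z)"
  unfolding heat_kernel_def using assms
  by (auto intro!: derivative_eq_intros simp: field_simps)

lemma heat_kernel_deriv_space_space:
  assumes "\<tau> > 0"
  shows "((\<lambda>z. - z / (2 * \<tau>) * heat_kernel \<tau> z) has_real_derivative
    (z\<^sup>2 / (4 * \<tau>\<^sup>2) - 1 / (2 * \<tau>)) * heat_kernel \<tau> z) (at z)"
  using assms
  by (auto intro!: derivative_eq_intros heat_kernel_deriv_space simp: field_simps power2_eq_square)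

text \<open>The value is that of the second space derivative in
  \<open>heat_kernel_deriv_space_space\<close>; together the two lemmas are the heat
  equation.\<close>

lemma heat_kernel_deriv_time:
  assumes "\<tau> > 0"
  shows "((\<lambda>\<tau>. heat_kernel \<tau> z) has_real_derivative
    (z\<^sup>2 / (4 * \<tau>\<^sup>2) - 1 / (2 * \<tau>)) * heat_kernel \<tau> z) (at \<tau>)"
proof -
  \<comment> \<open>Written in terms of \<open>s\<close>, with
    \<open>\<tau> = s * s / (4 * pi)\<close>, the identity to check is rational and free of square
    roots.\<close>
  define s where "s = sqrt (4 * pi * \<tau>)"
  define q where "q = exp (- z\<^sup>2 / (4 * \<tau>))"
  have s: "s > 0" "\<tau> = s * s / (4 * pi)"
    using assms by (auto simp: s_def)
  have "(q * (z\<^sup>2 / (4 * \<tau>\<^sup>2)) * s - q * (4 * pi * (inverse s / 2))) / (s * s)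
      = (z\<^sup>2 / (4 * \<tau>\<^sup>2) - 1 / (2 * \<tau>)) * (q / s)"
    using s(1) by (simp add: s(2) field_simps power2_eq_square)
  moreover have "((\<lambda>\<tau>. heat_kernel \<tau> z) has_real_derivative
      (q * (z\<^sup>2 / (4 * \<tau>\<^sup>2)) * s - q * (4 * pi * (inverse s / 2))) / (s * s)) (at \<tau>)"
    unfolding heat_kernel_def using assms
    by (auto intro!: derivative_eq_intros simp: q_def s_def power2_eq_square mult_less_0_iff)
  ultimately show ?thesis
    by (simp add: heat_kernel_def q_def s_def)
qed

text \<open>Half of the exponent swallows the factor \<open>\<bar>z\<bar> / sqrt \<tau>\<close>; the
  other half is the exponent of the kernel of doubled width, and \<open>sqrt 2\<close> corrects the
  normalisation.\<close>

lemma heat_kernel_deriv_space_bound: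
  assumes "\<tau> > 0"
  shows "\<bar>z\<bar> / (2 * \<tau>) * heat_kernel \<tau> z \<le> sqrt 2 / sqrt \<tau> * heat_kernel (2 * \<tau>) z"
proof -
  define u where "u = z / (2 * sqrt \<tau>)"
  have s: "sqrt \<tau> > 0" "sqrt \<tau> * sqrt \<tau> = \<tau>" using assms by auto
  have u2: "u\<^sup>2 / 2 = z\<^sup>2 / (8 * \<tau>)" 
    using s by (simp add: u_def power2_eq_square)
  have e: "exp (- (z\<^sup>2 / (4 * \<tau>))) = exp (- (z\<^sup>2 / (8 * \<tau>))) * exp (- (z\<^sup>2 / (8 * \<tau>)))"
    by (simp flip: exp_add)
  have h: "heat_kernel \<tau> z = sqrt 2 * heat_kernel (2 * \<tau>) z * exp (- u\<^sup>2 / 2)"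
    using assms unfolding heat_kernel_def minus_divide_left[symmetric] u2
    by (simp add: e real_sqrt_mult real_sqrt_mult[of 4 2, simplified])
  have "\<bar>z\<bar> / (2 * \<tau>) = \<bar>u\<bar> / sqrt \<tau>"
    using s by (simp add: u_def abs_mult)
  then have "\<bar>z\<bar> / (2 * \<tau>) * heat_kernel \<tau> z
      = (\<bar>u\<bar> * exp (- u\<^sup>2 / 2)) * (sqrt 2 / sqrt \<tau> * heat_kernel (2 * \<tau>) z)"
    by (simp add: h)
  also have "\<dots> \<le> 1 * (sqrt 2 / sqrt \<tau> * heat_kernel (2 * \<tau>) z)"
    using abs_mult_exp_neg_square_le assms heat_kernel_pos[of "2 * \<tau>" z]
    by (intro mult_right_mono) auto
  finally show ?thesis by simp
qed

lemma heat_kernel_abs: "heat_kernel \<tau> \<bar>z\<bar> = heat_kernel \<tau> z"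
  by (simp add: heat_kernel_def)

lemma heat_kernel_antimono:
  assumes "\<tau> > 0" "\<bar>a\<bar> \<le> \<bar>b\<bar>"
  shows "heat_kernel \<tau> b \<le> heat_kernel \<tau> a"
  using assms abs_le_square_iff[of a b]
  by (simp add: heat_kernel_def divide_right_mono)

text \<open>Since the kernel is even, both points may be moved to the same side of the origin; then
  the kernel of doubled width is at every intermediate point at most its value at the endpoint
  closer to the origin.\<close>

lemma heat_kernel_diff_le:
  assumes "\<tau> > 0"
  shows "\<bar>heat_kernel \<tau> a - heat_kernel \<tau> b\<bar>
    \<le> sqrt 2 / sqrt \<tau> * \<bar>a - b\<bar> * (heat_kernel (2 * \<tau>) a + heat_kernel (2 * \<tau>) b)"
proof -
  have *: "\<bar>heat_kernel \<tau> a - heat_kernel \<tau> b\<bar>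
      \<le> sqrt 2 / sqrt \<tau> * \<bar>a - b\<bar> * (heat_kernel (2 * \<tau>) a + heat_kernel (2 * \<tau>) b)"
    if ab: "0 \<le> a" "a < b" for a b
  proof -
    obtain z where z: "a < z" "z < b"
      "heat_kernel \<tau> b - heat_kernel \<tau> a = (b - a) * (- z / (2 * \<tau>) * heat_kernel \<tau> z)"
      using MVT2[OF ab(2) heat_kernel_deriv_space[OF assms]] by blast
    have "\<bar>heat_kernel \<tau> a - heat_kernel \<tau> b\<bar> = \<bar>a - b\<bar> * (\<bar>z\<bar> / (2 * \<tau>) * heat_kernel \<tau> z)"
      using assms heat_kernel_pos[OF assms, of z]
      by (simp add: abs_minus_commute[of "heat_kernel \<tau> a"] z(3) abs_mult abs_minus_commute)
    also have "\<dots> \<le> \<bar>a - b\<bar> * (sqrt 2 / sqrt \<tau> * heat_kernel (2 * \<tau>) z)"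
      using heat_kernel_deriv_space_bound[OF assms] by (intro mult_left_mono) auto
    also have "\<dots> \<le> \<bar>a - b\<bar> * (sqrt 2 / sqrt \<tau> * (heat_kernel (2 * \<tau>) a + heat_kernel (2 * \<tau>) b))"
      using heat_kernel_antimono[of "2 * \<tau>" a z] heat_kernel_pos[of "2 * \<tau>" b] assms ab z
      by (intro mult_left_mono) auto
    finally show ?thesis by (simp add: mult_ac)
  qed
  have **: "\<bar>heat_kernel \<tau> a - heat_kernel \<tau> b\<bar>
      \<le> sqrt 2 / sqrt \<tau> * \<bar>a - b\<bar> * (heat_kernel (2 * \<tau>) a + heat_kernel (2 * \<tau>) b)"
    if "0 \<le> a" "0 \<le> b" for a b
    using *[of a b] *[of b a] that
    by (cases a b rule: linorder_cases) (auto simp: abs_minus_commute add.commute)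
  have "\<bar>heat_kernel \<tau> a - heat_kernel \<tau> b\<bar>
      \<le> sqrt 2 / sqrt \<tau> * \<bar>\<bar>a\<bar> - \<bar>b\<bar>\<bar> * (heat_kernel (2 * \<tau>) a + heat_kernel (2 * \<tau>) b)"
    using **[of "\<bar>a\<bar>" "\<bar>b\<bar>"] by (simp add: heat_kernel_abs)
  also have "\<dots> \<le> sqrt 2 / sqrt \<tau> * \<bar>a - b\<bar> * (heat_kernel (2 * \<tau>) a + heat_kernel (2 * \<tau>) b)"
    using assms heat_kernel_pos[of "2 * \<tau>" a] heat_kernel_pos[of "2 * \<tau>" b]
    by (intro mult_right_mono mult_left_mono abs_triangle_ineq3) auto
  finally show ?thesis .
qed

text \<open>The exponential grows when \<tau> is raised to \<open>E\<close>, the prefactor when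
  \<tau> is lowered to \<epsilon>. This gives a single integrable majorant for all widths between
  \<epsilon> and \<open>E\<close>.\<close>

lemma heat_kernel_le_wider:
  assumes "0 < \<epsilon>" "\<epsilon> \<le> \<tau>" "\<tau> \<le> E"
  shows "heat_kernel \<tau> z \<le> sqrt (E / \<epsilon>) * heat_kernel E z"
proof -
  have "heat_kernel \<tau> z \<le> exp (- z\<^sup>2 / (4 * E)) / sqrt (4 * pi * \<epsilon>)"
    using assms by (auto simp: heat_kernel_def intro!: frac_le divide_left_mono)
  also have "\<dots> = sqrt (E / \<epsilon>) * heat_kernel E z"
    using assms by (simp add: heat_kernel_def real_sqrt_mult real_sqrt_divide)
  finally show ?thesis .
qed

subsection \<open>Cutoff functions and integration by parts\<close>

text \<open>The third power is chosen so that the second derivative is still continuous where the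
  support ends.\<close>

definition cutoff :: "real \<Rightarrow> real \<Rightarrow> real" where
  "cutoff R y = (max 0 (1 - (y / R)\<^sup>2)) ^ 3"

definition cutoff' :: "real \<Rightarrow> real \<Rightarrow> real" where
  "cutoff' R y = - 6 * y / R\<^sup>2 * (max 0 (1 - (y / R)\<^sup>2)) ^ 2"

definition cutoff'' :: "real \<Rightarrow> real \<Rightarrow> real" where
  "cutoff'' R y = - 6 / R\<^sup>2 * (max 0 (1 - (y / R)\<^sup>2)) ^ 2
    + 24 * y\<^sup>2 / R ^ 4 * max 0 (1 - (y / R)\<^sup>2)"

text \<open>Only the kink at 0 needs an argument; there the difference quotient is at most
  \<open>\<bar>h\<bar> ^ (n - 1)\<close>, which vanishes in the limit since
  \<open>n \<ge> 2\<close>.\<close>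

lemma max_0_power_deriv:
  fixes z :: real
  assumes "n \<ge> 2"
  shows "((\<lambda>z. max 0 z ^ n) has_real_derivative real n * max 0 z ^ (n - 1)) (at z)"
proof (cases z "0 :: real" rule: linorder_cases)
  case less
  have "((\<lambda>z. 0) has_real_derivative real n * max 0 z ^ (n - 1)) (at z)"
    using less assms by (auto intro!: derivative_eq_intros)
  then show ?thesis
    by (rule has_field_derivative_transform_within_open[where S = "{..<0}"])
      (use less assms in auto)
next
  case equal
  have "((\<lambda>h. max 0 h ^ n / h) \<longlongrightarrow> 0) (at (0 :: real))"
  proof (rule Lim_null_comparison)
    have "norm (max 0 h ^ n / h) \<le> \<bar>h\<bar> ^ (n - 1)" if "h \<noteq> 0" for h :: real
      using that assms by (cases n) (auto simp: max_def power_abs)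
    then show "\<forall>\<^sub>F h in at (0 :: real). norm (max 0 h ^ n / h) \<le> \<bar>h\<bar> ^ (n - 1)"
      by (auto simp: eventually_at_filter)
    show "((\<lambda>h. \<bar>h\<bar> ^ (n - 1)) \<longlongrightarrow> 0) (at (0 :: real))"
      using assms by (auto intro!: tendsto_eq_intros)
  qed
  then show ?thesis
    using equal assms by (simp add: DERIV_def power_0_left)
next
  case greater
  have "((\<lambda>z. z ^ n) has_real_derivative real n * max 0 z ^ (n - 1)) (at z)"
    using greater assms by (auto intro!: derivative_eq_intros)
  then show ?thesis
    by (rule has_field_derivative_transform_within_open[where S = "{0<..}"])
      (use greater assms in auto)
qed

lemma cutoff_deriv:
  assumes "R > 0"
  shows "(cutoff R has_real_derivative cutoff' R y) (at y)"
proof -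
  have 1: "((\<lambda>y. 1 - (y / R)\<^sup>2) has_real_derivative - 2 * y / R\<^sup>2) (at y)"
    using assms by (auto intro!: derivative_eq_intros simp: power2_eq_square field_simps)
  show ?thesis
    using DERIV_chain2[OF max_0_power_deriv 1, of 3]
    by (simp add: cutoff_def[abs_def] cutoff'_def field_simps)
qed

lemma cutoff'_deriv:
  assumes "R > 0"
  shows "(cutoff' R has_real_derivative cutoff'' R y) (at y)"
proof -
  have 1: "((\<lambda>y. 1 - (y / R)\<^sup>2) has_real_derivative - 2 * y / R\<^sup>2) (at y)"
    using assms by (auto intro!: derivative_eq_intros simp: power2_eq_square field_simps)
  have 2: "((\<lambda>y. max 0 (1 - (y / R)\<^sup>2) ^ 2) has_real_derivative
      2 * max 0 (1 - (y / R)\<^sup>2) * (- 2 * y / R\<^sup>2)) (at y)"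
    using DERIV_chain2[OF max_0_power_deriv 1, of 2] by simp
  have 3: "((\<lambda>y. - 6 * y / R\<^sup>2) has_real_derivative - 6 / R\<^sup>2) (at y)"
    using assms by (auto intro!: derivative_eq_intros simp: power2_eq_square power4_eq_xxxx)
  have 4: "- 6 * y / R\<^sup>2 * (2 * m * (- 2 * y / R\<^sup>2)) = 24 * y\<^sup>2 / R ^ 4 * m" for m
    using assms by (simp add: power2_eq_square power4_eq_xxxx mult_ac)
  show ?thesis
    using DERIV_mult[OF 3 2] unfolding 4
    by (simp add: cutoff'_def[abs_def] cutoff''_def algebra_simps power2_eq_square power4_eq_xxxx)
qed

lemma cutoff_continuous [continuous_intros]:
  assumes "continuous_on S f"
  shows "continuous_on S (\<lambda>x. cutoff R (f x))" "continuous_on S (\<lambda>x. cutoff' R (f x))"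
    "continuous_on S (\<lambda>x. cutoff'' R (f x))"
  unfolding cutoff_def cutoff'_def cutoff''_def divide_inverse
  by (intro continuous_intros assms)+

lemma cutoff_measurable [measurable]:
  "cutoff R \<in> borel_measurable borel" "cutoff' R \<in> borel_measurable borel"
  "cutoff'' R \<in> borel_measurable borel"
  unfolding cutoff_def[abs_def] cutoff'_def[abs_def] cutoff''_def[abs_def] by measurable

lemma cutoff_outside:
  assumes "R > 0" "\<bar>y\<bar> > R"
  shows "cutoff R y = 0" "cutoff' R y = 0" "cutoff'' R y = 0"
proof -
  have "1 \<le> (y / R)\<^sup>2"
    using assms abs_le_square_iff[of 1 "y / R"] by simp
  then have "max 0 (1 - (y / R)\<^sup>2) = 0" by simp
  then show "cutoff R y = 0" "cutoff' R y = 0" "cutoff'' R y = 0"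
    by (auto simp: cutoff_def cutoff'_def cutoff''_def)
qed

text \<open>On the support \<open>\<bar>y\<bar> \<le> R\<close>, and the truncated parabola lies
  between 0 and 1; 30 is the sum of the coefficients 6 and 24 of the two terms. The decay in
  \<open>R\<close> makes the error terms of the truncation disappear.\<close>

lemma cutoff_bounds:
  assumes "R > 0"
  shows "\<bar>cutoff R y\<bar> \<le> 1" "\<bar>cutoff' R y\<bar> \<le> 6 / R" "\<bar>cutoff'' R y\<bar> \<le> 30 / R\<^sup>2"
proof -
  define m where "m = max 0 (1 - (y / R)\<^sup>2)"
  have m: "0 \<le> m" "m \<le> 1" by (auto simp: m_def)
  have m2: "0 \<le> m\<^sup>2" "m\<^sup>2 \<le> 1" using m by (auto intro: power_le_one)
  show "\<bar>cutoff R y\<bar> \<le> 1"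
    unfolding cutoff_def m_def[symmetric] using m by (simp add: power_le_one)
  show "\<bar>cutoff' R y\<bar> \<le> 6 / R"
  proof (cases "\<bar>y\<bar> \<le> R")
    case True
    have "\<bar>cutoff' R y\<bar> = 6 * \<bar>y\<bar> / R\<^sup>2 * m\<^sup>2"
      unfolding cutoff'_def m_def[symmetric] using m by (simp add: abs_mult)
    also have "\<dots> \<le> 6 * R / R\<^sup>2 * 1"
      using True m2 assms by (intro mult_mono divide_right_mono) auto
    finally show ?thesis using assms by (simp add: power2_eq_square)
  qed (use assms cutoff_outside in auto)
  show "\<bar>cutoff'' R y\<bar> \<le> 30 / R\<^sup>2"
  proof (cases "\<bar>y\<bar> \<le> R")
    case True
    then have y2: "y\<^sup>2 \<le> R\<^sup>2" using assms by (simp add: abs_le_square_iff[symmetric])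
    have "24 * y\<^sup>2 / R ^ 4 * m \<le> 24 * R\<^sup>2 / R ^ 4 * 1"
      using y2 m assms by (intro mult_mono divide_right_mono) auto
    moreover have "6 / R\<^sup>2 * m\<^sup>2 \<le> 6 / R\<^sup>2 * 1"
      using m2 by (intro mult_left_mono) auto
    moreover have "0 \<le> 24 * y\<^sup>2 / R ^ 4 * m" "0 \<le> 6 / R\<^sup>2 * m\<^sup>2"
      using m by auto
    moreover have "24 * R\<^sup>2 / R ^ 4 = 24 / R\<^sup>2"
      using assms by (simp add: power2_eq_square power4_eq_xxxx)
    moreover have "30 / R\<^sup>2 = 24 / R\<^sup>2 + 6 / R\<^sup>2" by (simp add: add_divide_distrib[symmetric])
    moreover have "cutoff'' R y = - (6 / R\<^sup>2 * m\<^sup>2) + 24 * y\<^sup>2 / R ^ 4 * m"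
      unfolding cutoff''_def m_def[symmetric] by simp
    ultimately show ?thesis by linarith
  qed (use assms cutoff_outside in auto)
qed

lemma cutoff_limits:
  shows "(\<lambda>n. cutoff (real (Suc n)) y) \<longlonglongrightarrow> 1"
    and "(\<lambda>n. cutoff' (real (Suc n)) y) \<longlonglongrightarrow> 0"
    and "(\<lambda>n. cutoff'' (real (Suc n)) y) \<longlonglongrightarrow> 0"
proof -
  have inv: "(\<lambda>n. c * inverse (real (Suc n))) \<longlonglongrightarrow> 0" for c
    using tendsto_mult_right_zero[OF LIMSEQ_inverse_real_of_nat] .
  have "(\<lambda>n. max 0 (1 - (y * inverse (real (Suc n)))\<^sup>2) ^ 3) \<longlonglongrightarrow> max 0 (1 - 0\<^sup>2) ^ 3"
    by (intro tendsto_intros inv)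
  then show "(\<lambda>n. cutoff (real (Suc n)) y) \<longlonglongrightarrow> 1"
    by (simp add: cutoff_def divide_inverse)
  show "(\<lambda>n. cutoff' (real (Suc n)) y) \<longlonglongrightarrow> 0"
    by (rule Lim_null_comparison[OF _ inv[of 6]])
      (use cutoff_bounds(2) in \<open>auto simp: divide_inverse\<close>)
  have "(\<lambda>n. 30 * (inverse (real (Suc n)))\<^sup>2) \<longlonglongrightarrow> 30 * 0\<^sup>2"
    using inv[of 1] by (intro tendsto_intros) simp
  then have i2: "(\<lambda>n. 30 * (inverse (real (Suc n)))\<^sup>2) \<longlonglongrightarrow> 0" by simp
  show "(\<lambda>n. cutoff'' (real (Suc n)) y) \<longlonglongrightarrow> 0"
    by (rule Lim_null_comparison[OF _ i2])
      (use cutoff_bounds(3) in \<open>auto simp: divide_inverse power_inverse\<close>)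
qed

section \<open>Regularity classes on a strip and integrals over it\<close>

lemma C10_mono:
  assumes "C10 T f" "S \<le> T"
  shows "C10 S f"
proof -
  have "strip S \<subseteq> strip T" using assms(2) by (auto simp: strip_def)
  then show ?thesis
    using assms(1) unfolding C10_def by (blast intro: continuous_on_subset)
qed

lemma C10D:
  assumes "C10 T f" "0 \<le> t" "t \<le> T"
  shows "((\<lambda>y. f y t) has_real_derivative x_deriv f x t) (at x)"
    and "continuous_on S (\<lambda>y. f y t)" "continuous_on S (\<lambda>y. x_deriv f y t)"
proof -
  have in_strip: "(x, t) \<in> strip T" for x using assms by (auto simp: strip_def)
  then have "(\<lambda>y. f y t) differentiable (at x)"
    using assms(1) unfolding C10_def by auto
  then show "((\<lambda>y. f y t) has_real_derivative x_deriv f x t) (at x)"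
    unfolding x_deriv_def real_differentiable_def by (auto dest: DERIV_imp_deriv)
  have c: "continuous_on S (\<lambda>y. (y, t))" by (intro continuous_intros)
  show "continuous_on S (\<lambda>y. f y t)"
    using continuous_on_compose2[OF _ c, of "strip T" "\<lambda>(x, t). f x t"] assms(1) in_strip
    unfolding C10_def by auto
  show "continuous_on S (\<lambda>y. x_deriv f y t)"
    using continuous_on_compose2[OF _ c, of "strip T" "\<lambda>(x, t). x_deriv f x t"] assms(1) in_strip
    unfolding C10_def by auto
qed

text \<open>Two-sided time derivatives are demanded even at the ends of the interval. The test
  functions below have them, since their kernel is smooth across the final time.\<close>

lemma C11I:
  assumes "T > 0"
    and x: "\<And>x t. (x, t) \<in> strip T \<Longrightarrow> ((\<lambda>y. f y t) has_real_derivative fx x t) (at x)"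
    and t: "\<And>x t. (x, t) \<in> strip T \<Longrightarrow> (f x has_real_derivative ft x t) (at t)"
    and c: "continuous_on (strip T) (\<lambda>(x, t). f x t)"
      "continuous_on (strip T) (\<lambda>(x, t). fx x t)" "continuous_on (strip T) (\<lambda>(x, t). ft x t)"
  shows "C11 T f" "\<And>x t. (x, t) \<in> strip T \<Longrightarrow> x_deriv f x t = fx x t"
    "\<And>x t. (x, t) \<in> strip T \<Longrightarrow> t_deriv T f x t = ft x t"
proof -
  show xd: "x_deriv f x t = fx x t" if "(x, t) \<in> strip T" for x t
    unfolding x_deriv_def by (rule DERIV_imp_deriv[OF x[OF that]])
  show td: "t_deriv T f x t = ft x t" if "(x, t) \<in> strip T" for x t
    unfolding t_deriv_def
    by (rule vector_derivative_at_within_ivl)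
      (use t[OF that] that assms(1) in \<open>auto simp: strip_def has_real_derivative_iff_has_vector_derivative\<close>)
  have "continuous_on (strip T) (\<lambda>(x, t). x_deriv f x t)"
    by (rule continuous_on_eq[OF c(2)]) (auto simp: xd)
  moreover have "continuous_on (strip T) (\<lambda>(x, t). t_deriv T f x t)"
    by (rule continuous_on_eq[OF c(3)]) (auto simp: td)
  moreover have "(\<lambda>y. f y t) differentiable (at x)" if "(x, t) \<in> strip T" for x t
    using x[OF that] by (auto simp: real_differentiable_def)
  moreover have "f x differentiable (at t within {0..T})" if "(x, t) \<in> strip T" for x t
    using t[OF that] real_differentiable_def differentiable_at_withinI by blast
  ultimately show "C11 T f"
    using c(1) unfolding C11_def C10_def by auto
qed

lemma integral_by_parts_compact_support:
  fixes a a' w w' :: "real \<Rightarrow> real"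
  assumes "\<And>y. (a has_real_derivative a' y) (at y)" "\<And>y. (w has_real_derivative w' y) (at y)"
    and "continuous_on UNIV a'" "continuous_on UNIV w'"
    and "\<And>y. \<bar>y\<bar> > R \<Longrightarrow> a y = 0" "\<And>y. \<bar>y\<bar> > R \<Longrightarrow> a' y = 0" "R > 0"
  shows "(LINT y|lborel. a y * w' y) = - (LINT y|lborel. a' y * w y)"
    and "integrable lborel (\<lambda>y. a y * w' y)"
proof -
  \<comment> \<open>The hypotheses give zeros only for \<open>\<bar>y\<bar> > R\<close>, so the
    boundary terms are taken one unit further out.\<close>
  define I where "I = {- (R + 1)..R + 1}"
  have ca: "continuous_on UNIV a" "continuous_on UNIV w"
    using assms(1,2) by (auto simp: continuous_on_eq_continuous_at intro: DERIV_isCont)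
  have comp: "integrable lborel (\<lambda>y. indicator I y *\<^sub>R (f y * g y))"
    if "continuous_on UNIV f" "continuous_on UNIV g" for f g :: "real \<Rightarrow> real"
    unfolding I_def
    by (intro borel_integrable_compact continuous_intros)
      (use that in \<open>auto intro: continuous_on_subset\<close>)
  have aI: "indicator I y *\<^sub>R (a y * w' y) = a y * w' y" "indicator I y *\<^sub>R (a' y * w y) = a' y * w y" for y
  proof -
    have "y \<in> I" if "\<not> \<bar>y\<bar> > R" using that by (auto simp: I_def)
    then show "indicator I y *\<^sub>R (a y * w' y) = a y * w' y" "indicator I y *\<^sub>R (a' y * w y) = a' y * w y"
      using assms(5,6)[of y] by (cases "\<bar>y\<bar> > R"; simp)+
  qed
  have sum: "indicator I y *\<^sub>R (a' y * w y + a y * w' y) = a y * w' y + a' y * w y" for y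
    by (simp only: scaleR_add_right aI add.commute)
  have i1: "integrable lborel (\<lambda>y. a y * w' y)"
    using comp[OF ca(1) assms(4)] by (simp only: aI)
  have i2: "integrable lborel (\<lambda>y. a' y * w y)"
    using comp[OF assms(3) ca(2)] by (simp only: aI)
  have "(LINT y|lborel. a y * w' y) + (LINT y|lborel. a' y * w y)
      = (LINT y|lborel. indicator I y *\<^sub>R (a' y * w y + a y * w' y))"
    using i1 i2
    by (subst Bochner_Integration.integral_add[symmetric])
      (simp_all only: sum)
  also have "\<dots> = a (R + 1) * w (R + 1) - a (- (R + 1)) * w (- (R + 1))"
    unfolding I_def
  proof (rule integral_FTC_atLeastAtMost)
    show "((\<lambda>y. a y * w y) has_vector_derivative a' y * w y + a y * w' y)
        (at y within {- (R + 1)..R + 1})" for y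
      using DERIV_mult[OF assms(1,2)] 
      by (auto simp: has_real_derivative_iff_has_vector_derivative[symmetric] mult.commute add.commute
          intro: has_field_derivative_at_within)
    show "continuous_on {- (R + 1)..R + 1} (\<lambda>y. a' y * w y + a y * w' y)"
      by (intro continuous_intros) (use assms ca in \<open>auto intro: continuous_on_subset\<close>)
  qed (use assms(7) in auto)
  also have "\<dots> = 0" using assms(5,7) by simp
  finally show "(LINT y|lborel. a y * w' y) = - (LINT y|lborel. a' y * w y)" by simp
  show "integrable lborel (\<lambda>y. a y * w' y)" by (rule i1)
qed

lemma integrable_strip_dominated:
  fixes h :: "real \<times> real \<Rightarrow> real"
  assumes [measurable]: "h \<in> borel_measurable (lborel \<Otimes>\<^sub>M lborel)"
    and k: "integrable lborel k"
    and "\<And>s y. \<bar>h (s, y)\<bar> \<le> indicator {a..b} s * k y"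
  shows "integrable (lborel \<Otimes>\<^sub>M lborel) h"
proof (rule Bochner_Integration.integrable_bound)
  have [measurable]: "k \<in> borel_measurable lborel" using k by (rule borel_measurable_integrable)
  have "integrable lborel (indicator {a..b} :: real \<Rightarrow> real)" by (simp add: integrable_indicator_iff emeasure_lborel_Icc_eq)
  then show "integrable (lborel \<Otimes>\<^sub>M lborel) (\<lambda>(s :: real, y). indicator {a..b} s * k y)"
    by (intro lborel_pair.Fubini_integrable) (use k in \<open>auto simp: abs_mult\<close>)
  show "AE x in lborel \<Otimes>\<^sub>M lborel. norm (h x) \<le> norm (case x of (s, y) \<Rightarrow> indicator {a..b} s * k y)"
    using assms(3) by (auto intro!: AE_I2 order.trans[OF _ abs_ge_self])
qed measurable

text \<open>The substitution \<open>y = x + sqrt \<tau> * z\<close> freezes the kernel at width 1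
  and moves \<tau> into the argument of \<open>g\<close>, where continuity and dominated convergence
  apply.\<close>

lemma LIMSEQ_heat_kernel_integral:
  assumes g: "continuous_on UNIV g" and M: "\<And>y. \<bar>g y\<bar> \<le> M"
  shows "(\<lambda>n. LINT y|lborel. heat_kernel (inverse (real (Suc n))) (x - y) * g y) \<longlonglongrightarrow> g x"
proof -
  have [measurable]: "g \<in> borel_measurable borel"
    using g by (rule borel_measurable_continuous_onI)
  have subst: "(LINT y|lborel. heat_kernel \<tau> (x - y) * g y)
      = (LINT z|lborel. heat_kernel 1 (0 - z) * g (x + sqrt \<tau> * z))" if "\<tau> > 0" for \<tau>
  proof -
    have "sqrt \<tau> * heat_kernel \<tau> (x - (x + sqrt \<tau> * z)) = heat_kernel 1 (0 - z)" for z
      using that by (simp add: heat_kernel_def power_mult_distrib real_sqrt_mult)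
    moreover have "(LINT y|lborel. heat_kernel \<tau> (x - y) * g y) = (LINT z|lborel.
        (sqrt \<tau> * heat_kernel \<tau> (x - (x + sqrt \<tau> * z))) * g (x + sqrt \<tau> * z))"
      using that by (subst lborel_integral_real_affine[where t = x and c = "sqrt \<tau>"])
        (auto simp: mult.assoc)
    ultimately show ?thesis by simp
  qed
  have "(\<lambda>n. LINT z|lborel. heat_kernel 1 (0 - z) * g (x + sqrt (inverse (real (Suc n))) * z))
      \<longlonglongrightarrow> (LINT z|lborel. heat_kernel 1 (0 - z) * g x)"
  proof (rule integral_dominated_convergence)
    show "integrable lborel (\<lambda>z. heat_kernel 1 (0 - z) * M)"
      by (intro integrable_mult_left integrable_heat_kernel) simp
    have "(\<lambda>n. x + sqrt (inverse (real (Suc n))) * z) \<longlonglongrightarrow> x" for z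
      using tendsto_add[OF tendsto_const[of x]
        tendsto_mult[OF tendsto_real_sqrt[OF LIMSEQ_inverse_real_of_nat] tendsto_const[of z]]]
      by simp
    then show "AE z in lborel. (\<lambda>n. heat_kernel 1 (0 - z) * g (x + sqrt (inverse (real (Suc n))) * z))
        \<longlonglongrightarrow> heat_kernel 1 (0 - z) * g x"
      using g by (auto intro!: AE_I2 tendsto_intros continuous_on_tendsto_compose[where f = g and s = UNIV])
    show "AE z in lborel. norm (heat_kernel 1 (0 - z) * g (x + sqrt (inverse (real (Suc n))) * z))
        \<le> heat_kernel 1 (0 - z) * M" for n
      using M heat_kernel_pos[of 1] by (auto intro!: AE_I2 mult_left_mono simp: abs_mult less_imp_le)
  qed measurable
  then show ?thesis
    using integral_heat_kernel[of 1 0] by (simp add: subst del: of_nat_Suc)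
qed

text \<open>With \<open>J = \<integral>\<^sub>0\<^sup>t B\<close>, subtracting the hypothesis at \<open>r < t\<close> from the one at \<open>t\<close> leaves
  \<open>\<integral>\<^sub>r\<^sup>t (A s + J + (r - s) B s) ds = 0\<close>, which fixes the sign of \<open>A t + J\<close> as \<open>r\<close> tends to \<open>t\<close>.\<close>

lemma weighted_integrals_zero_le:
  fixes A B :: "real \<Rightarrow> real"
  assumes "t > 0" and A: "continuous_on {0..t} A"
    and B [measurable]: "B \<in> borel_measurable borel" and C: "\<And>s. s \<in> {0..t} \<Longrightarrow> \<bar>B s\<bar> \<le> C"
    and eq: "\<And>r. 0 < r \<Longrightarrow> r \<le> t \<Longrightarrow> (LINT s:{0..r}|lborel. A s + (r - s) * B s) = 0"
  shows "A t + (LINT s:{0..t}|lborel. B s) \<le> 0"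
proof (rule ccontr)
  define J where "J = (LINT s:{0..t}|lborel. B s)"
  define e where "e = A t + J"
  assume "\<not> A t + (LINT s:{0..t}|lborel. B s) \<le> 0"
  then have e: "e > 0" by (simp add: e_def J_def)
  have "C \<ge> 0" using C[of t] assms(1) by auto
  have Bint: "set_integrable lborel S B" if "S \<subseteq> {0..t}" "S \<in> sets borel" for S
    unfolding set_integrable_def
  proof (rule Bochner_Integration.integrable_bound)
    show "integrable lborel (\<lambda>s. indicator {0..t} s * C)"
      by (intro integrable_mult_left) (simp add: integrable_indicator_iff emeasure_lborel_Icc_eq)
    show "AE s in lborel. norm (indicator S s *\<^sub>R B s) \<le> norm (indicator {0..t} s * C)"
      using that C by (auto intro!: AE_I2 simp: indicator_def abs_mult intro: order.trans[OF _ abs_ge_self])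
  qed (use that in measurable)
  have sBint: "set_integrable lborel S (\<lambda>s. (r - s) * B s)"
    if "S \<subseteq> {0..t}" "S \<in> sets borel" "0 \<le> r" "r \<le> t" for S r
    unfolding set_integrable_def
  proof (rule Bochner_Integration.integrable_bound)
    show "integrable lborel (\<lambda>s. indicator {0..t} s * (t * C))"
      by (intro integrable_mult_left) (simp add: integrable_indicator_iff emeasure_lborel_Icc_eq)
    have "\<bar>r - s\<bar> * \<bar>B s\<bar> \<le> t * C" if "s \<in> {0..t}" for s
      using that C \<open>0 \<le> r\<close> \<open>r \<le> t\<close> by (intro mult_mono) auto
    then show "AE s in lborel. norm (indicator S s *\<^sub>R ((r - s) * B s)) \<le> norm (indicator {0..t} s * (t * C))"
      using that \<open>C \<ge> 0\<close> by (auto intro!: AE_I2 simp: indicator_def abs_mult)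
  qed (use that in measurable)
  have Aint: "set_integrable lborel S A" if "S \<subseteq> {0..t}" "S \<in> sets borel" for S
    using borel_integrable_atLeastAtMost'[OF A] set_integrable_subset that by (metis sets_lborel)
  obtain d where d: "d > 0" "\<And>s. s \<in> {0..t} \<Longrightarrow> \<bar>s - t\<bar> < d \<Longrightarrow> \<bar>A s - A t\<bar> < e / 2"
    using A[unfolded continuous_on_iff, rule_format, of t "e / 2"] assms(1) e
    by (auto simp: dist_real_def)
  \<comment> \<open>The three entries keep \<open>r = t - h\<close> positive, keep \<open>A\<close>
    within \<open>e / 2\<close> of \<open>A t\<close> on the last piece, and make
    \<open>h * C\<close> at most \<open>e / 4\<close>; \<open>C + 1\<close> avoids a division by
    zero.\<close>
  define h where "h = min (t / 2) (min (d / 2) (e / (4 * (C + 1))))"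
  have h: "h > 0" "h < t" "h < d" using assms(1) d e \<open>C \<ge> 0\<close> by (auto simp: h_def)
  have hC: "h * C \<le> e / 4"
  proof -
    have "h * C \<le> e / (4 * (C + 1)) * (C + 1)"
      using h \<open>C \<ge> 0\<close> e by (intro mult_mono) (auto simp: h_def)
    also have "\<dots> = e / 4" using \<open>C \<ge> 0\<close> by (simp add: field_simps)
    finally show ?thesis .
  qed
  define r where "r = t - h"
  have r: "0 < r" "r < t" using h by (auto simp: r_def)
  have un: "{0..t} = {0..r} \<union> {r<..t}" "{0..r} \<inter> {r<..t} = {}" using r by auto
  have split: "(LINT s:{0..t}|lborel. f s) = (LINT s:{0..r}|lborel. f s) + (LINT s:{r<..t}|lborel. f s)"
    if "set_integrable lborel {0..r} f" "set_integrable lborel {r<..t} f" for f :: "real \<Rightarrow> real"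
    unfolding un(1) by (rule set_integral_Un[OF un(2) that])
  have sub: "{0..r} \<subseteq> {0..t}" "{r<..t} \<subseteq> {0..t}" using r by auto
  let ?I = "{0..r}" and ?K = "{r<..t}"
  note ints = Aint[OF sub(1)] Aint[OF sub(2)] Bint[OF sub(1)] Bint[OF sub(2)]
    sBint[OF sub(1)] sBint[OF sub(2)]
  have cK: "set_integrable lborel ?K (\<lambda>s. c)" for c :: real
    using r by (simp add: set_integrable_def integrable_indicator_iff emeasure_lborel_Ioc)
  have cKi: "(LINT s:?K|lborel. c) = h * c" for c :: real
    using r by (simp add: set_lebesgue_integral_def r_def)
  have "0 = (LINT s:{0..t}|lborel. A s + (t - s) * B s) - (LINT s:?I|lborel. A s + (r - s) * B s)"
    using eq[of t] eq[of r] r assms(1) by simp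
  also have "\<dots> = (LINT s:?K|lborel. A s) + (LINT s:?I|lborel. (t - s) * B s - (r - s) * B s)
      + (LINT s:?K|lborel. (t - s) * B s)"
    using ints r by (subst split) (auto simp: set_integral_add set_integral_diff)
  also have "(LINT s:?I|lborel. (t - s) * B s - (r - s) * B s) = (LINT s:?I|lborel. h * B s)"
    by (intro set_lebesgue_integral_cong) (auto simp: r_def algebra_simps)
  also have "(LINT s:?I|lborel. h * B s) = h * J - (LINT s:?K|lborel. h * B s)"
    using split[of B] ints by (simp add: J_def algebra_simps)
  \<comment> \<open>The interval \<open>?K\<close> has length \<open>h\<close>, so
    \<open>h * J\<close> is the integral of the constant \<open>J\<close> over it. What remains
    beside \<open>A s + J\<close> is \<open>- (s - r) * B s\<close>, of size at most
    \<open>h * C\<close>.\<close>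
  also have "(LINT s:?K|lborel. A s) + (h * J - (LINT s:?K|lborel. h * B s)) + (LINT s:?K|lborel. (t - s) * B s)
      = (LINT s:?K|lborel. A s + J + ((t - s) * B s - h * B s))"
    using ints r cK cKi by (subst set_integral_add set_integral_diff; simp add: set_integral_diff set_integral_add)+
  also have "\<dots> \<ge> (LINT s:?K|lborel. e / 4)"
  proof (rule set_integral_mono)
    show "set_integrable lborel ?K (\<lambda>s. A s + J + ((t - s) * B s - h * B s))"
      using ints r cK by (auto intro!: set_integral_add set_integral_diff)
    fix s assume s: "s \<in> ?K"
    have "\<bar>(t - s) * B s - h * B s\<bar> = (s - r) * \<bar>B s\<bar>"
      using s by (simp add: r_def left_diff_distrib[symmetric] abs_mult)
    also have "\<dots> \<le> h * C"
      using s r C h by (intro mult_mono) (auto simp: r_def)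
    finally have "\<bar>(t - s) * B s - h * B s\<bar> \<le> e / 4" using hC by simp
    moreover have "\<bar>A s - A t\<bar> < e / 2"
      using s r h by (intro d(2)) (auto simp: r_def)
    ultimately show "e / 4 \<le> A s + J + ((t - s) * B s - h * B s)"
      unfolding e_def by (simp add: abs_if split: if_splits)
  qed (rule cK)
  finally show False using cKi[of "e / 4"] h e by (simp add: mult_le_0_iff)
qed

text \<open>The one-sided estimate is applied to \<open>A\<close>, \<open>B\<close> and to their
  negatives. Continuity is asked of \<open>A\<close> only: it will be an average of the continuous
  \<open>w\<close>, whereas \<open>B\<close> averages a source that is merely measurable in
  time.\<close>

lemma weighted_integrals_zero:
  fixes A B :: "real \<Rightarrow> real"
  assumes "t > 0" and A: "continuous_on {0..t} A"
    and B [measurable]: "B \<in> borel_measurable borel" and C: "\<And>s. s \<in> {0..t} \<Longrightarrow> \<bar>B s\<bar> \<le> C"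
    and eq: "\<And>r. 0 < r \<Longrightarrow> r \<le> t \<Longrightarrow> (LINT s:{0..r}|lborel. A s + (r - s) * B s) = 0"
  shows "A t = - (LINT s:{0..t}|lborel. B s)"
proof -
  have "- A t + (LINT s:{0..t}|lborel. - B s) \<le> 0"
  proof (rule weighted_integrals_zero_le[OF assms(1)])
    show "(LINT s:{0..r}|lborel. - A s + (r - s) * - B s) = 0" if "0 < r" "r \<le> t" for r
    proof -
      have "indicator {0..r} s *\<^sub>R (- A s + (r - s) * - B s)
          = - (indicator {0..r} s *\<^sub>R (A s + (r - s) * B s))" for s
        by (simp add: algebra_simps)
      then show ?thesis
        using eq[OF that] by (simp only: set_lebesgue_integral_def Bochner_Integration.integral_minus)
    qed
  qed (use C A in \<open>auto intro: continuous_intros\<close>)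
  then have "- A t - (LINT s:{0..t}|lborel. B s) \<le> 0"
    by (simp add: set_lebesgue_integral_def)
  with weighted_integrals_zero_le[OF assms] show ?thesis by simp
qed

subsection \<open>Duhamel's formula\<close>

text \<open>Product integrals have time as first coordinate, because the weak formulation integrates
  over space inside and over time outside; strips have space first.\<close>

lemma continuous_on_strip_swap:
  assumes "continuous_on (strip T) (\<lambda>(x, t). f x t)" "S \<subseteq> {0..T} \<times> UNIV"
  shows "continuous_on S (\<lambda>(s, y). f y s)"
proof -
  have "continuous_on S (\<lambda>z. case (snd z, fst z) of (x, t) \<Rightarrow> f x t)"
    using assms(2)
    by (intro continuous_on_compose2[OF assms(1), where f = "\<lambda>z. (snd z, fst z)"] continuous_intros)
      (auto simp: strip_def)
  then show ?thesis by (simp add: case_prod_unfold)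
qed

text \<open>The shift \<epsilon> keeps the kernel away from its singularity at \<open>s = t\<close>.
  All estimates are made for positive \<epsilon> with bounds independent of it. The source of the
  heat equation is \<open>- F\<close>, so it is \<open>- w\<close> that arises in the limit.\<close>

definition duhamel :: "(real \<Rightarrow> real \<Rightarrow> real) \<Rightarrow> real \<Rightarrow> real \<Rightarrow> real \<Rightarrow> real" where
  "duhamel F x t \<epsilon> = (LINT s:{0..t}|lborel. LINT y|lborel. heat_kernel (t + \<epsilon> - s) (x - y) * F y s)"

text \<open>The weak form of \<open>w_t = w_xx - F\<close> with zero initial values, which are
  encoded by test functions that need not vanish at time 0. The integrals are over
  \<open>lborel\<close> instead of \<open>lebesgue\<close>, so that Fubini applies directly.\<close>

definition weak_heat :: "real \<Rightarrow> (real \<Rightarrow> real \<Rightarrow> real) \<Rightarrow> (real \<Rightarrow> real \<Rightarrow> real) \<Rightarrow> bool" where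
  "weak_heat T w F \<longleftrightarrow> (\<forall>\<phi>. test_function T \<phi> \<longrightarrow>
     (LINT s:{0..T}|lborel. LINT y|lborel. t_deriv T \<phi> y s * w y s)
     = (LINT s:{0..T}|lborel. LINT y|lborel. x_deriv \<phi> y s * x_deriv w y s + F y s * \<phi> y s))"

text \<open>The weak form is assumed for every final time up to \<open>T\<close> because the
  weighted identity is exploited for all \<open>r \<le> t\<close>. \<open>F\<close> is Borel and
  bounded everywhere rather than almost everywhere, so no null sets enter the estimates.\<close>

locale weak_heat_solution =
  fixes T M C :: real and w F :: "real \<Rightarrow> real \<Rightarrow> real"
  assumes C10: "C10 T w"
    and bound: "\<And>y s. (y, s) \<in> strip T \<Longrightarrow> \<bar>w y s\<bar> \<le> M"
    and F_measurable [measurable]: "(\<lambda>(y, s). F y s) \<in> borel_measurable borel"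
    and F_bound: "\<And>y s. \<bar>F y s\<bar> \<le> C"
    and weak: "\<And>t. 0 < t \<Longrightarrow> t \<le> T \<Longrightarrow> weak_heat t w F"
begin

lemma F_measurable' [measurable (raw)]:
  assumes "f \<in> borel_measurable N" "g \<in> borel_measurable N"
  shows "(\<lambda>x. F (f x) (g x)) \<in> borel_measurable N"
  using measurable_compose[OF borel_measurable_Pair[OF assms] F_measurable] by simp

lemma C_nonneg: "C \<ge> 0"
  using F_bound[of 0 0] by (rule order.trans[OF abs_ge_zero])

text \<open>The test function is \<open>(r - s) k \<chi>\<close> with the backward heat kernel \<open>k\<close> and the cutoff \<open>\<chi>\<close>: the
  first factor makes it vanish at the final time \<open>r\<close>, and all terms with second derivatives of \<open>k\<close>
  cancel.\<close>

lemma duhamel_cutoff: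
  assumes r: "0 < r" "r \<le> t" "t \<le> T" "\<epsilon> > 0" and R: "R > 0"
  shows "(LINT z|(lborel \<Otimes>\<^sub>M lborel). (\<lambda>(s, y). indicator {0..r} s * (
      heat_kernel (t + \<epsilon> - s) (x - y) * cutoff R y * w y s
      - (r - s) * ((x - y) / (t + \<epsilon> - s) * heat_kernel (t + \<epsilon> - s) (x - y) * cutoff' R y
          + heat_kernel (t + \<epsilon> - s) (x - y) * cutoff'' R y) * w y s
      + (r - s) * (F y s * heat_kernel (t + \<epsilon> - s) (x - y) * cutoff R y))) z) = 0"
proof -
  define k where "k y s = heat_kernel (t + \<epsilon> - s) (x - y)" for y s
  define kx where "kx y s = (x - y) / (2 * (t + \<epsilon> - s)) * k y s" for y s
  define kxx where "kxx y s = ((x - y)\<^sup>2 / (4 * (t + \<epsilon> - s)\<^sup>2) - 1 / (2 * (t + \<epsilon> - s))) * k y s" for y s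
  have pos: "t + \<epsilon> - s > 0" if "s \<le> r" for s using r that by simp
  have dk: "((\<lambda>y. k y s) has_real_derivative kx y s) (at y)"
    and dkx: "((\<lambda>y. kx y s) has_real_derivative kxx y s) (at y)"
    and dks: "(k y has_real_derivative - kxx y s) (at s)" if "s \<le> r" for y s
  proof -
    have 1: "((\<lambda>y. x - y) has_real_derivative - 1) (at y)"
      by (auto intro!: derivative_eq_intros)
    show "((\<lambda>y. k y s) has_real_derivative kx y s) (at y)"
      using DERIV_chain2[OF heat_kernel_deriv_space[OF pos[OF that]] 1]
      unfolding k_def kx_def by (rule DERIV_cong) (simp add: divide_inverse ring_distribs)
    have kx: "(\<lambda>y. kx y s) = (\<lambda>y. - (- (x - y) / (2 * (t + \<epsilon> - s)) * heat_kernel (t + \<epsilon> - s) (x - y)))"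
      unfolding kx_def k_def by (simp only: minus_divide_left[symmetric] mult_minus_left minus_minus)
    show "((\<lambda>y. kx y s) has_real_derivative kxx y s) (at y)"
      using DERIV_minus[OF DERIV_chain2[OF heat_kernel_deriv_space_space[OF pos[OF that]] 1]]
      unfolding kx kxx_def k_def by simp
    have 2: "((\<lambda>s. t + \<epsilon> - s) has_real_derivative - 1) (at s)"
      by (auto intro!: derivative_eq_intros)
    show "(k y has_real_derivative - kxx y s) (at s)"
      using DERIV_chain2[OF heat_kernel_deriv_time[OF pos[OF that]] 2]
      unfolding k_def[abs_def] kxx_def by simp
  qed
  have cont_k: "continuous_on (strip r) (\<lambda>(y, s). k y s)" "continuous_on (strip r) (\<lambda>(y, s). kx y s)"
      "continuous_on (strip r) (\<lambda>(y, s). kxx y s)"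
    unfolding kxx_def kx_def k_def heat_kernel_def case_prod_unfold using r
    by (auto intro!: continuous_intros simp: strip_def)
  define \<phi> where "\<phi> y s = (r - s) * (k y s * cutoff R y)" for y s
  define \<phi>x where "\<phi>x y s = (r - s) * (kx y s * cutoff R y + k y s * cutoff' R y)" for y s
  define \<phi>xx where "\<phi>xx y s
    = (r - s) * (kxx y s * cutoff R y + 2 * (kx y s * cutoff' R y) + k y s * cutoff'' R y)" for y s
  define \<phi>t where "\<phi>t y s = - (k y s * cutoff R y) - (r - s) * (kxx y s * cutoff R y)" for y s
  note dc = cutoff_deriv[OF R] cutoff'_deriv[OF R]
  have d\<phi>: "((\<lambda>y. \<phi> y s) has_real_derivative \<phi>x y s) (at y)"
    and d\<phi>x: "((\<lambda>y. \<phi>x y s) has_real_derivative \<phi>xx y s) (at y)"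
    and d\<phi>s: "(\<phi> y has_real_derivative \<phi>t y s) (at s)" if "s \<le> r" for y s
    unfolding \<phi>_def[abs_def] \<phi>x_def[abs_def] \<phi>xx_def[abs_def] \<phi>t_def[abs_def]
    by (auto intro!: derivative_eq_intros dk[OF that] dkx[OF that] dks[OF that] dc simp: algebra_simps)
  note cont_k' = cont_k[unfolded case_prod_unfold]
  have cont_\<phi>: "continuous_on (strip r) (\<lambda>(y, s). \<phi> y s)" "continuous_on (strip r) (\<lambda>(y, s). \<phi>x y s)"
      "continuous_on (strip r) (\<lambda>(y, s). \<phi>xx y s)" "continuous_on (strip r) (\<lambda>(y, s). \<phi>t y s)"
    unfolding \<phi>_def \<phi>x_def \<phi>xx_def \<phi>t_def case_prod_unfold
    by (intro continuous_intros cont_k')+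
  have outside: "\<phi> y s = 0" "\<phi>x y s = 0" "\<phi>xx y s = 0" "\<phi>t y s = 0" if "\<bar>y\<bar> > R" for y s
    using cutoff_outside[OF R that] by (auto simp: \<phi>_def \<phi>x_def \<phi>xx_def \<phi>t_def)
  have strip_le: "s \<le> r" if "(y, s) \<in> strip r" for y s using that by (auto simp: strip_def)
  have C11: "C11 r \<phi>" and x_eq: "\<And>y s. (y, s) \<in> strip r \<Longrightarrow> x_deriv \<phi> y s = \<phi>x y s"
    and t_eq: "\<And>y s. (y, s) \<in> strip r \<Longrightarrow> t_deriv r \<phi> y s = \<phi>t y s"
    using C11I[OF r(1) d\<phi> d\<phi>s cont_\<phi>(1,2,4)] strip_le by auto
  have "test_function r \<phi>"
    unfolding test_function_def using C11 outside(1) by (auto simp: \<phi>_def)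
  then have "(LINT s:{0..r}|lborel. LINT y|lborel. t_deriv r \<phi> y s * w y s)
     = (LINT s:{0..r}|lborel. LINT y|lborel. x_deriv \<phi> y s * x_deriv w y s + F y s * \<phi> y s)"
    using weak[of r] r by (auto simp: weak_heat_def)
  also have "(LINT s:{0..r}|lborel. LINT y|lborel. t_deriv r \<phi> y s * w y s)
     = (LINT s|lborel. LINT y|lborel. indicator {0..r} s * (\<phi>t y s * w y s))"
    unfolding set_lebesgue_integral_def
    by (intro Bochner_Integration.integral_cong) (auto simp: indicator_def t_eq strip_def)
  also have "(LINT s:{0..r}|lborel. LINT y|lborel. x_deriv \<phi> y s * x_deriv w y s + F y s * \<phi> y s)
     = (LINT s|lborel. LINT y|lborel. indicator {0..r} s * (F y s * \<phi> y s - \<phi>xx y s * w y s))"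
    unfolding set_lebesgue_integral_def
  proof (intro Bochner_Integration.integral_cong refl)
    fix s :: real
    show "indicator {0..r} s *\<^sub>R (LINT y|lborel. x_deriv \<phi> y s * x_deriv w y s + F y s * \<phi> y s)
       = (LINT y|lborel. indicator {0..r} s * (F y s * \<phi> y s - \<phi>xx y s * w y s))"
    proof (cases "s \<in> {0..r}")
      case True
      have C10r: "C10 r \<phi>" using C11 by (simp add: C11_def)
      have s: "0 \<le> s" "s \<le> r" "s \<le> T" using True r by auto
      note wd = C10D[OF C10 s(1,3)] and fd = C10D[OF C10r s(1,2)]
      have cs: "continuous_on UNIV (\<lambda>y. f y s)" if "continuous_on (strip r) (\<lambda>(y, s). f y s)" for f
      proof -
        have "continuous_on UNIV (\<lambda>y. (y, s))" by (intro continuous_intros)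
        moreover have "range (\<lambda>y. (y, s)) \<subseteq> strip r" using s by (auto simp: strip_def)
        ultimately show ?thesis
          using continuous_on_compose2[OF that] by fastforce
      qed
      have compact: "integrable lborel (\<lambda>y. a y * b y)"
        if "continuous_on UNIV a" "continuous_on UNIV b" "\<And>y. \<bar>y\<bar> > R \<Longrightarrow> a y = 0" for a b :: "real \<Rightarrow> real"
      proof -
        have "integrable lborel (\<lambda>y. indicator {-R..R} y *\<^sub>R (a y * b y))"
          by (intro borel_integrable_compact continuous_intros)
            (use that in \<open>auto intro: continuous_on_subset\<close>)
        moreover have "indicator {-R..R} y *\<^sub>R (a y * b y) = a y * b y" for y
        proof (cases "\<bar>y\<bar> > R")
          case False
          then have "y \<in> {-R..R}" by auto
          then show ?thesis by simp
        qed (simp add: that(3))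
        ultimately show ?thesis by (simp only:)
      qed
      \<comment> \<open>The space derivative is moved off \<open>w\<close>, since \<open>w\<close>
        is bounded but nothing bounds \<open>x_deriv w\<close> when the cutoff is removed.\<close>
      have ibp: "(LINT y|lborel. \<phi>x y s * x_deriv w y s) = - (LINT y|lborel. \<phi>xx y s * w y s)"
        "integrable lborel (\<lambda>y. \<phi>x y s * x_deriv w y s)"
        using integral_by_parts_compact_support[where a = "\<lambda>y. \<phi>x y s" and a' = "\<lambda>y. \<phi>xx y s"
            and w = "\<lambda>y. w y s" and w' = "\<lambda>y. x_deriv w y s" and R = R]
          d\<phi>x[OF s(2)] wd cs[OF cont_\<phi>(3)] outside R by auto
      have i1: "integrable lborel (\<lambda>y. \<phi>xx y s * w y s)"
        by (rule compact) (use wd cs[OF cont_\<phi>(3)] outside in auto)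
      have i2: "integrable lborel (\<lambda>y. F y s * \<phi> y s)"
      proof (rule Bochner_Integration.integrable_bound)
        show "integrable lborel (\<lambda>y. \<phi> y s * C)"
          by (rule compact) (use cs[OF cont_\<phi>(1)] outside in auto)
        have [measurable]: "(\<lambda>y. \<phi> y s) \<in> borel_measurable borel"
          using cs[OF cont_\<phi>(1)] by (rule borel_measurable_continuous_onI)
        show "(\<lambda>y. F y s * \<phi> y s) \<in> borel_measurable lborel" by measurable
        show "AE y in lborel. norm (F y s * \<phi> y s) \<le> norm (\<phi> y s * C)"
          using F_bound C_nonneg by (auto intro!: AE_I2 simp: abs_mult mult.commute[of _ C] mult_right_mono)
      qed
      have "(LINT y|lborel. x_deriv \<phi> y s * x_deriv w y s + F y s * \<phi> y s)
          = (LINT y|lborel. \<phi>x y s * x_deriv w y s + F y s * \<phi> y s)"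
        using True by (intro Bochner_Integration.integral_cong) (auto simp: x_eq strip_def)
      also have "\<dots> = (LINT y|lborel. F y s * \<phi> y s - \<phi>xx y s * w y s)"
        using ibp i1 i2 by simp
      finally show ?thesis using True by simp
    qed simp
  qed
  finally have weak': "(LINT s|lborel. LINT y|lborel. indicator {0..r} s * (\<phi>t y s * w y s))
     = (LINT s|lborel. LINT y|lborel. indicator {0..r} s * (F y s * \<phi> y s - \<phi>xx y s * w y s))" .
  have compact: "integrable (lborel \<Otimes>\<^sub>M lborel) (\<lambda>(s, y). indicator {0..r} s * (a y s * b y s))"
    if "continuous_on (strip r) (\<lambda>(y, s). a y s)" "continuous_on (strip r) (\<lambda>(y, s). b y s)"
      "\<And>y s. \<bar>y\<bar> > R \<Longrightarrow> a y s = 0" for a b :: "real \<Rightarrow> real \<Rightarrow> real"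
  proof -
    let ?S = "{0..r} \<times> {-R..R}"
    have S: "?S \<subseteq> {0..r} \<times> UNIV" by auto
    have "compact ?S" by (intro compact_Times compact_Icc)
    then have "integrable lborel (\<lambda>z. indicator ?S z *\<^sub>R ((\<lambda>(s, y). a y s) z * (\<lambda>(s, y). b y s) z))"
      by (rule borel_integrable_compact)
        (intro continuous_on_mult continuous_on_strip_swap[OF that(1) S] continuous_on_strip_swap[OF that(2) S])
    moreover have "indicator ?S z *\<^sub>R ((\<lambda>(s, y). a y s) z * (\<lambda>(s, y). b y s) z)
        = (\<lambda>(s, y). indicator {0..r} s * (a y s * b y s)) z" for z
    proof (cases "\<bar>snd z\<bar> > R")
      case False
      then have "snd z \<in> {-R..R}" by auto
      then show ?thesis by (simp add: indicator_times case_prod_unfold)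
    qed (simp add: that(3) case_prod_unfold)
    ultimately show ?thesis by (simp only: lborel_prod)
  qed
  have C10r: "C10 r w" using C10_mono[OF C10] r by simp
  have cw: "continuous_on (strip r) (\<lambda>(y, s). w y s)" using C10r by (simp add: C10_def)
  have j1: "integrable (lborel \<Otimes>\<^sub>M lborel) (\<lambda>(s, y). indicator {0..r} s * (\<phi>t y s * w y s))"
    by (rule compact[OF cont_\<phi>(4) cw outside(4)])
  have j2: "integrable (lborel \<Otimes>\<^sub>M lborel) (\<lambda>(s, y). indicator {0..r} s * (\<phi>xx y s * w y s))"
    by (rule compact[OF cont_\<phi>(3) cw outside(3)])
  have j3: "integrable (lborel \<Otimes>\<^sub>M lborel) (\<lambda>(s, y). indicator {0..r} s * (F y s * \<phi> y s))"
  proof (rule Bochner_Integration.integrable_bound)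
    show *: "integrable (lborel \<Otimes>\<^sub>M lborel) (\<lambda>(s, y). indicator {0..r} s * (\<phi> y s * C))"
      by (rule compact[OF cont_\<phi>(1) _ outside(1)]) auto
    have "(\<lambda>(s, y). indicator {0..r} s * (F y s * \<phi> y s)) = (\<lambda>z. F (snd z) (fst z) *
        (\<lambda>(s, y). indicator {0..r} s * (\<phi> y s * 1)) z)"
      by (auto simp: fun_eq_iff)
    \<comment> \<open>Applying \<open>compact\<close> with second factor 1 yields joint
      measurability of the truncated test function.\<close>
    moreover have [measurable]: "(\<lambda>(s, y). indicator {0..r} s * (\<phi> y s * 1)) \<in> borel_measurable (lborel \<Otimes>\<^sub>M lborel)"
      using compact[OF cont_\<phi>(1) _ outside(1), of "\<lambda>y s. 1"] borel_measurable_integrable by auto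
    ultimately show "(\<lambda>(s, y). indicator {0..r} s * (F y s * \<phi> y s)) \<in> borel_measurable (lborel \<Otimes>\<^sub>M lborel)"
      by simp
    show "AE z in lborel \<Otimes>\<^sub>M lborel. norm (case z of (s, y) \<Rightarrow> indicator {0..r} s * (F y s * \<phi> y s))
        \<le> norm (case z of (s, y) \<Rightarrow> indicator {0..r} s * (\<phi> y s * C))"
      using F_bound C_nonneg
      by (auto intro!: AE_I2 mult_left_mono mult_right_mono simp: abs_mult mult.commute[of _ C])
  qed
  have j23: "integrable (lborel \<Otimes>\<^sub>M lborel) (\<lambda>(s, y). indicator {0..r} s * (F y s * \<phi> y s - \<phi>xx y s * w y s))"
    using Bochner_Integration.integrable_diff[OF j3 j2] by (simp add: case_prod_unfold right_diff_distrib)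
  have "(LINT z|(lborel \<Otimes>\<^sub>M lborel). (\<lambda>(s, y). indicator {0..r} s * (F y s * \<phi> y s - \<phi>xx y s * w y s)) z
      - (\<lambda>(s, y). indicator {0..r} s * (\<phi>t y s * w y s)) z) = 0"
    unfolding Bochner_Integration.integral_diff[OF j23 j1]
    using weak' lborel_pair.integral_fst'[OF j1] lborel_pair.integral_fst'[OF j23] by simp
  moreover have "(\<lambda>(s, y). indicator {0..r} s * (F y s * \<phi> y s - \<phi>xx y s * w y s)) z
      - (\<lambda>(s, y). indicator {0..r} s * (\<phi>t y s * w y s)) z
    = (\<lambda>(s, y). indicator {0..r} s * (k y s * cutoff R y * w y s
      - (r - s) * ((x - y) / (t + \<epsilon> - s) * k y s * cutoff' R y + k y s * cutoff'' R y) * w y s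
      + (r - s) * (F y s * k y s * cutoff R y))) z" for z
  proof (cases z)
    case (Pair s y)
    \<comment> \<open>The cross term \<open>2 * kx * cutoff'\<close> of the second derivative
      absorbs the 2 in the denominator of \<open>kx\<close>.\<close>
    have "a / \<tau> * c = 2 * (a / (2 * \<tau>) * c)" for a \<tau> c :: real by simp
    then have kk: "(x - y) / (t + \<epsilon> - s) * k y s = 2 * kx y s" unfolding kx_def .
    show ?thesis unfolding Pair prod.case kk
      by (simp add: \<phi>_def \<phi>xx_def \<phi>t_def algebra_simps)
  qed
  ultimately show ?thesis unfolding k_def by (simp only:)
qed

lemma w_slice:
  assumes "0 \<le> s" "s \<le> T"
  shows "continuous_on S (\<lambda>y. w y s)" and "(\<lambda>y. w y s) \<in> borel_measurable borel"
    and "\<bar>w y s\<bar> \<le> M"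
proof -
  show "continuous_on S (\<lambda>y. w y s)" for S by (rule C10D(2)[OF C10 assms])
  then show "(\<lambda>y. w y s) \<in> borel_measurable borel" by (rule borel_measurable_continuous_onI)
  show "\<bar>w y s\<bar> \<le> M" by (rule bound) (use assms in \<open>auto simp: strip_def\<close>)
qed

lemma M_nonneg: "T > 0 \<Longrightarrow> M \<ge> 0"
  using w_slice(3)[of 0 0] by linarith

text \<open>The cutoff radius tends to infinity. One multiple of the kernel of width
  \<open>2 * E\<close> dominates everything: it majorises both the kernel and its space derivative,
  the bound for the latter being what doubles the width.\<close>

lemma duhamel_weighted:
  assumes r: "0 < r" "r \<le> t" "t \<le> T" "\<epsilon> > 0"
  shows "(LINT z|(lborel \<Otimes>\<^sub>M lborel). (\<lambda>(s, y). indicator {0..r} s * (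
      heat_kernel (t + \<epsilon> - s) (x - y) * w y s
      + (r - s) * (F y s * heat_kernel (t + \<epsilon> - s) (x - y)))) z) = 0"
    (is "integral\<^sup>L _ ?f = 0")
    and "integrable (lborel \<Otimes>\<^sub>M lborel) (\<lambda>(s, y). indicator {0..r} s * (
      heat_kernel (t + \<epsilon> - s) (x - y) * w y s
      + (r - s) * (F y s * heat_kernel (t + \<epsilon> - s) (x - y))))"
proof -
  define E where "E = t + \<epsilon>"
  \<comment> \<open>\<open>P\<close> and \<open>Q\<close> compare the kernel and
    \<open>(x - y) / \<tau>\<close> times the kernel with the kernel of width \<open>2 * E\<close>,
    for widths \<tau> between \<epsilon> and \<open>E\<close>. \<open>D\<close> adds up the three
    summands, with 6 and 30 bounding the derivatives of the cutoff for radii at least 1.\<close>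
  define P where "P = sqrt (2 * E / \<epsilon>)"
  define Q where "Q = 2 * (sqrt 2 / sqrt \<epsilon> * sqrt (2 * E / (2 * \<epsilon>)))"
  define D where "D = P * M + t * ((6 * Q + 30 * P) * M) + t * (C * P)"
  have "E > 0" using r by (simp add: E_def)
  have M: "M \<ge> 0" using M_nonneg r by simp
  have nonneg: "P \<ge> 0" "Q \<ge> 0" using \<open>E > 0\<close> r by (auto simp: P_def Q_def)
  let ?k = "\<lambda>s y. heat_kernel (t + \<epsilon> - s) (x - y)"
  let ?h = "\<lambda>y. heat_kernel (2 * E) (x - y)"
  have h: "?h y > 0" for y using \<open>E > 0\<close> by (intro heat_kernel_pos) simp
  have k: "0 \<le> ?k s y" "?k s y \<le> P * ?h y"
    "\<bar>(x - y) / (t + \<epsilon> - s)\<bar> * ?k s y \<le> Q * ?h y" if s: "s \<in> {0..r}" for s y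
  proof -
    have \<tau>: "t + \<epsilon> - s > 0" "\<epsilon> \<le> t + \<epsilon> - s" "t + \<epsilon> - s \<le> E" using s r by (auto simp: E_def)
    show "0 \<le> ?k s y" using heat_kernel_pos[OF \<tau>(1)] by (rule less_imp_le)
    show "?k s y \<le> P * ?h y"
      unfolding P_def by (rule heat_kernel_le_wider) (use \<tau> r \<open>E > 0\<close> in auto)
    have "\<bar>z / \<tau>\<bar> * c = 2 * (\<bar>z\<bar> / (2 * \<tau>) * c)" if "\<tau> > 0" for z \<tau> c :: real
      using that by simp
    then have "\<bar>(x - y) / (t + \<epsilon> - s)\<bar> * ?k s y = 2 * (\<bar>x - y\<bar> / (2 * (t + \<epsilon> - s)) * ?k s y)"
      using \<tau>(1) by blast
    also have "\<dots> \<le> 2 * (sqrt 2 / sqrt (t + \<epsilon> - s) * heat_kernel (2 * (t + \<epsilon> - s)) (x - y))"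
      by (intro mult_left_mono heat_kernel_deriv_space_bound \<tau>) simp
    also have "\<dots> \<le> 2 * (sqrt 2 / sqrt \<epsilon> * (sqrt (2 * E / (2 * \<epsilon>)) * ?h y))"
    proof -
      have 1: "sqrt 2 / sqrt (t + \<epsilon> - s) \<le> sqrt 2 / sqrt \<epsilon>"
        using \<tau> r by (intro divide_left_mono) auto
      have 2: "heat_kernel (2 * (t + \<epsilon> - s)) (x - y) \<le> sqrt (2 * E / (2 * \<epsilon>)) * ?h y"
        by (rule heat_kernel_le_wider) (use \<tau> r in auto)
      have 3: "0 \<le> heat_kernel (2 * (t + \<epsilon> - s)) (x - y)"
        using heat_kernel_pos[of "2 * (t + \<epsilon> - s)" "x - y"] \<tau>(1) by (simp add: less_imp_le)
      show ?thesis
        using mult_mono[OF 1 2 _ 3] r by simp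
    qed
    finally show "\<bar>(x - y) / (t + \<epsilon> - s)\<bar> * ?k s y \<le> Q * ?h y" by (simp add: Q_def)
  qed
  let ?g = "\<lambda>n (s, y). indicator {0..r} s * (?k s y * cutoff (real (Suc n)) y * w y s
      - (r - s) * ((x - y) / (t + \<epsilon> - s) * ?k s y * cutoff' (real (Suc n)) y
          + ?k s y * cutoff'' (real (Suc n)) y) * w y s
      + (r - s) * (F y s * ?k s y * cutoff (real (Suc n)) y))"
  let ?d = "\<lambda>(s, y). indicator {0..r} s * (D * ?h y)"
  \<comment> \<open>Nothing is known about \<open>w\<close> outside the strip, so it is measurable
    only together with the indicator; the integrands are regrouped accordingly.\<close>
  have "continuous_on (strip T) (\<lambda>(y, s). w y s)" using C10 by (simp add: C10_def)
  then have "continuous_on ({0..r} \<times> UNIV) (\<lambda>(s, y). w y s)"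
    by (rule continuous_on_strip_swap) (use r in auto)
  then have "(\<lambda>z. indicator ({0..r} \<times> UNIV) z *\<^sub>R (\<lambda>(s, y). w y s) z) \<in> borel_measurable borel"
    by (intro borel_measurable_continuous_on_indicator) (auto intro!: borel_closed closed_Times)
  then have [measurable]: "(\<lambda>z. indicator {0..r} (fst z) * w (snd z) (fst z))
      \<in> borel_measurable (lborel \<Otimes>\<^sub>M lborel)"
    by (simp add: lborel_prod case_prod_unfold indicator_times)
  have "?f = (\<lambda>z. ?k (fst z) (snd z) * (indicator {0..r} (fst z) * w (snd z) (fst z))
      + indicator {0..r} (fst z) * ((r - fst z) * (F (snd z) (fst z) * ?k (fst z) (snd z))))"
    by (auto simp: fun_eq_iff algebra_simps)
  then have f_meas: "?f \<in> borel_measurable (lborel \<Otimes>\<^sub>M lborel)" by simp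
  have "?g n = (\<lambda>z. (?k (fst z) (snd z) * cutoff (real (Suc n)) (snd z) -
       (r - fst z) * ((x - snd z) / (t + \<epsilon> - fst z) * ?k (fst z) (snd z) * cutoff' (real (Suc n)) (snd z)
          + ?k (fst z) (snd z) * cutoff'' (real (Suc n)) (snd z)))
         * (indicator {0..r} (fst z) * w (snd z) (fst z))
      + indicator {0..r} (fst z) * ((r - fst z) * (F (snd z) (fst z) * ?k (fst z) (snd z) * cutoff (real (Suc n)) (snd z))))" for n
    by (auto simp: fun_eq_iff algebra_simps simp del: of_nat_Suc)
  then have g_meas: "?g n \<in> borel_measurable (lborel \<Otimes>\<^sub>M lborel)" for n
    by (simp del: of_nat_Suc)
  have d_int: "integrable (lborel \<Otimes>\<^sub>M lborel) ?d"
  proof (rule integrable_strip_dominated)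
    show "integrable lborel (\<lambda>y. \<bar>D\<bar> * ?h y)"
      using \<open>E > 0\<close> by (intro integrable_mult_right integrable_heat_kernel) simp
  qed (use h in \<open>auto simp: abs_mult less_imp_le indicator_def\<close>)
  have lim: "(\<lambda>n. ?g n z) \<longlonglongrightarrow> ?f z" for z
  proof (cases z)
    case (Pair s y)
    have "(\<lambda>n. ?g n (s, y)) \<longlonglongrightarrow> indicator {0..r} s * (?k s y * 1 * w y s
      - (r - s) * ((x - y) / (t + \<epsilon> - s) * ?k s y * 0 + ?k s y * 0) * w y s
      + (r - s) * (F y s * ?k s y * 1))"
      unfolding prod.case by (intro tendsto_intros cutoff_limits)
    then show ?thesis by (simp add: Pair)
  qed
  have dom: "norm (?g n z) \<le> ?d z" for n z
  proof (cases z)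
    case (Pair s y)
    show ?thesis
    proof (cases "s \<in> {0..r}")
      case True
      let ?R = "real (Suc n)"
      have R: "?R > 0" "?R \<ge> 1" by auto
      have c0: "\<bar>cutoff ?R y\<bar> \<le> 1" by (rule cutoff_bounds(1)[OF R(1)])
      have c1: "\<bar>cutoff' ?R y\<bar> \<le> 6"
      proof -
        have "6 / ?R \<le> 6" by (simp add: divide_le_eq)
        then show ?thesis using cutoff_bounds(2)[OF R(1), of y] by linarith
      qed
      have c2: "\<bar>cutoff'' ?R y\<bar> \<le> 30"
      proof -
        have "1 \<le> ?R\<^sup>2" using R(2) by (rule one_le_power)
        then have "30 / ?R\<^sup>2 \<le> 30" by (simp add: divide_le_eq del: of_nat_Suc)
        then show ?thesis using cutoff_bounds(3)[OF R(1), of y] by linarith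
      qed
      have w: "\<bar>w y s\<bar> \<le> M" using w_slice(3) True r by auto
      have rs: "\<bar>r - s\<bar> \<le> t" using True r by auto
      note ks = k[OF True, of y]
      have a0: "\<bar>?k s y * cutoff ?R y\<bar> \<le> P * ?h y * 1"
        unfolding abs_mult using ks c0 by (intro mult_mono) auto
      have a1: "\<bar>(x - y) / (t + \<epsilon> - s) * ?k s y * cutoff' ?R y\<bar> \<le> Q * ?h y * 6"
        unfolding abs_mult[of _ "cutoff' ?R y"] using ks c1 nonneg less_imp_le[OF h]
        by (intro mult_mono) (auto simp: abs_mult)
      have a2: "\<bar>?k s y * cutoff'' ?R y\<bar> \<le> P * ?h y * 30"
        unfolding abs_mult using ks c2 by (intro mult_mono) auto
      have a12: "\<bar>(x - y) / (t + \<epsilon> - s) * ?k s y * cutoff' ?R y + ?k s y * cutoff'' ?R y\<bar>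
          \<le> (6 * Q + 30 * P) * ?h y"
        using abs_triangle_ineq[of "(x - y) / (t + \<epsilon> - s) * ?k s y * cutoff' ?R y" "?k s y * cutoff'' ?R y"] a1 a2
        by (simp add: algebra_simps)
      have b0: "\<bar>?k s y * cutoff ?R y * w y s\<bar> \<le> P * ?h y * M"
        using mult_mono[OF a0 w] nonneg less_imp_le[OF h] by (simp add: abs_mult)
      have b1: "\<bar>(r - s) * ((x - y) / (t + \<epsilon> - s) * ?k s y * cutoff' ?R y + ?k s y * cutoff'' ?R y) * w y s\<bar>
          \<le> t * ((6 * Q + 30 * P) * ?h y) * M"
        unfolding abs_mult[of "_ * _" "w y s"] abs_mult[of "r - s"]
        using nonneg less_imp_le[OF h] r by (intro mult_mono rs a12 w) auto
      have b2: "\<bar>(r - s) * (F y s * ?k s y * cutoff ?R y)\<bar> \<le> t * (C * (P * ?h y))"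
      proof -
        have "\<bar>F y s\<bar> * \<bar>?k s y * cutoff ?R y\<bar> \<le> C * (P * ?h y)"
          using a0 F_bound[of y s] C_nonneg by (intro mult_mono) auto
        then show ?thesis
          unfolding abs_mult[of "r - s"] using r
          by (intro mult_mono rs) (auto simp: abs_mult mult.assoc)
      qed
      have "\<bar>?k s y * cutoff ?R y * w y s
          - (r - s) * ((x - y) / (t + \<epsilon> - s) * ?k s y * cutoff' ?R y + ?k s y * cutoff'' ?R y) * w y s
          + (r - s) * (F y s * ?k s y * cutoff ?R y)\<bar> \<le> D * ?h y"
        unfolding D_def using b0 b1 b2 by (simp add: ring_distribs mult_ac del: of_nat_Suc)
      then show ?thesis using True by (simp add: Pair del: of_nat_Suc)
    qed (simp add: Pair)
  qed
  note conv = f_meas g_meas d_int AE_I2[OF lim] AE_I2[OF dom]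
  show "integrable (lborel \<Otimes>\<^sub>M lborel) ?f"
    by (rule integrable_dominated_convergence[OF conv])
  have "(\<lambda>n. integral\<^sup>L (lborel \<Otimes>\<^sub>M lborel) (?g n)) \<longlonglongrightarrow> integral\<^sup>L (lborel \<Otimes>\<^sub>M lborel) ?f"
    by (rule integral_dominated_convergence[OF conv])
  moreover have "integral\<^sup>L (lborel \<Otimes>\<^sub>M lborel) (?g n) = 0" for n
    by (rule duhamel_cutoff[OF r]) simp
  ultimately show "integral\<^sup>L (lborel \<Otimes>\<^sub>M lborel) ?f = 0"
    using LIMSEQ_unique tendsto_const by (simp add: LIMSEQ_const_iff)
qed

text \<open>With \<open>A\<close> and \<open>B\<close> the kernel averages of \<open>w\<close> and
  \<open>F\<close>, \<open>duhamel_weighted\<close> is the hypothesis of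
  \<open>weighted_integrals_zero\<close>. At \<open>s = t\<close> the kernel in \<open>A\<close> has
  only the width \<epsilon> left.\<close>

lemma smoothed_eq_duhamel:
  assumes t: "0 < t" "t \<le> T" and "\<epsilon> > 0"
  shows "(LINT y|lborel. heat_kernel \<epsilon> (x - y) * w y t) = - duhamel F x t \<epsilon>"
proof -
  define A where "A s = (LINT y|lborel. heat_kernel (t + \<epsilon> - s) (x - y) * w y s)" for s
  define B where "B s = (LINT y|lborel. heat_kernel (t + \<epsilon> - s) (x - y) * F y s)" for s
  define E where "E = t + \<epsilon>"
  have "E > 0" using assms by (simp add: E_def)
  have M: "M \<ge> 0" using M_nonneg t by simp
  have \<tau>: "t + \<epsilon> - s > 0" "\<epsilon> \<le> t + \<epsilon> - s" "t + \<epsilon> - s \<le> E" if "s \<in> {0..t}" for s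
    using that assms by (auto simp: E_def)
  \<comment> \<open>One majorant serves \<open>w\<close> with \<open>K = M\<close>, \<open>F\<close>
    with \<open>K = C\<close>, and the dominated convergence that makes \<open>A\<close>
    continuous.\<close>
  have dom: "\<bar>heat_kernel (t + \<epsilon> - s) (x - y) * v\<bar> \<le> sqrt (E / \<epsilon>) * heat_kernel E (x - y) * K"
    if "s \<in> {0..t}" "\<bar>v\<bar> \<le> K" for s y v K
    unfolding abs_mult using heat_kernel_pos[OF \<tau>(1)[OF that(1)], of "x - y"] that
      heat_kernel_le_wider[OF assms(3) \<tau>(2,3)[OF that(1)], of "x - y"] by (intro mult_mono) auto
  have dom_int: "integrable lborel (\<lambda>y. sqrt (E / \<epsilon>) * heat_kernel E (x - y) * K)" for K
    using \<open>E > 0\<close> by (intro integrable_mult_left integrable_mult_right integrable_heat_kernel)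
  have A_int: "integrable lborel (\<lambda>y. heat_kernel (t + \<epsilon> - s) (x - y) * w y s)" if s: "s \<in> {0..t}" for s
  proof (rule Bochner_Integration.integrable_bound[OF dom_int])
    have "0 \<le> s" "s \<le> T" using s t by auto
    note [measurable] = w_slice(2)[OF this]
    show "(\<lambda>y. heat_kernel (t + \<epsilon> - s) (x - y) * w y s) \<in> borel_measurable lborel" by measurable
    show "AE y in lborel. norm (heat_kernel (t + \<epsilon> - s) (x - y) * w y s)
        \<le> norm (sqrt (E / \<epsilon>) * heat_kernel E (x - y) * M)"
      using dom[OF s w_slice(3)[OF \<open>0 \<le> s\<close> \<open>s \<le> T\<close>]]
      by (auto intro!: AE_I2 intro: order.trans[OF _ abs_ge_self])
  qed
  have B_int: "integrable lborel (\<lambda>y. heat_kernel (t + \<epsilon> - s) (x - y) * F y s)" if s: "s \<in> {0..t}" for s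
  proof (rule Bochner_Integration.integrable_bound[OF dom_int])
    show "AE y in lborel. norm (heat_kernel (t + \<epsilon> - s) (x - y) * F y s)
        \<le> norm (sqrt (E / \<epsilon>) * heat_kernel E (x - y) * C)"
      using dom[OF s F_bound] by (auto intro!: AE_I2 intro: order.trans[OF _ abs_ge_self])
  qed measurable
  have "A t = - (LINT s:{0..t}|lborel. B s)"
  proof (rule weighted_integrals_zero[OF t(1)])
    show "continuous_on {0..t} A"
    proof (rule continuous_on_sequentiallyI)
      fix u :: "nat \<Rightarrow> real" and a :: real
      assume u: "\<forall>n. u n \<in> {0..t}" "u \<longlonglongrightarrow> a" and a: "a \<in> {0..t}"
      show "(\<lambda>n. A (u n)) \<longlonglongrightarrow> A a"
        unfolding A_def
      proof (rule integral_dominated_convergence)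
        show "integrable lborel (\<lambda>y. sqrt (E / \<epsilon>) * heat_kernel E (x - y) * M)" by (rule dom_int)
        show "(\<lambda>y. heat_kernel (t + \<epsilon> - a) (x - y) * w y a) \<in> borel_measurable lborel"
          using A_int[OF a] by (rule borel_measurable_integrable)
        show "(\<lambda>y. heat_kernel (t + \<epsilon> - u n) (x - y) * w y (u n)) \<in> borel_measurable lborel" for n
          using A_int u(1) by (auto intro: borel_measurable_integrable)
        show "AE y in lborel. norm (heat_kernel (t + \<epsilon> - u n) (x - y) * w y (u n))
            \<le> sqrt (E / \<epsilon>) * heat_kernel E (x - y) * M" for n
        proof (rule AE_I2)
          fix y
          have un: "u n \<in> {0..t}" using u(1) by blast
          then have "\<bar>w y (u n)\<bar> \<le> M" using t by (intro w_slice(3)) auto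
          from dom[OF un this] show "norm (heat_kernel (t + \<epsilon> - u n) (x - y) * w y (u n))
            \<le> sqrt (E / \<epsilon>) * heat_kernel E (x - y) * M" by simp
        qed
        show "AE y in lborel. (\<lambda>n. heat_kernel (t + \<epsilon> - u n) (x - y) * w y (u n))
            \<longlonglongrightarrow> heat_kernel (t + \<epsilon> - a) (x - y) * w y a"
        proof (rule AE_I2)
          fix y
          have "continuous_on (strip T) (\<lambda>(y, s). w y s)" using C10 by (simp add: C10_def)
          then have "(\<lambda>n. (\<lambda>(y, s). w y s) (y, u n)) \<longlonglongrightarrow> (\<lambda>(y, s). w y s) (y, a)"
            by (rule continuous_on_tendsto_compose)
              (use u a t in \<open>auto intro!: tendsto_intros always_eventually simp: strip_def intro: order.trans\<close>)
          then have wl: "(\<lambda>n. w y (u n)) \<longlonglongrightarrow> w y a" by simp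
          have "(\<lambda>n. heat_kernel (t + \<epsilon> - u n) (x - y)) \<longlonglongrightarrow> heat_kernel (t + \<epsilon> - a) (x - y)"
            unfolding heat_kernel_def using \<tau>(1)[OF a] u(2) by (intro tendsto_intros) auto
          with wl show "(\<lambda>n. heat_kernel (t + \<epsilon> - u n) (x - y) * w y (u n))
            \<longlonglongrightarrow> heat_kernel (t + \<epsilon> - a) (x - y) * w y a" by (intro tendsto_mult)
        qed
      qed
    qed
    show "B \<in> borel_measurable borel" unfolding B_def[abs_def] by measurable
    show "\<bar>B s\<bar> \<le> C" if s: "s \<in> {0..t}" for s
    proof -
      have "\<bar>B s\<bar> \<le> (LINT y|lborel. heat_kernel (t + \<epsilon> - s) (x - y) * C)"
        unfolding B_def real_norm_def[symmetric]
      proof (rule Bochner_Integration.integral_norm_bound_integral)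
        show "integrable lborel (\<lambda>y. heat_kernel (t + \<epsilon> - s) (x - y) * C)"
          by (intro integrable_mult_left integrable_heat_kernel \<tau>(1)[OF s])
        show "norm (heat_kernel (t + \<epsilon> - s) (x - y) * F y s) \<le> heat_kernel (t + \<epsilon> - s) (x - y) * C" for y
          using heat_kernel_pos[OF \<tau>(1)[OF s], of "x - y"] F_bound[of y s] by (simp add: abs_mult)
      qed (rule B_int[OF s])
      then show ?thesis using integral_heat_kernel[OF \<tau>(1)[OF s]] by simp
    qed
    show "(LINT s:{0..r}|lborel. A s + (r - s) * B s) = 0" if r: "0 < r" "r \<le> t" for r
    proof -
      note z = duhamel_weighted[OF r t(2) assms(3), of x]
      have "(LINT s:{0..r}|lborel. A s + (r - s) * B s) = (LINT s|lborel. LINT y|lborel.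
        indicator {0..r} s * (heat_kernel (t + \<epsilon> - s) (x - y) * w y s
          + (r - s) * (F y s * heat_kernel (t + \<epsilon> - s) (x - y))))"
        unfolding set_lebesgue_integral_def
      proof (intro Bochner_Integration.integral_cong refl)
        fix s :: real
        show "indicator {0..r} s *\<^sub>R (A s + (r - s) * B s) = (LINT y|lborel.
          indicator {0..r} s * (heat_kernel (t + \<epsilon> - s) (x - y) * w y s
            + (r - s) * (F y s * heat_kernel (t + \<epsilon> - s) (x - y))))"
        proof (cases "s \<in> {0..r}")
          case True
          then have s: "s \<in> {0..t}" using r by auto
          have "A s + (r - s) * B s = (LINT y|lborel. heat_kernel (t + \<epsilon> - s) (x - y) * w y s
            + (r - s) * (heat_kernel (t + \<epsilon> - s) (x - y) * F y s))"
            unfolding A_def B_def using A_int[OF s] B_int[OF s] by simp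
          then show ?thesis using True by (simp add: mult.commute)
        qed simp
      qed
      also have "\<dots> = 0"
        using z(1) lborel_pair.integral_fst'[OF z(2)] by simp
      finally show ?thesis .
    qed
  qed
  then show ?thesis by (simp add: A_def B_def duhamel_def)
qed

text \<open>As \<epsilon> tends to 0 the smoothing of \<open>w\<close> disappears. Hence every bound
  on \<open>duhamel\<close> that is uniform in \<epsilon> passes to \<open>w\<close>.\<close>

lemma duhamel_tendsto:
  assumes t: "0 < t" "t \<le> T"
  shows "(\<lambda>n. duhamel F x t (inverse (real (Suc n)))) \<longlonglongrightarrow> - w x t"
proof -
  have "(\<lambda>n. LINT y|lborel. heat_kernel (inverse (real (Suc n))) (x - y) * w y t) \<longlonglongrightarrow> w x t"
    by (rule LIMSEQ_heat_kernel_integral[where M = M]) (use w_slice t in auto)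
  then have "(\<lambda>n. - duhamel F x t (inverse (real (Suc n)))) \<longlonglongrightarrow> w x t"
    using smoothed_eq_duhamel[OF t] by (simp del: of_nat_Suc)
  from tendsto_minus[OF this] show ?thesis by simp
qed

end

subsection \<open>Bounds for Duhamel integrals\<close>

lemma bounded_heat_kernel_integral:
  assumes [measurable]: "f \<in> borel_measurable borel" and f: "\<And>y. \<bar>f y\<bar> \<le> C" and "\<tau> > 0"
  shows "integrable lborel (\<lambda>y. heat_kernel \<tau> (x - y) * f y)"
    and "\<bar>LINT y|lborel. heat_kernel \<tau> (x - y) * f y\<bar> \<le> C"
proof -
  have i: "integrable lborel (\<lambda>y. heat_kernel \<tau> (x - y) * C)"
    using assms(3) by (intro integrable_mult_left integrable_heat_kernel)
  have b: "norm (heat_kernel \<tau> (x - y) * f y) \<le> heat_kernel \<tau> (x - y) * C" for y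
    using heat_kernel_pos[OF assms(3), of "x - y"] f by (simp add: abs_mult)
  show j: "integrable lborel (\<lambda>y. heat_kernel \<tau> (x - y) * f y)"
    by (rule Bochner_Integration.integrable_bound[OF i])
      (use b in \<open>auto intro!: AE_I2 intro: order.trans[OF _ abs_ge_self]\<close>)
  show "\<bar>LINT y|lborel. heat_kernel \<tau> (x - y) * f y\<bar> \<le> C"
    using Bochner_Integration.integral_norm_bound_integral[OF j i b] integral_heat_kernel[OF assms(3)] by simp
qed

text \<open>\<open>heat_kernel_diff_le\<close> compares with two kernels of doubled width, each of
  mass 1; this is the factor 2. The factor \<open>1 / sqrt \<tau>\<close> is integrable in
  time.\<close>

lemma heat_kernel_integral_lipschitz:
  assumes [measurable]: "f \<in> borel_measurable borel" and f: "\<And>y. \<bar>f y\<bar> \<le> C" and "\<tau> > 0"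
  shows "\<bar>(LINT y|lborel. heat_kernel \<tau> (x - y) * f y) - (LINT y|lborel. heat_kernel \<tau> (x' - y) * f y)\<bar>
    \<le> 2 * sqrt 2 * C * \<bar>x - x'\<bar> / sqrt \<tau>"
proof -
  note i = bounded_heat_kernel_integral(1)[OF assms]
  let ?c = "sqrt 2 / sqrt \<tau> * \<bar>x - x'\<bar> * C"
  have h: "integrable lborel (\<lambda>y. heat_kernel (2 * \<tau>) (x - y))" for x
    using assms(3) by (intro integrable_heat_kernel) simp
  have "norm (LINT y|lborel. heat_kernel \<tau> (x - y) * f y - heat_kernel \<tau> (x' - y) * f y)
      \<le> (LINT y|lborel. ?c * (heat_kernel (2 * \<tau>) (x - y) + heat_kernel (2 * \<tau>) (x' - y)))"
  proof (rule Bochner_Integration.integral_norm_bound_integral)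
    fix y
    have "\<bar>heat_kernel \<tau> (x - y) - heat_kernel \<tau> (x' - y)\<bar> * \<bar>f y\<bar>
        \<le> (sqrt 2 / sqrt \<tau> * \<bar>(x - y) - (x' - y)\<bar>
            * (heat_kernel (2 * \<tau>) (x - y) + heat_kernel (2 * \<tau>) (x' - y))) * C"
      using f[of y] heat_kernel_diff_le[OF assms(3), of "x - y" "x' - y"]
      by (intro mult_mono) auto
    moreover have "heat_kernel \<tau> (x - y) * f y - heat_kernel \<tau> (x' - y) * f y
        = (heat_kernel \<tau> (x - y) - heat_kernel \<tau> (x' - y)) * f y"
      by (simp only: left_diff_distrib)
    ultimately show "norm (heat_kernel \<tau> (x - y) * f y - heat_kernel \<tau> (x' - y) * f y)
        \<le> ?c * (heat_kernel (2 * \<tau>) (x - y) + heat_kernel (2 * \<tau>) (x' - y))"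
      by (simp only: real_norm_def abs_mult) (simp add: mult_ac)
  qed (use i h in auto)
  also have "\<dots> = 2 * sqrt 2 * C * \<bar>x - x'\<bar> / sqrt \<tau>"
    using h integral_heat_kernel[of "2 * \<tau>"] assms(3) by (simp add: algebra_simps)
  finally show ?thesis using i by simp
qed

text \<open>The uniformly small part of the difference is charged with the mass of the kernel, the
  part living on \<open>J\<close> with its height.\<close>

lemma heat_kernel_integral_diff_le:
  assumes [measurable]: "f \<in> borel_measurable borel" "g \<in> borel_measurable borel"
    and f: "\<And>y. \<bar>f y\<bar> \<le> C" and g: "\<And>y. \<bar>g y\<bar> \<le> C" and "\<tau> > 0"
    and J: "J \<in> sets lborel" "emeasure lborel J \<le> ennreal L" "L \<ge> 0"
    and fg: "AE y in lborel. \<bar>f y - g y\<bar> \<le> \<delta> + K * indicator J y" and "K \<ge> 0"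
  shows "\<bar>(LINT y|lborel. heat_kernel \<tau> (x - y) * f y) - (LINT y|lborel. heat_kernel \<tau> (x - y) * g y)\<bar>
    \<le> \<delta> + K * L / sqrt \<tau>"
proof -
  note i = bounded_heat_kernel_integral(1)[OF assms(1) f assms(5)]
    bounded_heat_kernel_integral(1)[OF assms(2) g assms(5)]
  have h: "integrable lborel (\<lambda>y. heat_kernel \<tau> (x - y))"
    using assms(5) by (rule integrable_heat_kernel)
  have J_fin: "emeasure lborel J < \<infinity>" using J(2) by (rule order.strict_trans1) simp
  have J_int: "integrable lborel (indicator J :: real \<Rightarrow> real)"
    using J(1) J_fin by (simp add: integrable_indicator_iff)
  have "norm (LINT y|lborel. heat_kernel \<tau> (x - y) * f y - heat_kernel \<tau> (x - y) * g y)
      \<le> (LINT y|lborel. norm (heat_kernel \<tau> (x - y) * f y - heat_kernel \<tau> (x - y) * g y))"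
    by (rule integral_norm_bound)
  also have "\<dots> \<le> (LINT y|lborel. \<delta> * heat_kernel \<tau> (x - y) + K / sqrt \<tau> * indicator J y)"
  proof (rule integral_mono_AE)
    show "AE y in lborel. norm (heat_kernel \<tau> (x - y) * f y - heat_kernel \<tau> (x - y) * g y)
        \<le> \<delta> * heat_kernel \<tau> (x - y) + K / sqrt \<tau> * indicator J y"
      using fg
    proof eventually_elim
      case (elim y)
      have p: "0 < heat_kernel \<tau> (x - y)" by (rule heat_kernel_pos[OF assms(5)])
      have "norm (heat_kernel \<tau> (x - y) * f y - heat_kernel \<tau> (x - y) * g y)
          = heat_kernel \<tau> (x - y) * \<bar>f y - g y\<bar>"
        using p by (simp add: abs_mult flip: right_diff_distrib)
      also have "\<dots> \<le> heat_kernel \<tau> (x - y) * (\<delta> + K * indicator J y)"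
        using p elim by (intro mult_left_mono) auto
      also have "\<dots> = \<delta> * heat_kernel \<tau> (x - y) + heat_kernel \<tau> (x - y) * (K * indicator J y)"
        by (simp add: algebra_simps)
      also have "heat_kernel \<tau> (x - y) * (K * indicator J y) \<le> 1 / sqrt \<tau> * (K * indicator J y)"
        using heat_kernel_le[OF assms(5)] \<open>K \<ge> 0\<close> by (intro mult_right_mono) auto
      finally show ?case by simp
    qed
  qed (use i h J_int in auto)
  also have "\<dots> = \<delta> + K / sqrt \<tau> * measure lborel J"
    using h J_int J(1) J_fin integral_heat_kernel[OF assms(5)] by simp
  also have "measure lborel J \<le> L"
    using J(2,3) by (simp add: measure_def enn2real_leI)
  finally show ?thesis using i assms(5) \<open>K \<ge> 0\<close> by (simp add: divide_right_mono mult_left_mono)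
qed

text \<open>The integral is \<open>2 * (sqrt (t + \<epsilon>) - sqrt \<epsilon>)\<close>;
  subadditivity of the root makes the bound uniform in \<epsilon>.\<close>

lemma set_integral_inverse_sqrt_le:
  assumes "t > 0" "\<epsilon> > 0"
  shows "set_integrable lborel {0..t} (\<lambda>s. 1 / sqrt (t + \<epsilon> - s))"
    and "(LINT s:{0..t}|lborel. 1 / sqrt (t + \<epsilon> - s)) \<le> 2 * sqrt t"
proof -
  have c: "continuous_on {0..t} (\<lambda>s. 1 / sqrt (t + \<epsilon> - s))"
    using assms by (auto intro!: continuous_intros)
  show "set_integrable lborel {0..t} (\<lambda>s. 1 / sqrt (t + \<epsilon> - s))"
    by (rule borel_integrable_atLeastAtMost'[OF c])
  have "(LINT s:{0..t}|lborel. 1 / sqrt (t + \<epsilon> - s)) = - 2 * sqrt (t + \<epsilon> - t) - (- 2 * sqrt (t + \<epsilon> - 0))"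
    unfolding set_lebesgue_integral_def
  proof (rule integral_FTC_atLeastAtMost)
    show "((\<lambda>s. - 2 * sqrt (t + \<epsilon> - s)) has_vector_derivative 1 / sqrt (t + \<epsilon> - s)) (at s within {0..t})"
      if "0 \<le> s" "s \<le> t" for s
      unfolding has_real_derivative_iff_has_vector_derivative[symmetric] using that assms
      by (auto intro!: derivative_eq_intros simp: field_simps)
  qed (use assms c in auto)
  also have "\<dots> \<le> 2 * sqrt t"
    using sqrt_add_le_add_sqrt[of t \<epsilon>] assms by simp
  finally show "(LINT s:{0..t}|lborel. 1 / sqrt (t + \<epsilon> - s)) \<le> 2 * sqrt t" .
qed

text \<open>Two sources and two points are allowed at once so that three estimates become instances:
  size (\<open>G = 0\<close>, \<open>b = 0\<close>), Lipschitz continuity in space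
  (\<open>F = G\<close>, \<open>a = 0\<close>), and the distance of two solutions
  (\<open>x = x'\<close>).\<close>

lemma duhamel_diff_le:
  assumes F: "(\<lambda>(y, s). F y s) \<in> borel_measurable borel" "\<And>y s. \<bar>F y s\<bar> \<le> C"
    and G: "(\<lambda>(y, s). G y s) \<in> borel_measurable borel" "\<And>y s. \<bar>G y s\<bar> \<le> C"
    and t: "t > 0" "\<epsilon> > 0"
    and ae: "AE s in lborel. s \<in> {0<..t} \<longrightarrow>
      \<bar>(LINT y|lborel. heat_kernel (t + \<epsilon> - s) (x - y) * F y s)
        - (LINT y|lborel. heat_kernel (t + \<epsilon> - s) (x' - y) * G y s)\<bar> \<le> a + b / sqrt (t + \<epsilon> - s)"
    and "b \<ge> 0"
  shows "\<bar>duhamel F x t \<epsilon> - duhamel G x' t \<epsilon>\<bar> \<le> a * t + 2 * b * sqrt t"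
proof -
  have int: "set_integrable lborel {0..t} (\<lambda>s. LINT y|lborel. heat_kernel (t + \<epsilon> - s) (x - y) * F y s)"
    if F: "(\<lambda>(y, s). F y s) \<in> borel_measurable borel" "\<And>y s. \<bar>F y s\<bar> \<le> C" for F x
    unfolding set_integrable_def
  proof (rule Bochner_Integration.integrable_bound)
    have [measurable]: "(\<lambda>z. F (snd z) (fst z)) \<in> borel_measurable (lborel \<Otimes>\<^sub>M lborel)"
    proof -
      have "(\<lambda>z. (snd z, fst z)) \<in> borel_measurable (lborel \<Otimes>\<^sub>M lborel)"
        by (intro borel_measurable_Pair) measurable
      from measurable_compose[OF this F(1)] show ?thesis by simp
    qed
    show "integrable lborel (\<lambda>s. indicator {0..t} s * C)"
      by (intro integrable_mult_left) (simp add: integrable_indicator_iff emeasure_lborel_Icc_eq)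
    have "(\<lambda>s. LINT y|lborel. heat_kernel (t + \<epsilon> - s) (x - y) * F y s) \<in> borel_measurable lborel"
      by measurable
    then show "(\<lambda>s. indicator {0..t} s *\<^sub>R (LINT y|lborel. heat_kernel (t + \<epsilon> - s) (x - y) * F y s))
        \<in> borel_measurable lborel" by measurable
    have Fs: "(\<lambda>y. F y s) \<in> borel_measurable borel" for s
      using measurable_compose[OF borel_measurable_Pair[OF measurable_ident measurable_const] F(1)] by auto
    have "\<bar>LINT y|lborel. heat_kernel (t + \<epsilon> - s) (x - y) * F y s\<bar> \<le> C" if "s \<in> {0..t}" for s
      using bounded_heat_kernel_integral(2)[OF Fs F(2)] t that by simp
    then show "AE s in lborel. norm (indicator {0..t} s *\<^sub>R (LINT y|lborel. heat_kernel (t + \<epsilon> - s) (x - y) * F y s))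
        \<le> norm (indicator {0..t} s * C)"
      by (auto intro!: AE_I2 simp: indicator_def intro: order.trans[OF _ abs_ge_self])
  qed
  note i = set_integral_diff[OF int[OF F] int[OF G], of x x']
  note s = set_integral_inverse_sqrt_le[OF t]
  have b_int: "set_integrable lborel {0..t} (\<lambda>s. a + b * (1 / sqrt (t + \<epsilon> - s)))"
    using s(1) by (intro set_integral_add set_integrable_mult_right)
      (auto simp: set_integrable_def integrable_indicator_iff emeasure_lborel_Icc_eq)
  have "\<bar>duhamel F x t \<epsilon> - duhamel G x' t \<epsilon>\<bar> = norm (LINT s:{0..t}|lborel.
      (LINT y|lborel. heat_kernel (t + \<epsilon> - s) (x - y) * F y s)
        - (LINT y|lborel. heat_kernel (t + \<epsilon> - s) (x' - y) * G y s))"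
    using i(2) by (simp add: duhamel_def)
  also have "\<dots> \<le> (LINT s:{0..t}|lborel. norm (
      (LINT y|lborel. heat_kernel (t + \<epsilon> - s) (x - y) * F y s)
        - (LINT y|lborel. heat_kernel (t + \<epsilon> - s) (x' - y) * G y s)))"
    by (rule set_integral_norm_bound[OF i(1)])
  also have "\<dots> \<le> (LINT s:{0..t}|lborel. a + b * (1 / sqrt (t + \<epsilon> - s)))"
    unfolding set_lebesgue_integral_def
  proof (rule integral_mono_AE)
    show "integrable lborel (\<lambda>s. indicator {0..t} s *\<^sub>R norm (
      (LINT y|lborel. heat_kernel (t + \<epsilon> - s) (x - y) * F y s)
        - (LINT y|lborel. heat_kernel (t + \<epsilon> - s) (x' - y) * G y s)))"
      using set_integrable_norm[OF i(1)] by (simp add: set_integrable_def)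
    show "integrable lborel (\<lambda>s. indicator {0..t} s *\<^sub>R (a + b * (1 / sqrt (t + \<epsilon> - s))))"
      using b_int by (simp add: set_integrable_def)
    \<comment> \<open>The hypothesis speaks of positive times only; time 0 is a null set.\<close>
    have "AE s in lborel. s \<noteq> (0 :: real)" by (rule AE_lborel_singleton)
    with ae show "AE s in lborel. indicator {0..t} s *\<^sub>R norm (
      (LINT y|lborel. heat_kernel (t + \<epsilon> - s) (x - y) * F y s)
        - (LINT y|lborel. heat_kernel (t + \<epsilon> - s) (x' - y) * G y s))
      \<le> indicator {0..t} s *\<^sub>R (a + b * (1 / sqrt (t + \<epsilon> - s)))"
      by eventually_elim (auto simp: indicator_def)
  qed
  also have "\<dots> = a * t + b * (LINT s:{0..t}|lborel. 1 / sqrt (t + \<epsilon> - s))"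
  proof -
    have c: "set_integrable lborel {0..t} (\<lambda>s. a)"
      by (simp add: set_integrable_def integrable_indicator_iff emeasure_lborel_Icc_eq)
    have "(LINT s:{0..t}|lborel. a) = a * t" using t by (simp add: set_lebesgue_integral_def)
    then show ?thesis
      unfolding set_integral_add(2)[OF c set_integrable_mult_right[OF s(1)]]
      by (simp only: set_integral_mult_right)
  qed
  also have "\<dots> \<le> a * t + b * (2 * sqrt t)"
    using s(2) \<open>b \<ge> 0\<close> by (intro add_left_mono mult_left_mono)
  finally show ?thesis by simp
qed

context weak_heat_solution
begin

lemma F_slice [measurable]: "(\<lambda>y. F y s) \<in> borel_measurable borel"
  by measurable

lemma w_le:
  assumes "0 < t" "t \<le> T"
  shows "\<bar>w x t\<bar> \<le> C * t"
proof -
  have "\<bar>duhamel F x t \<epsilon>\<bar> \<le> C * t" if "\<epsilon> > 0" for \<epsilon>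
  proof -
    have z: "duhamel (\<lambda>_ _. 0) x t \<epsilon> = 0" by (simp add: duhamel_def)
    have "\<bar>duhamel F x t \<epsilon> - duhamel (\<lambda>_ _. 0) x t \<epsilon>\<bar> \<le> C * t + 2 * 0 * sqrt t"
      by (rule duhamel_diff_le)
        (use that assms F_bound C_nonneg in \<open>auto intro!: AE_I2 bounded_heat_kernel_integral(2)\<close>)
    then show ?thesis using z by simp
  qed
  then have "\<bar>- w x t\<bar> \<le> C * t"
    by (intro LIMSEQ_le_const2[OF tendsto_rabs[OF duhamel_tendsto[OF assms]]]) auto
  then show ?thesis by simp
qed

lemma w_lipschitz:
  assumes "0 < t" "t \<le> T"
  shows "\<bar>w x t - w x' t\<bar> \<le> 4 * sqrt 2 * C * sqrt t * \<bar>x - x'\<bar>"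
proof -
  have "\<bar>duhamel F x t \<epsilon> - duhamel F x' t \<epsilon>\<bar> \<le> 0 * t + 2 * (2 * sqrt 2 * C * \<bar>x - x'\<bar>) * sqrt t"
    if "\<epsilon> > 0" for \<epsilon>
    by (rule duhamel_diff_le)
      (use that assms F_bound C_nonneg heat_kernel_integral_lipschitz[OF F_slice F_bound] in
        \<open>auto intro!: AE_I2\<close>)
  then have "\<bar>- w x t - - w x' t\<bar> \<le> 0 * t + 2 * (2 * sqrt 2 * C * \<bar>x - x'\<bar>) * sqrt t"
    by (intro LIMSEQ_le_const2[OF tendsto_rabs[OF tendsto_diff[OF
        duhamel_tendsto[OF assms] duhamel_tendsto[OF assms]]]]) auto
  then show ?thesis by (simp add: abs_minus_commute mult_ac)
qed

end

text \<open>The set \<open>J\<close> may move with the time \<open>s\<close>; only its measure is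
  controlled uniformly.\<close>

lemma weak_heat_solutions_diff_le:
  assumes "weak_heat_solution T M C w F" "weak_heat_solution T M' C v G"
    and t: "0 < t" "t \<le> T" and "L \<ge> 0" "K \<ge> 0"
    and ae: "AE s in lborel. s \<in> {0<..t} \<longrightarrow> (\<exists>J\<in>sets lborel. emeasure lborel J \<le> ennreal L \<and>
      (AE y in lborel. \<bar>F y s - G y s\<bar> \<le> \<delta> + K * indicator J y))"
  shows "\<bar>w x t - v x t\<bar> \<le> \<delta> * t + 2 * (K * L) * sqrt t"
proof -
  interpret w: weak_heat_solution T M C w F by fact
  interpret v: weak_heat_solution T M' C v G by fact
  have "\<bar>duhamel F x t \<epsilon> - duhamel G x t \<epsilon>\<bar> \<le> \<delta> * t + 2 * (K * L) * sqrt t" if "\<epsilon> > 0" for \<epsilon>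
  proof (rule duhamel_diff_le[OF w.F_measurable w.F_bound v.F_measurable v.F_bound t(1) that])
    show "AE s in lborel. s \<in> {0<..t} \<longrightarrow>
      \<bar>(LINT y|lborel. heat_kernel (t + \<epsilon> - s) (x - y) * F y s)
        - (LINT y|lborel. heat_kernel (t + \<epsilon> - s) (x - y) * G y s)\<bar> \<le> \<delta> + K * L / sqrt (t + \<epsilon> - s)"
      using ae
    proof eventually_elim
      case (elim s)
      then show ?case
        using heat_kernel_integral_diff_le[OF w.F_slice v.F_slice w.F_bound v.F_bound, of "t + \<epsilon> - s"]
          that \<open>L \<ge> 0\<close> \<open>K \<ge> 0\<close> by auto
    qed
  qed (use assms(5,6) in auto)
  then have "\<bar>- w x t - - v x t\<bar> \<le> \<delta> * t + 2 * (K * L) * sqrt t"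
    by (intro LIMSEQ_le_const2[OF tendsto_rabs[OF tendsto_diff[OF
        w.duhamel_tendsto[OF t] v.duhamel_tendsto[OF t]]]]) auto
  then show ?thesis by (simp add: abs_minus_commute)
qed

subsection \<open>The self-similar profile\<close>

lemma integrable_exp_neg_square: "integrable lborel (\<lambda>s :: real. exp (- s\<^sup>2))"
proof -
  have "heat_kernel (1 / 4) (0 - s) * sqrt pi = exp (- s\<^sup>2)" for s
    by (simp add: heat_kernel_def)
  moreover have "integrable lborel (\<lambda>s. heat_kernel (1 / 4) (0 - s) * sqrt pi)"
    by (intro integrable_mult_left integrable_heat_kernel) simp
  ultimately show ?thesis by (simp only:)
qed

lemma set_integrable_exp_neg_square:
  fixes S :: "real set"
  assumes "S \<in> sets borel"
  shows "set_integrable lborel S (\<lambda>s. exp (- s\<^sup>2))"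
  unfolding set_integrable_def using assms
  by (intro integrable_mult_indicator integrable_exp_neg_square) auto

lemma erfc_nonneg: "0 \<le> erfc x"
  unfolding erfc_def set_lebesgue_integral_def
  by (intro mult_nonneg_nonneg Bochner_Integration.integral_nonneg) auto

text \<open>On \<open>{a..<b}\<close> the integrand is at least its value at \<open>h\<close>.
  Fixing \<open>h\<close> makes the rate of decrease uniform over all
  \<open>b \<le> h\<close>.\<close>

lemma erfc_diff_ge:
  assumes "0 \<le> a" "a \<le> b" "b \<le> h"
  shows "2 / sqrt pi * exp (- h\<^sup>2) * (b - a) \<le> erfc a - erfc b"
proof -
  have un: "{a..} = {a..<b} \<union> {b..}" "{a..<b} \<inter> {b..} = {}" using assms by auto
  have "(LBINT s:{a..}. exp (- s\<^sup>2)) = (LBINT s:{a..<b}. exp (- s\<^sup>2)) + (LBINT s:{b..}. exp (- s\<^sup>2))"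
    unfolding un(1) by (rule set_integral_Un[OF un(2)]) (auto intro: set_integrable_exp_neg_square)
  moreover have "(LBINT s:{a..<b}. exp (- h\<^sup>2)) \<le> (LBINT s:{a..<b}. exp (- s\<^sup>2))"
    using assms
    by (intro set_integral_mono set_integrable_exp_neg_square)
      (auto simp: set_integrable_def integrable_indicator_iff emeasure_lborel_Ico abs_le_square_iff[symmetric])
  moreover have "(LBINT s:{a..<b}. exp (- h\<^sup>2)) = exp (- h\<^sup>2) * (b - a)"
    using assms by (simp add: set_lebesgue_integral_def)
  ultimately have "exp (- h\<^sup>2) * (b - a) \<le> (LBINT s:{a..}. exp (- s\<^sup>2)) - (LBINT s:{b..}. exp (- s\<^sup>2))"
    by simp
  then have "2 / sqrt pi * (exp (- h\<^sup>2) * (b - a))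
      \<le> 2 / sqrt pi * ((LBINT s:{a..}. exp (- s\<^sup>2)) - (LBINT s:{b..}. exp (- s\<^sup>2)))"
    by (intro mult_left_mono) auto
  then show ?thesis
    unfolding erfc_def by (simp only: right_diff_distrib mult.assoc)
qed

lemma erfc_antimono:
  assumes "0 \<le> a" "a \<le> b"
  shows "erfc b \<le> erfc a"
proof -
  have "0 \<le> 2 / sqrt pi * exp (- b\<^sup>2) * (b - a)" using assms by simp
  then show ?thesis using erfc_diff_ge[OF assms order_refl] by linarith
qed

lemma erfc_tendsto_0: "(\<lambda>n. erfc (real n)) \<longlonglongrightarrow> 0"
proof -
  have "(\<lambda>n. LINT s|lborel. indicator {real n..} s *\<^sub>R exp (- s\<^sup>2)) \<longlonglongrightarrow> integral\<^sup>L lborel (\<lambda>s :: real. 0 :: real)"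
  proof (rule integral_dominated_convergence[where w = "\<lambda>s. exp (- s\<^sup>2)"])
    show "integrable lborel (\<lambda>s :: real. exp (- s\<^sup>2))" by (rule integrable_exp_neg_square)
    show "AE s in lborel. (\<lambda>n. indicator {real n..} s *\<^sub>R exp (- s\<^sup>2)) \<longlonglongrightarrow> (0 :: real)"
    proof (rule AE_I2)
      fix s :: real
      obtain N :: nat where "s < real N" using reals_Archimedean2 by blast
      then have "\<forall>\<^sub>F n in sequentially. indicator {real n..} s *\<^sub>R exp (- s\<^sup>2) = (0 :: real)"
        by (intro eventually_mono[OF eventually_ge_at_top[of N]]) (auto simp: indicator_def)
      then show "(\<lambda>n. indicator {real n..} s *\<^sub>R exp (- s\<^sup>2)) \<longlonglongrightarrow> (0 :: real)"
        by (rule tendsto_eventually)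
    qed
  qed (auto simp: indicator_def)
  then have "(\<lambda>n. 2 / sqrt pi * (LBINT s:{real n..}. exp (- s\<^sup>2))) \<longlonglongrightarrow> 2 / sqrt pi * 0"
    unfolding set_lebesgue_integral_def by (intro tendsto_mult tendsto_const) simp
  then show ?thesis by (simp add: erfc_def[abs_def])
qed

context
  fixes \<alpha> \<beta> :: real
  assumes \<alpha>\<beta>: "\<alpha> > 0" "\<beta> > 0"
begin

lemma Psi_ge_\<alpha>:
  assumes "\<eta> \<ge> \<alpha>"
  shows "Psi \<alpha> \<beta> \<eta> = \<alpha> * \<beta> * sqrt pi / 2 * exp (\<alpha>\<^sup>2 / 4) * erfc (\<eta> / 2)"
  using assms by (auto simp: Psi_def)

lemma Psi_nonneg: "0 \<le> Psi \<alpha> \<beta> \<eta>"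
  using \<alpha>\<beta> erfc_nonneg by (auto simp: Psi_def)

lemma Psi_antimono:
  assumes "\<eta> \<le> \<theta>"
  shows "Psi \<alpha> \<beta> \<theta> \<le> Psi \<alpha> \<beta> \<eta>"
  unfolding Psi_def using \<alpha>\<beta> assms by (intro mult_left_mono) (auto intro: erfc_antimono)

lemma Psi_le: "Psi \<alpha> \<beta> \<eta> \<le> Psi \<alpha> \<beta> \<alpha>"
proof (cases "\<eta> \<le> \<alpha>")
  case True
  then show ?thesis by (simp add: Psi_def)
qed (use Psi_antimono[of \<alpha> \<eta>] in auto)

lemma Psi_measurable [measurable]: "Psi \<alpha> \<beta> \<in> borel_measurable borel"
proof -
  have "mono (\<lambda>\<eta>. - Psi \<alpha> \<beta> \<eta>)" using Psi_antimono by (auto simp: mono_def)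
  then have [measurable]: "(\<lambda>\<eta>. - Psi \<alpha> \<beta> \<eta>) \<in> borel_measurable borel" by (rule borel_measurable_mono)
  have "(\<lambda>\<eta>. - (- Psi \<alpha> \<beta> \<eta>)) \<in> borel_measurable borel" by measurable
  then show ?thesis by simp
qed

lemma psi_measurable [measurable]: "(\<lambda>(x, t). psi \<alpha> \<beta> x t) \<in> borel_measurable borel"
  unfolding psi_def case_prod_unfold borel_prod[symmetric] by measurable

lemma psi_bounds: "0 \<le> psi \<alpha> \<beta> x t" "psi \<alpha> \<beta> x t \<le> Psi \<alpha> \<beta> \<alpha>"
  using Psi_nonneg Psi_le by (auto simp: psi_def)

text \<open>Beyond \<open>H\<close> the profile is too small to take part in reaching the threshold.
  This confines the crossing to the range from \<alpha> to \<open>H\<close>, where the slope of the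
  profile is bounded away from 0.\<close>

lemma Psi_eventually_small:
  assumes "c > 0"
  obtains H where "H \<ge> \<alpha>" "Psi \<alpha> \<beta> H < c"
proof -
  have "(\<lambda>n. \<alpha> * \<beta> * sqrt pi / 2 * exp (\<alpha>\<^sup>2 / 4) * erfc (real n)) \<longlonglongrightarrow> \<alpha> * \<beta> * sqrt pi / 2 * exp (\<alpha>\<^sup>2 / 4) * 0"
    by (intro tendsto_intros erfc_tendsto_0)
  then have "\<forall>\<^sub>F n in sequentially. \<alpha> * \<beta> * sqrt pi / 2 * exp (\<alpha>\<^sup>2 / 4) * erfc (real n) < c"
    by (rule order_tendstoD) (use assms in simp)
  then obtain N where N: "\<And>n. n \<ge> N \<Longrightarrow> \<alpha> * \<beta> * sqrt pi / 2 * exp (\<alpha>\<^sup>2 / 4) * erfc (real n) < c"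
    by (auto simp: eventually_sequentially)
  obtain n :: nat where n: "\<alpha> < real n" using reals_Archimedean2 by blast
  define m where "m = max n N"
  have "2 * real m \<ge> \<alpha>" using n \<alpha>\<beta> by (auto simp: m_def)
  moreover have "Psi \<alpha> \<beta> (2 * real m) < c"
    using Psi_ge_\<alpha>[OF calculation] N[of m] by (simp add: m_def)
  ultimately show ?thesis by (rule that)
qed

lemma Psi_decreases_linearly:
  obtains c where "c > 0" "\<And>\<eta> \<theta>. \<alpha> \<le> \<eta> \<Longrightarrow> \<eta> \<le> \<theta> \<Longrightarrow> \<theta> \<le> H \<Longrightarrow>
    c * (\<theta> - \<eta>) \<le> Psi \<alpha> \<beta> \<eta> - Psi \<alpha> \<beta> \<theta>"
proof
  let ?a = "\<alpha> * \<beta> * sqrt pi / 2 * exp (\<alpha>\<^sup>2 / 4)"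
  have a: "?a > 0" using \<alpha>\<beta> by simp
  \<comment> \<open>The prefactor of the profile times the rate of decrease of \<open>erfc\<close>
    at \<open>H / 2\<close>; the last factor 1/2 stems from the argument
    \<open>\<eta> / 2\<close>.\<close>
  let ?c = "?a * (2 / sqrt pi * exp (- (H / 2)\<^sup>2)) / 2"
  show "?c > 0" using \<alpha>\<beta> by (intro divide_pos_pos mult_pos_pos) auto
  fix \<eta> \<theta> assume *: "\<alpha> \<le> \<eta>" "\<eta> \<le> \<theta>" "\<theta> \<le> H"
  have "2 / sqrt pi * exp (- (H / 2)\<^sup>2) * (\<theta> / 2 - \<eta> / 2) \<le> erfc (\<eta> / 2) - erfc (\<theta> / 2)"
    using * \<alpha>\<beta> by (intro erfc_diff_ge) auto
  then have "?a * (2 / sqrt pi * exp (- (H / 2)\<^sup>2) * (\<theta> / 2 - \<eta> / 2)) \<le> ?a * (erfc (\<eta> / 2) - erfc (\<theta> / 2))"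
    using a by (intro mult_left_mono) auto
  also have "\<dots> = Psi \<alpha> \<beta> \<eta> - Psi \<alpha> \<beta> \<theta>"
    using * by (simp add: Psi_ge_\<alpha> right_diff_distrib)
  finally have "?a * (2 / sqrt pi * exp (- (H / 2)\<^sup>2) * (\<theta> / 2 - \<eta> / 2)) \<le> Psi \<alpha> \<beta> \<eta> - Psi \<alpha> \<beta> \<theta>" .
  moreover have "a * b / 2 * (\<theta> - \<eta>) = a * (b * (\<theta> / 2 - \<eta> / 2))" for a b :: real
    by (simp add: field_simps)
  ultimately show "?c * (\<theta> - \<eta>) \<le> Psi \<alpha> \<beta> \<eta> - Psi \<alpha> \<beta> \<theta>"
    by (simp only:)
qed

end

subsection \<open>Weak solutions\<close>

lemma AE_lborel_swap:
  fixes P :: "real \<times> real \<Rightarrow> bool"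
  assumes "AE z in lborel. P z"
  shows "AE s in lborel. AE y in lborel. P (y, s)"
proof -
  have swap: "distr (lborel \<Otimes>\<^sub>M lborel) (lborel \<Otimes>\<^sub>M lborel) (\<lambda>(x, y). (y, x)) = (lborel :: (real \<times> real) measure)"
    by (metis lborel_pair.distr_pair_swap lborel_prod)
  have "AE z in distr (lborel \<Otimes>\<^sub>M lborel) (lborel \<Otimes>\<^sub>M lborel) (\<lambda>(x, y). (y, x)). P z"
    unfolding swap by (rule assms)
  then have "AE z in lborel \<Otimes>\<^sub>M lborel. P ((\<lambda>(x, y). (y, x)) z)"
    by (rule AE_distrD[OF measurable_pair_swap'])
  from lborel_pair.AE_pair[OF this] show ?thesis by simp
qed

text \<open>The set where \<open>f\<close> and \<open>g\<close> agree is only Lebesgue measurable,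
  so Fubini is applied to Borel versions of both; these agree with them on almost every
  slice.\<close>

lemma AE_lebesgue_eq_by_slices:
  fixes f g :: "real \<times> real \<Rightarrow> real"
  assumes "f \<in> borel_measurable lebesgue" "g \<in> borel_measurable lebesgue"
    and eq: "AE s in lborel. AE y in lborel. f (y, s) = g (y, s)"
  shows "AE z in lebesgue. f z = g z"
proof -
  obtain f' where f' [measurable]: "f' \<in> borel_measurable lborel" and ff': "AE z in lborel. f z = f' z"
    using completion_ex_borel_measurable_real[OF assms(1)] by blast
  obtain g' where g' [measurable]: "g' \<in> borel_measurable lborel" and gg': "AE z in lborel. g z = g' z"
    using completion_ex_borel_measurable_real[OF assms(2)] by blast
  have "{z \<in> space lborel. f' z = g' z} \<in> sets lborel" by measurable
  then have sets: "{z. f' z = g' z} \<in> sets (lborel \<Otimes>\<^sub>M lborel)" by (simp only: lborel_prod space_lborel) simp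
  have "AE s in lborel. AE y in lborel. f' (y, s) = g' (y, s)"
    using eq AE_lborel_swap[OF ff'] AE_lborel_swap[OF gg']
  proof eventually_elim
    case (elim s)
    then show ?case by eventually_elim simp
  qed
  then have "AE y in lborel. AE s in lborel. f' (y, s) = g' (y, s)"
    by (subst lborel_pair.AE_commute) (use sets in \<open>simp_all add: space_pair_measure\<close>)
  then have "AE z in lborel \<Otimes>\<^sub>M lborel. f' z = g' z"
    by (intro lborel_pair.AE_pair_measure) (use sets in \<open>simp_all add: space_pair_measure\<close>)
  then have "AE z in lborel. f' z = g' z" unfolding lborel_prod .
  with ff' gg' have "AE z in lborel. f z = g z" by eventually_elim simp
  then show ?thesis by (simp add: AE_completion_iff)
qed

text \<open>Measurability of \<open>k\<close> comes for free from the completeness of the Lebesgue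
  measure.\<close>

lemma integral_lebesgue_eq_lborel:
  fixes h k :: "real \<Rightarrow> real"
  assumes h: "h \<in> borel_measurable lborel" and eq: "AE x in lborel. k x = h x"
  shows "integral\<^sup>L lebesgue k = integral\<^sup>L lborel h"
proof -
  have hl: "h \<in> borel_measurable lebesgue" using h by (rule measurable_completion)
  have eq': "AE x in lebesgue. h x = k x"
    using eq by (simp add: AE_completion_iff eq_commute)
  have "integral\<^sup>L lebesgue h = integral\<^sup>L lebesgue k"
    by (rule integral_cong_AE[OF hl borel_measurable_AE[OF hl eq'] eq'])
  then show ?thesis using integral_completion[OF h] by simp
qed

text \<open>Serves to replace the integrands of the weak formulation, which contain the Lebesgue
  measurable \<open>p\<close>, by Borel ones, slice by slice.\<close>

lemma iterated_integral_lebesgue_eq_lborel: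
  fixes h k :: "real \<Rightarrow> real \<Rightarrow> real"
  assumes h: "(\<lambda>(y, s). indicator {0..t} s * h y s) \<in> borel_measurable borel"
    and eq: "AE s in lborel. s \<in> {0..t} \<longrightarrow> (AE y in lborel. k y s = h y s)"
  shows "(LINT s:{0..t}|lebesgue. LINT y|lebesgue. k y s) = (LINT s:{0..t}|lborel. LINT y|lborel. h y s)"
proof -
  have [measurable]: "(\<lambda>z. indicator {0..t} (fst z) * h (snd z) (fst z)) \<in> borel_measurable (lborel \<Otimes>\<^sub>M lborel)"
  proof -
    have "(\<lambda>z. (snd z, fst z)) \<in> borel_measurable (lborel \<Otimes>\<^sub>M lborel)"
      by (intro borel_measurable_Pair) measurable
    from measurable_compose[OF this h] show ?thesis by simp
  qed
  have slice: "(\<lambda>y. h y s) \<in> borel_measurable lborel" if "s \<in> {0..t}" for s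
  proof -
    have "(\<lambda>y. (y, s)) \<in> borel_measurable (lborel :: real measure)"
      by (intro borel_measurable_Pair) measurable
    from measurable_compose[OF this h] show ?thesis using that by simp
  qed
  show ?thesis
    unfolding set_lebesgue_integral_def
  proof (rule integral_lebesgue_eq_lborel)
    have "(\<lambda>s. LINT y|lborel. indicator {0..t} s * h y s) \<in> borel_measurable lborel"
      by measurable
    moreover have "(LINT y|lborel. indicator {0..t} s * h y s) = indicator {0..t} s *\<^sub>R (LINT y|lborel. h y s)" for s
      by simp
    ultimately show "(\<lambda>s. indicator {0..t} s *\<^sub>R (LINT y|lborel. h y s)) \<in> borel_measurable lborel"
      by (simp only:)
    show "AE s in lborel. indicator {0..t} s *\<^sub>R (LINT y|lebesgue. k y s) = indicator {0..t} s *\<^sub>R (LINT y|lborel. h y s)"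
      using eq
    proof eventually_elim
      case (elim s)
      then show ?case
        using integral_lebesgue_eq_lborel[OF slice] by (cases "s \<in> {0..t}") auto
    qed
  qed
qed

text \<open>Inside the strip the set where the bound fails is open and negligible, hence empty;
  continuity carries the bound to the two boundary times.\<close>

lemma continuous_on_strip_AE_bounded:
  fixes f :: "real \<Rightarrow> real \<Rightarrow> real"
  assumes c: "continuous_on (strip T) (\<lambda>(x, t). f x t)" and "T > 0"
    and ae: "AE (x, t) in lebesgue_on (strip T). \<bar>f x t\<bar> \<le> M"
    and "(x, t) \<in> strip T"
  shows "\<bar>f x t\<bar> \<le> M"
proof -
  let ?S = "UNIV \<times> {0<..<T} :: (real \<times> real) set"
  let ?f = "\<lambda>z. \<bar>(\<lambda>(x, t). f x t) z\<bar>"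
  have cl: "closure ?S = strip T" using \<open>T > 0\<close> by (simp add: closure_Times strip_def)
  have cf: "continuous_on (strip T) ?f" using continuous_on_rabs[OF c] by simp
  have "closed (strip T)" unfolding strip_def by (intro closed_Times) auto
  then have strip_sets: "strip T \<in> sets lebesgue" by (simp add: borel_closed)
  have ae': "AE z in lebesgue. z \<in> strip T \<longrightarrow> ?f z \<le> M"
    using ae strip_sets by (simp add: AE_restrict_space_iff case_prod_unfold)
  have open_S: "open ?S" by (intro open_Times) auto
  define V where "V = {z \<in> ?S. ?f z > M}"
  have "open V"
  proof -
    have "continuous_on ?S ?f" by (rule continuous_on_subset[OF cf]) (auto simp: strip_def)
    then have "open (?S \<inter> ?f -` {M<..})"
      by (rule continuous_open_preimage) (use open_S in auto)
    then show ?thesis by (simp add: V_def Int_def vimage_def)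
  qed
  moreover have "negligible V"
  proof -
    have "V \<subseteq> {z. \<not> (z \<in> strip T \<longrightarrow> ?f z \<le> M)}" by (auto simp: V_def strip_def)
    moreover have "V \<in> sets lebesgue" using \<open>open V\<close> by (simp add: borel_open)
    moreover have "AE z in lebesgue. z \<notin> V" using ae' by eventually_elim (use calculation in auto)
    ultimately show ?thesis
      by (simp add: negligible_iff_null_sets AE_iff_null_sets)
  qed
  ultimately have "V = {}" using open_not_negligible by blast
  then have "?f z \<le> M" if "z \<in> ?S" for z using that by (auto simp: V_def not_less)
  then have "?f (x, t) \<le> M"
    using continuous_le_on_closure[of ?S ?f "(x, t)" M] cf assms(4) unfolding cl by blast
  then show ?thesis by simp
qed

lemma indicator_strip_measurable:
  fixes f :: "real \<Rightarrow> real \<Rightarrow> real"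
  assumes "continuous_on (strip t) (\<lambda>(y, s). f y s)"
  shows "(\<lambda>(y, s). indicator {0..t} s * f y s) \<in> borel_measurable borel"
proof -
  have "closed (strip t)" unfolding strip_def by (intro closed_Times) auto
  then have "(\<lambda>z. indicator (strip t) z *\<^sub>R (\<lambda>(y, s). f y s) z) \<in> borel_measurable borel"
    using assms by (intro borel_measurable_continuous_on_indicator) auto
  moreover have "indicator (strip t) z *\<^sub>R (\<lambda>(y, s). f y s) z = (\<lambda>(y, s). indicator {0..t} s * f y s) z" for z
    by (auto simp: strip_def indicator_def split: prod.split)
  ultimately show ?thesis by (simp only:)
qed

text \<open>The source \<open>F\<close> is a Borel version of \<open>p u\<close>.\<close>

lemma weak_solution_heat:
  assumes ab: "\<alpha> > 0" "\<beta> > 0" and ws: "weak_solution \<alpha> \<beta> ustar (u, p)" and T: "T > 0"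
  obtains g F M where "C10 T g" "\<And>y s. (y, s) \<in> strip T \<Longrightarrow> \<bar>g y s\<bar> \<le> M"
    "\<And>y s. (y, s) \<in> strip T \<inter> spacetime \<Longrightarrow> u y s = g y s + psi \<alpha> \<beta> y s"
    "(\<lambda>(y, s). F y s) \<in> borel_measurable borel"
    "\<And>y s. \<bar>F y s\<bar> \<le> (if s \<in> {0<..T} then \<bar>g y s + psi \<alpha> \<beta> y s\<bar> else 0)"
    "\<And>t. 0 < t \<Longrightarrow> t \<le> T \<Longrightarrow> weak_heat t g F"
    "AE s in lborel. s \<in> {0<..T} \<longrightarrow> (AE y in lborel. F y s = p y s * u y s)"
proof -
  define w where "w x t = u x t - psi \<alpha> \<beta> x t" for x t
  note ws' = ws[unfolded weak_solution_def Let_def prod.case, folded w_def]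
  have reg: "regular_part T w" using ws' T unfolding w_def[abs_def] by blast
  have p_meas: "(\<lambda>(x, t). p x t) \<in> borel_measurable (lebesgue_on spacetime)" using ws' by blast
  have p01: "p x t \<in> {0..1}" if "(x, t) \<in> spacetime" for x t
  proof -
    have "(past_sup u x t < ustar \<longrightarrow> p x t = 0) \<and> (past_sup u x t = ustar \<longrightarrow> p x t \<in> {0..1}) \<and>
        (past_sup u x t > ustar \<longrightarrow> p x t = 1)"
      using ws' that by blast
    then show ?thesis by (cases "past_sup u x t" ustar rule: linorder_cases) auto
  qed
  have weak: "(LINT s:{0..t}|lebesgue. (LINT y|lebesgue. t_deriv t \<phi> y s * w y s)) =
      (LINT s:{0..t}|lebesgue. (LINT y|lebesgue. x_deriv \<phi> y s * x_deriv w y s + p y s * u y s * \<phi> y s))"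
    if "t > 0" "test_function t \<phi>" for t \<phi>
    using ws' that unfolding w_def[abs_def] by blast
  obtain g where g: "C10 T g" "Linfty T g" "\<And>x t. (x, t) \<in> strip T \<inter> spacetime \<Longrightarrow> w x t = g x t"
    using reg unfolding regular_part_def by auto
  obtain M where M: "AE (x, t) in lebesgue_on (strip T). \<bar>g x t\<bar> \<le> M"
    using g(2) unfolding Linfty_def by blast
  have g_bound: "\<bar>g y s\<bar> \<le> M" if "(y, s) \<in> strip T" for y s
    by (rule continuous_on_strip_AE_bounded[OF _ T M that]) (use g(1) in \<open>simp add: C10_def\<close>)
  have u_eq: "u y s = g y s + psi \<alpha> \<beta> y s" if "(y, s) \<in> strip T \<inter> spacetime" for y s
    using g(3)[OF that] by (simp add: w_def)
  have "spacetime \<in> sets borel"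
    unfolding spacetime_def by (intro sets.Diff borel_closed closed_Times) auto
  then have st: "spacetime \<in> sets lebesgue" by simp
  \<comment> \<open>A Borel version of \<open>p\<close> extended by 0 to the plane.\<close>
  obtain q where q: "q \<in> borel_measurable lborel"
    "AE z in lborel. (if z \<in> spacetime then (\<lambda>(x, t). p x t) z else 0) = q z"
    using completion_ex_borel_measurable_real[OF borel_measurable_if_I[OF p_meas st]] by blast
  \<comment> \<open>Clamping \<open>q\<close> to the range of \<open>p\<close> makes the bound on
    \<open>F\<close> hold everywhere without changing \<open>F\<close> almost everywhere. The inner
    indicator is there for measurability, since \<open>g\<close> is controlled on the strip
    only.\<close>
  define F where "F y s = indicator {0<..T} s * max 0 (min 1 (q (y, s)))
      * (indicator {0..T} s * g y s + psi \<alpha> \<beta> y s)" for y s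
  have F_meas: "(\<lambda>(y, s). F y s) \<in> borel_measurable borel"
  proof -
    have [measurable]: "q \<in> borel_measurable borel" using q(1) by simp
    have [measurable]: "(\<lambda>(y, s). indicator {0..T} s * g y s) \<in> borel_measurable borel"
      by (rule indicator_strip_measurable) (use g(1) in \<open>simp add: C10_def\<close>)
    note [measurable] = psi_measurable[OF ab]
    have [measurable]: "(\<lambda>z :: real \<times> real. indicator {0<..T} (snd z) :: real) \<in> borel_measurable borel"
      unfolding borel_prod[symmetric] by measurable
    have "(\<lambda>z. indicator {0<..T} (snd z) * max 0 (min 1 (q z))
        * ((\<lambda>(y, s). indicator {0..T} s * g y s) z + (\<lambda>(y, s). psi \<alpha> \<beta> y s) z)) \<in> borel_measurable borel"
      by measurable
    then show ?thesis by (simp add: F_def case_prod_unfold)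
  qed
  have F_bound: "\<bar>F y s\<bar> \<le> (if s \<in> {0<..T} then \<bar>g y s + psi \<alpha> \<beta> y s\<bar> else 0)" for y s
    by (auto simp: F_def abs_mult intro!: mult_left_le_one_le)
  have F_eq: "AE s in lborel. s \<in> {0<..T} \<longrightarrow> (AE y in lborel. F y s = p y s * u y s)"
    using AE_lborel_swap[OF q(2)]
  proof eventually_elim
    case (elim s)
    show ?case
    proof
      assume s: "s \<in> {0<..T}"
      show "AE y in lborel. F y s = p y s * u y s"
        using elim
      proof eventually_elim
        case (elim y)
        have "(y, s) \<in> spacetime" "(y, s) \<in> strip T" using s by (auto simp: spacetime_def strip_def)
        then show ?case using elim p01[of y s] u_eq[of y s] s by (simp add: F_def)
      qed
    qed
  qed
  have heat: "weak_heat t g F" if t: "0 < t" "t \<le> T" for t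
    unfolding weak_heat_def
  proof (intro allI impI)
    fix \<phi> assume \<phi>: "test_function t \<phi>"
    have gt: "C10 t g" by (rule C10_mono[OF g(1) t(2)])
    have C11: "C11 t \<phi>" using \<phi> by (simp add: test_function_def)
    then have C10: "C10 t \<phi>" by (simp add: C11_def)
    \<comment> \<open>Time 0 is left out: at the origin \<open>w\<close> and its extension
      \<open>g\<close> may differ, which also spoils the space derivative of \<open>w\<close>
      there.\<close>
    have wg: "w y s = g y s" "x_deriv w y s = x_deriv g y s" if "s \<in> {0<..t}" for y s
    proof -
      have *: "w y s = g y s" for y
        using that t by (intro g(3)) (auto simp: spacetime_def strip_def)
      show "w y s = g y s" by (rule *)
      show "x_deriv w y s = x_deriv g y s" by (simp add: x_deriv_def *)
    qed
    have nz: "AE s in lborel. s \<noteq> (0 :: real)" by (rule AE_lborel_singleton)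
    have I: "(\<lambda>z. indicator {0..t} (snd z) * f (fst z) (snd z)) \<in> borel_measurable borel"
      if "continuous_on (strip t) (\<lambda>(y, s). f y s)" for f :: "real \<Rightarrow> real \<Rightarrow> real"
      using indicator_strip_measurable[OF that] by (simp add: case_prod_unfold)
    have [measurable]: "(\<lambda>z. F (fst z) (snd z)) \<in> borel_measurable borel"
      using F_meas by (simp add: case_prod_unfold)
    have [measurable]: "(\<lambda>z. indicator {0..t} (snd z) * t_deriv t \<phi> (fst z) (snd z)) \<in> borel_measurable borel"
      "(\<lambda>z. indicator {0..t} (snd z) * g (fst z) (snd z)) \<in> borel_measurable borel"
      "(\<lambda>z. indicator {0..t} (snd z) * \<phi> (fst z) (snd z)) \<in> borel_measurable borel"
      "(\<lambda>z. indicator {0..t} (snd z) * x_deriv \<phi> (fst z) (snd z)) \<in> borel_measurable borel"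
      "(\<lambda>z. indicator {0..t} (snd z) * x_deriv g (fst z) (snd z)) \<in> borel_measurable borel"
      using C11 gt by (auto intro!: I simp: C11_def C10_def)
    have "(LINT s:{0..t}|lborel. LINT y|lborel. t_deriv t \<phi> y s * g y s)
        = (LINT s:{0..t}|lebesgue. LINT y|lebesgue. t_deriv t \<phi> y s * w y s)"
    proof (rule iterated_integral_lebesgue_eq_lborel[symmetric])
      have "(\<lambda>(y, s). indicator {0..t} s * (t_deriv t \<phi> y s * g y s))
        = (\<lambda>z. (indicator {0..t} (snd z) * t_deriv t \<phi> (fst z) (snd z)) * (indicator {0..t} (snd z) * g (fst z) (snd z)))"
        by (auto simp: fun_eq_iff indicator_def)
      then show "(\<lambda>(y, s). indicator {0..t} s * (t_deriv t \<phi> y s * g y s)) \<in> borel_measurable borel"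
        by simp
      show "AE s in lborel. s \<in> {0..t} \<longrightarrow> (AE y in lborel. t_deriv t \<phi> y s * w y s = t_deriv t \<phi> y s * g y s)"
        using nz by eventually_elim (simp add: wg)
    qed
    also have "\<dots> = (LINT s:{0..t}|lebesgue. (LINT y|lebesgue. x_deriv \<phi> y s * x_deriv w y s + p y s * u y s * \<phi> y s))"
      by (rule weak[OF t(1) \<phi>])
    also have "\<dots> = (LINT s:{0..t}|lborel. LINT y|lborel. x_deriv \<phi> y s * x_deriv g y s + F y s * \<phi> y s)"
    proof (rule iterated_integral_lebesgue_eq_lborel)
      have "(\<lambda>(y, s). indicator {0..t} s * (x_deriv \<phi> y s * x_deriv g y s + F y s * \<phi> y s))
        = (\<lambda>z. (indicator {0..t} (snd z) * x_deriv \<phi> (fst z) (snd z)) * (indicator {0..t} (snd z) * x_deriv g (fst z) (snd z))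
            + F (fst z) (snd z) * (indicator {0..t} (snd z) * \<phi> (fst z) (snd z)))"
        by (auto simp: fun_eq_iff indicator_def)
      then show "(\<lambda>(y, s). indicator {0..t} s * (x_deriv \<phi> y s * x_deriv g y s + F y s * \<phi> y s)) \<in> borel_measurable borel"
        by simp
      show "AE s in lborel. s \<in> {0..t} \<longrightarrow> (AE y in lborel. x_deriv \<phi> y s * x_deriv w y s + p y s * u y s * \<phi> y s
          = x_deriv \<phi> y s * x_deriv g y s + F y s * \<phi> y s)"
        using F_eq nz
      proof eventually_elim
        case (elim s)
        show ?case
        proof
          assume "s \<in> {0..t}"
          then have s: "s \<in> {0<..t}" "s \<in> {0<..T}" using elim(2) t by auto
          from elim(1) s(2) have "AE y in lborel. F y s = p y s * u y s" by blast
          then show "AE y in lborel. x_deriv \<phi> y s * x_deriv w y s + p y s * u y s * \<phi> y s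
            = x_deriv \<phi> y s * x_deriv g y s + F y s * \<phi> y s"
            by eventually_elim (simp add: wg[OF s(1)])
        qed
      qed
    qed
    finally show "(LINT s:{0..t}|lborel. LINT y|lborel. t_deriv t \<phi> y s * g y s)
      = (LINT s:{0..t}|lborel. LINT y|lborel. x_deriv \<phi> y s * x_deriv g y s + F y s * \<phi> y s)" .
  qed
  show ?thesis by (rule that[OF g(1) g_bound u_eq F_meas F_bound heat F_eq])
qed

section \<open>A priori bounds for short times\<close>

text \<open>Continuity carries the bound to \<open>t = 0\<close>, where it says
  \<open>g x 0 = 0\<close>; the weak form expresses this initial condition only through its test
  functions.\<close>

lemma C10_le_time_extend:
  assumes g: "C10 T g" and T: "T > 0"
    and le: "\<And>t. 0 < t \<Longrightarrow> t \<le> T \<Longrightarrow> \<bar>g x t\<bar> \<le> K * t" and "(x, t) \<in> strip T"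
  shows "\<bar>g x t\<bar> \<le> K * t"
proof (cases "t = 0")
  case True
  define u where "u n = T * inverse (real (Suc n))" for n
  have u: "u \<longlonglongrightarrow> 0"
    unfolding u_def using tendsto_mult_right_zero[OF LIMSEQ_inverse_real_of_nat] .
  have u_in: "0 < u n" "u n \<le> T" for n
    using T by (auto simp: u_def field_simps)
  have "continuous_on (strip T) (\<lambda>(x, t). g x t)" using g by (simp add: C10_def)
  then have "(\<lambda>n. (\<lambda>(x, t). g x t) (x, u n)) \<longlonglongrightarrow> (\<lambda>(x, t). g x t) (x, 0)"
    by (rule continuous_on_tendsto_compose)
      (use u u_in T in \<open>auto intro!: tendsto_intros always_eventually simp: strip_def less_imp_le\<close>)
  then have "(\<lambda>n. g x (u n)) \<longlonglongrightarrow> g x 0" by simp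
  then have "(\<lambda>n. \<bar>g x (u n)\<bar>) \<longlonglongrightarrow> \<bar>g x 0\<bar>" by (rule tendsto_rabs)
  moreover have "(\<lambda>n. K * u n) \<longlonglongrightarrow> K * 0" by (intro tendsto_intros u)
  ultimately have "\<bar>g x 0\<bar> \<le> K * 0"
    by (rule LIMSEQ_le) (use le[OF u_in] in auto)
  then show ?thesis using True by simp
qed (use le assms(4) in \<open>auto simp: strip_def\<close>)

text \<open>The bound given with a solution depends on that solution. But if \<open>m\<close> is the
  supremum of \<open>\<bar>g\<bar>\<close>, the source is at most \<open>m + ?U\<close>, so Duhamel
  gives \<open>m \<le> (m + ?U) * T \<le> (m + ?U) / 2\<close>, that is \<open>m \<le> ?U\<close>.
  Repeating the estimate with \<open>?U\<close> in place of \<open>m\<close> yields the linear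
  growth in time.\<close>

lemma weak_solution_apriori:
  assumes ab: "\<alpha> > 0" "\<beta> > 0" and ws: "weak_solution \<alpha> \<beta> ustar (u, p)" and T: "0 < T" "T \<le> 1 / 2"
  obtains g F where "weak_heat_solution T (Psi \<alpha> \<beta> \<alpha>) (2 * Psi \<alpha> \<beta> \<alpha>) g F"
    "\<And>y s. (y, s) \<in> strip T \<Longrightarrow> \<bar>g y s\<bar> \<le> 2 * Psi \<alpha> \<beta> \<alpha> * s"
    "\<And>y s. (y, s) \<in> strip T \<inter> spacetime \<Longrightarrow> u y s = g y s + psi \<alpha> \<beta> y s"
    "AE s in lborel. s \<in> {0<..T} \<longrightarrow> (AE y in lborel. F y s = p y s * u y s)"
proof -
  let ?U = "Psi \<alpha> \<beta> \<alpha>"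
  obtain g F M where g: "C10 T g" "\<And>y s. (y, s) \<in> strip T \<Longrightarrow> \<bar>g y s\<bar> \<le> M"
    "\<And>y s. (y, s) \<in> strip T \<inter> spacetime \<Longrightarrow> u y s = g y s + psi \<alpha> \<beta> y s"
    and F: "(\<lambda>(y, s). F y s) \<in> borel_measurable borel"
    "\<And>y s. \<bar>F y s\<bar> \<le> (if s \<in> {0<..T} then \<bar>g y s + psi \<alpha> \<beta> y s\<bar> else 0)"
    "\<And>t. 0 < t \<Longrightarrow> t \<le> T \<Longrightarrow> weak_heat t g F"
    "AE s in lborel. s \<in> {0<..T} \<longrightarrow> (AE y in lborel. F y s = p y s * u y s)"
    by (rule weak_solution_heat[OF ab ws T(1)]) (rule that)
  have U: "0 \<le> ?U" by (rule Psi_nonneg[OF ab])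
  \<comment> \<open>Stated for an arbitrary bound \<open>m\<close> because it is used twice, with
    the supremum and with \<open>?U\<close>.\<close>
  have sol: "weak_heat_solution T m (m + ?U) g F"
    if m: "\<And>y s. (y, s) \<in> strip T \<Longrightarrow> \<bar>g y s\<bar> \<le> m" for m
  proof
    fix y s :: real
    have "m \<ge> 0" using m[of 0 0] T by (simp add: strip_def)
    show "\<bar>F y s\<bar> \<le> m + ?U"
    proof (cases "s \<in> {0<..T}")
      case True
      then have "\<bar>g y s\<bar> \<le> m" by (intro m) (auto simp: strip_def)
      moreover have "0 \<le> psi \<alpha> \<beta> y s" "psi \<alpha> \<beta> y s \<le> ?U" using psi_bounds[OF ab] by auto
      moreover have "\<bar>F y s\<bar> \<le> \<bar>g y s + psi \<alpha> \<beta> y s\<bar>" using F(2)[of y s] True by simp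
      ultimately show ?thesis by linarith
    qed (use F(2)[of y s] \<open>m \<ge> 0\<close> U in auto)
  qed (use g F m in auto)
  have improve: "\<bar>g y s\<bar> \<le> (m + ?U) * s"
    if m: "\<And>y s. (y, s) \<in> strip T \<Longrightarrow> \<bar>g y s\<bar> \<le> m" and "(y, s) \<in> strip T" for m y s
    by (rule C10_le_time_extend[OF g(1) T(1) weak_heat_solution.w_le[OF sol[OF m]] that(2)])
  define m where "m = (SUP z\<in>strip T. \<bar>(\<lambda>(y, s). g y s) z\<bar>)"
  have ne: "strip T \<noteq> {}" using T by (auto simp: strip_def)
  have bdd: "bdd_above ((\<lambda>z. \<bar>(\<lambda>(y, s). g y s) z\<bar>) ` strip T)"
    using g(2) by (intro bdd_aboveI2[where M = M]) auto
  have m: "\<bar>g y s\<bar> \<le> m" if "(y, s) \<in> strip T" for y s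
    using cSUP_upper[OF that bdd] by (simp add: m_def)
  have "m \<ge> 0" using m[of 0 0] T by (simp add: strip_def)
  have "m \<le> (m + ?U) * T"
    unfolding m_def
  proof (rule cSUP_least[OF ne], fold m_def)
    fix z assume z: "z \<in> strip T"
    then have "\<bar>(\<lambda>(y, s). g y s) z\<bar> \<le> (m + ?U) * snd z"
      using improve[OF m, of "fst z" "snd z"] by (cases z) simp
    also have "\<dots> \<le> (m + ?U) * T"
      using z \<open>m \<ge> 0\<close> U by (intro mult_left_mono) (auto simp: strip_def)
    finally show "\<bar>(\<lambda>(y, s). g y s) z\<bar> \<le> (m + ?U) * T" .
  qed
  also have "\<dots> \<le> (m + ?U) * (1 / 2)"
    using T \<open>m \<ge> 0\<close> U by (intro mult_left_mono) auto
  finally have "m \<le> ?U" by simp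
  then have gU: "\<bar>g y s\<bar> \<le> ?U" if "(y, s) \<in> strip T" for y s
    using m[OF that] by simp
  show ?thesis
  proof (rule that[OF _ _ g(3) F(4)])
    show "weak_heat_solution T ?U (2 * ?U) g F" using sol[OF gU] by simp
    show "\<bar>g y s\<bar> \<le> 2 * ?U * s" if "(y, s) \<in> strip T" for y s
      using improve[OF gU that] by simp
  qed
qed

section \<open>Suprema over the past\<close>

text \<open>A real \<open>SUP\<close> says something only for nonempty sets that are bounded above:
  hence \<open>K\<close> here, and \<open>t > 0\<close> in \<open>past_sup_least\<close>, where it
  keeps the set nonempty at \<open>x = 0\<close> too.\<close>

lemma past_sup_upper:
  assumes "\<And>s. (x, s) \<in> strip t \<inter> spacetime \<Longrightarrow> u x s \<le> K" and "0 < s" "s \<le> t"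
  shows "u x s \<le> past_sup u x t"
  unfolding past_sup_def
  by (rule cSUP_upper) (use assms in \<open>auto simp: spacetime_def strip_def intro!: bdd_aboveI2[where M = K]\<close>)

lemma past_sup_least:
  assumes "t > 0" "\<And>s. (x, s) \<in> strip t \<inter> spacetime \<Longrightarrow> u x s \<le> K"
  shows "past_sup u x t \<le> K"
  unfolding past_sup_def
proof (rule cSUP_least)
  show "{s \<in> {0..t}. (x, s) \<in> spacetime} \<noteq> {}" using assms(1) by (auto simp: spacetime_def intro!: exI[of _ t])
qed (use assms in \<open>auto simp: strip_def\<close>)

lemma past_sup_le_add:
  assumes "t > 0" and b: "\<And>s. (x, s) \<in> strip t \<inter> spacetime \<Longrightarrow> v x s \<le> K"
    and le: "\<And>s. (x, s) \<in> strip t \<inter> spacetime \<Longrightarrow> u x s \<le> v x s + \<delta>"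
  shows "past_sup u x t \<le> past_sup v x t + \<delta>"
proof (rule past_sup_least[OF assms(1)])
  fix s assume s: "(x, s) \<in> strip t \<inter> spacetime"
  have "v x s \<le> past_sup v x t"
    unfolding past_sup_def
    by (rule cSUP_upper) (use s b in \<open>auto simp: strip_def intro!: bdd_aboveI2[where M = K]\<close>)
  then show "u x s \<le> past_sup v x t + \<delta>" using le[OF s] by simp
qed

subsection \<open>Uniqueness\<close>

text \<open>The second point \<open>x'\<close> has nearly reached the threshold at some time \<open>s\<close>, at which the
  first point has not exceeded it by more than \<open>\<delta>\<close>; but at that time \<open>u\<close> falls from \<open>x\<close> to
  \<open>x'\<close> at the rate at which \<open>\<Psi>\<close> decreases beyond \<open>\<alpha>\<close>.\<close>

lemma mismatch_width:
  fixes u g :: "real \<Rightarrow> real \<Rightarrow> real"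
  assumes ab: "\<alpha> > 0" "\<beta> > 0" and t: "t > 0"
    and u: "\<And>y s. (y, s) \<in> strip t \<inter> spacetime \<Longrightarrow> u y s = g y s + psi \<alpha> \<beta> y s"
    and ga: "\<And>y s. (y, s) \<in> strip t \<Longrightarrow> \<bar>g y s\<bar> \<le> a" and g0: "\<And>y. g y 0 = 0"
    and lip: "\<And>y y' s. 0 < s \<Longrightarrow> s \<le> t \<Longrightarrow> \<bar>g y s - g y' s\<bar> \<le> L * sqrt s * \<bar>y - y'\<bar>"
    and c: "c > 0" "\<And>\<eta> \<theta>. \<alpha> \<le> \<eta> \<Longrightarrow> \<eta> \<le> \<theta> \<Longrightarrow> \<theta> \<le> H \<Longrightarrow> c * (\<theta> - \<eta>) \<le> Psi \<alpha> \<beta> \<eta> - Psi \<alpha> \<beta> \<theta>"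
    and H: "Psi \<alpha> \<beta> H < ustar / 2"
    and small: "\<delta> + a < Psi \<alpha> \<beta> \<alpha> - ustar" "\<delta> + a < ustar / 2" "L * t \<le> c / 2" "L \<ge> 0" "\<delta> \<ge> 0"
    and upper: "\<And>s. 0 < s \<Longrightarrow> s \<le> t \<Longrightarrow> u x s \<le> ustar + \<delta>"
    and lower: "ustar - \<delta> \<le> past_sup u x' t"
    and x: "0 < x" "x < x'"
  shows "x' - x \<le> 4 * \<delta> * sqrt t / c"
proof -
  have a: "a \<ge> 0" using ga[of 0 0] t by (simp add: strip_def)
  have mem: "(y, s) \<in> strip t" "(y, s) \<in> spacetime" if "0 < s" "s \<le> t" for y s
    using that by (auto simp: strip_def spacetime_def)
  \<comment> \<open>On the plateau \<open>u x t\<close> would be at least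
    \<open>Psi \<alpha> \<beta> \<alpha> - a\<close>, which exceeds
    \<open>ustar + \<delta>\<close>.\<close>
  have "Psi \<alpha> \<beta> (x / sqrt t) < Psi \<alpha> \<beta> \<alpha>"
    using upper[OF t order_refl] u[of x t] ga[of x t] mem[OF t order_refl, of x] small x t
    by (simp add: psi_def)
  then have x_\<alpha>: "\<alpha> < x / sqrt t" by (cases "x / sqrt t \<le> \<alpha>") (auto simp: Psi_def)
  \<comment> \<open>The supremum over the past need not be attained, so a slack \<gamma> is allowed
    and removed at the end.\<close>
  have step: "(x' - x) * c / (2 * sqrt t) \<le> 2 * \<delta> + \<gamma>" if \<gamma>: "0 < \<gamma>" "\<delta> + a + \<gamma> \<le> ustar / 2" for \<gamma>
  proof -
    obtain s where s: "(x', s) \<in> strip t \<inter> spacetime" "ustar - \<delta> - \<gamma> < u x' s"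
    proof (rule ccontr)
      assume "\<not> thesis"
      then have "past_sup u x' t \<le> ustar - \<delta> - \<gamma>"
        using that by (intro past_sup_least[OF t]) (auto simp: not_less[symmetric])
      then show False using lower \<gamma>(1) by simp
    qed
    \<comment> \<open>At time 0 both \<open>g\<close> and \<open>psi\<close> vanish, whereas
      \<open>ustar - \<delta> - \<gamma>\<close> is positive.\<close>
    have "s \<noteq> 0"
    proof
      assume "s = 0"
      then have "u x' s = 0" using u[OF s(1)] g0 by (simp add: psi_def)
      then show False using s(2) \<gamma> small(5) a by linarith
    qed
    then have s_pos: "0 < s" "s \<le> t" using s(1) by (auto simp: strip_def)
    have u': "u y s = g y s + Psi \<alpha> \<beta> (y / sqrt s)" if "y > 0" for y
      using u[of y s] mem[OF s_pos] that s_pos by (simp add: psi_def)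
    \<comment> \<open>By the choice of \<gamma>, the profile at \<open>x' / sqrt s\<close> exceeds
      \<open>ustar - \<delta> - \<gamma> - a \<ge> ustar / 2\<close>.\<close>
    have "Psi \<alpha> \<beta> H < Psi \<alpha> \<beta> (x' / sqrt s)"
      using u'[of x'] s(2) ga[OF mem(1)[OF s_pos], of x'] H \<gamma> x by linarith
    then have H': "x' / sqrt s \<le> H" using Psi_antimono[OF ab, of H "x' / sqrt s"] by linarith
    \<comment> \<open>Going back in time increases the similarity variable, so \<open>x\<close> is
      beyond the kink at time \<open>s\<close> as well, and both points lie in the range where
      \<open>c\<close> bounds the slope.\<close>
    have "x / sqrt t \<le> x / sqrt s"
      using s_pos x by (intro divide_left_mono) auto
    then have "c * (x' / sqrt s - x / sqrt s) \<le> Psi \<alpha> \<beta> (x / sqrt s) - Psi \<alpha> \<beta> (x' / sqrt s)"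
      using x_\<alpha> H' x s_pos by (intro c(2)) (auto intro!: divide_right_mono)
    also have "\<dots> = (u x s - g x s) - (u x' s - g x' s)"
      using u'[of x] u'[of x'] x by simp
    also have "\<dots> \<le> 2 * \<delta> + \<gamma> + L * sqrt s * (x' - x)"
      using upper[OF s_pos] s(2) lip[OF s_pos, of x x'] x by (simp add: abs_le_iff)
    finally have "c * ((x' - x) / sqrt s) - L * sqrt s * (x' - x) \<le> 2 * \<delta> + \<gamma>"
      by (simp add: diff_divide_distrib)
    \<comment> \<open>The regular part \<open>g\<close> can compensate at most half of the fall of
      the profile; this is the purpose of \<open>L * t \<le> c / 2\<close>.\<close>
    moreover have "L * sqrt s * (x' - x) \<le> c / 2 * ((x' - x) / sqrt s)"
    proof -
      have "L * s \<le> c / 2" using small(3,4) s_pos mult_left_mono[of s t L] by linarith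
      then have "L * s * ((x' - x) / sqrt s) \<le> c / 2 * ((x' - x) / sqrt s)"
        using x s_pos by (intro mult_right_mono) auto
      moreover have "s / sqrt s = sqrt s" using s_pos by (simp add: real_div_sqrt)
      then have "L * s * ((x' - x) / sqrt s) = L * sqrt s * (x' - x)"
        by (metis (no_types, opaque_lifting) mult.assoc mult.commute times_divide_eq_left)
      ultimately show ?thesis by simp
    qed
    ultimately have "c / 2 * ((x' - x) / sqrt s) \<le> 2 * \<delta> + \<gamma>" by (simp add: algebra_simps)
    moreover have "c / 2 * ((x' - x) / sqrt t) \<le> c / 2 * ((x' - x) / sqrt s)"
      using x s_pos c(1) by (intro mult_left_mono divide_left_mono) auto
    ultimately show ?thesis by (simp add: mult.commute)
  qed
  have "(x' - x) * c / (2 * sqrt t) \<le> 2 * \<delta>"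
  proof (rule ccontr)
    define e where "e = (x' - x) * c / (2 * sqrt t) - 2 * \<delta>"
    assume "\<not> ?thesis"
    then have e: "e > 0" by (simp add: e_def)
    \<comment> \<open>At most half of the supposed excess \<open>e\<close>, which contradicts
      \<open>e \<le> \<gamma>\<close>.\<close>
    define \<gamma> where "\<gamma> = min (e / 2) (ustar / 2 - \<delta> - a)"
    have \<gamma>: "\<gamma> \<le> e / 2" "\<gamma> \<le> ustar / 2 - \<delta> - a" "\<gamma> > 0"
      using e small(2) by (auto simp: \<gamma>_def min_def)
    have "(x' - x) * c / (2 * sqrt t) \<le> 2 * \<delta> + \<gamma>"
      using \<gamma> by (intro step) auto
    then have "e \<le> \<gamma>" by (simp only: e_def diff_le_eq add.commute)
    then show False using e \<gamma>(1) by linarith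
  qed
  then show ?thesis using c(1) t by (simp add: field_simps)
qed

text \<open>The conditions on \<open>T\<close> come from the estimates: \<open>6 * U * T\<close> is
  the sum of the bounds \<open>4 * U * T\<close> for \<delta> and \<open>2 * U * T\<close> for
  \<open>g\<close>; \<open>8 * sqrt 2 * U\<close> is the Lipschitz constant of
  \<open>w_lipschitz\<close> for a source bounded by \<open>2 * U\<close>; the last condition makes
  the contraction factor at most 1/2.\<close>

lemma uniqueness_on_strip:
  fixes \<alpha> \<beta> ustar c H T :: real
  defines "U \<equiv> Psi \<alpha> \<beta> \<alpha>"
  assumes ab: "\<alpha> > 0" "\<beta> > 0"
    and c: "c > 0" "\<And>\<eta> \<theta>. \<alpha> \<le> \<eta> \<Longrightarrow> \<eta> \<le> \<theta> \<Longrightarrow> \<theta> \<le> H \<Longrightarrow> c * (\<theta> - \<eta>) \<le> Psi \<alpha> \<beta> \<eta> - Psi \<alpha> \<beta> \<theta>"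
    and H: "Psi \<alpha> \<beta> H < ustar / 2"
    and T: "0 < T" "T \<le> 1 / 2" "6 * U * T < U - ustar" "6 * U * T < ustar / 2"
      "8 * sqrt 2 * U * T \<le> c / 2" "T * (1 + 128 * U / c) \<le> 1 / 2"
    and ws1: "weak_solution \<alpha> \<beta> ustar (u1, p1)" and ws2: "weak_solution \<alpha> \<beta> ustar (u2, p2)"
  shows "\<forall>(x, t) \<in> strip T \<inter> spacetime. u1 x t = u2 x t"
    and "AE (x, t) in lebesgue_on (strip T). p1 x t = p2 x t"
proof -
  have U: "U \<ge> 0" unfolding U_def by (rule Psi_nonneg[OF ab])
  obtain g1 F1 where g1: "weak_heat_solution T U (2 * U) g1 F1"
    "\<And>y s. (y, s) \<in> strip T \<Longrightarrow> \<bar>g1 y s\<bar> \<le> 2 * U * s"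
    "\<And>y s. (y, s) \<in> strip T \<inter> spacetime \<Longrightarrow> u1 y s = g1 y s + psi \<alpha> \<beta> y s"
    "AE s in lborel. s \<in> {0<..T} \<longrightarrow> (AE y in lborel. F1 y s = p1 y s * u1 y s)"
    by (rule weak_solution_apriori[OF ab ws1 T(1,2), folded U_def]) (rule that)
  obtain g2 F2 where g2: "weak_heat_solution T U (2 * U) g2 F2"
    "\<And>y s. (y, s) \<in> strip T \<Longrightarrow> \<bar>g2 y s\<bar> \<le> 2 * U * s"
    "\<And>y s. (y, s) \<in> strip T \<inter> spacetime \<Longrightarrow> u2 y s = g2 y s + psi \<alpha> \<beta> y s"
    "AE s in lborel. s \<in> {0<..T} \<longrightarrow> (AE y in lborel. F2 y s = p2 y s * u2 y s)"
    by (rule weak_solution_apriori[OF ab ws2 T(1,2), folded U_def]) (rule that)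
  have even: "p1 (- x) t = p1 x t" "p2 (- x) t = p2 x t" if "(x, t) \<in> spacetime" for x t
    using ws1 ws2 that unfolding weak_solution_def Let_def by auto
  have threshold:
    "past_sup u1 x t < ustar \<longrightarrow> p1 x t = 0" "past_sup u1 x t = ustar \<longrightarrow> p1 x t \<in> {0..1}"
    "past_sup u1 x t > ustar \<longrightarrow> p1 x t = 1"
    "past_sup u2 x t < ustar \<longrightarrow> p2 x t = 0" "past_sup u2 x t = ustar \<longrightarrow> p2 x t \<in> {0..1}"
    "past_sup u2 x t > ustar \<longrightarrow> p2 x t = 1" if "(x, t) \<in> spacetime" for x t
    using ws1 ws2 that unfolding weak_solution_def Let_def by auto
  have p01: "\<bar>p1 x t\<bar> \<le> 1" "\<bar>p2 x t\<bar> \<le> 1" if "(x, t) \<in> spacetime" for x t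
    using threshold(1-3)[OF that] threshold(4-6)[OF that]
    by (cases "past_sup u1 x t" ustar rule: linorder_cases;
        cases "past_sup u2 x t" ustar rule: linorder_cases; simp)+
  have mem: "(y, s) \<in> strip T" "(y, s) \<in> spacetime" if "0 < s" "s \<le> T" for y s
    using that by (auto simp: strip_def spacetime_def)
  have g_small: "\<bar>g1 y s\<bar> \<le> 2 * U * T" "\<bar>g2 y s\<bar> \<le> 2 * U * T" if "(y, s) \<in> strip T" for y s
  proof -
    have "2 * U * s \<le> 2 * U * T" using that U by (intro mult_left_mono) (auto simp: strip_def)
    then show "\<bar>g1 y s\<bar> \<le> 2 * U * T" "\<bar>g2 y s\<bar> \<le> 2 * U * T"
      using g1(2)[OF that] g2(2)[OF that] by auto
  qed
  have "2 * U * T \<le> U" using T(2) U mult_left_mono[of "2 * T" 1 U] by (simp add: mult_ac)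
  then have u_bound: "\<bar>u1 y s\<bar> \<le> 2 * U" "\<bar>u2 y s\<bar> \<le> 2 * U" if "(y, s) \<in> strip T \<inter> spacetime" for y s
    using g_small[of y s] that g1(3)[OF that] g2(3)[OF that] psi_bounds[OF ab, of y s, folded U_def]
    by auto
  \<comment> \<open>The distance is measured by the regular parts, which are defined on the whole
    strip; away from the origin their difference is that of the solutions.\<close>
  define \<delta> where "\<delta> = (SUP z\<in>strip T. \<bar>(\<lambda>(y, s). g1 y s - g2 y s) z\<bar>)"
  have ne: "strip T \<noteq> {}" using T by (auto simp: strip_def)
  have diff_le: "\<bar>(\<lambda>(y, s). g1 y s - g2 y s) z\<bar> \<le> 4 * U * T" if "z \<in> strip T" for z
    using g_small[of "fst z" "snd z"] that by (cases z) auto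
  have bdd: "bdd_above ((\<lambda>z. \<bar>(\<lambda>(y, s). g1 y s - g2 y s) z\<bar>) ` strip T)"
    using diff_le by (intro bdd_aboveI2)
  have \<delta>: "\<bar>g1 y s - g2 y s\<bar> \<le> \<delta>" if "(y, s) \<in> strip T" for y s
    using cSUP_upper[OF that bdd] by (simp add: \<delta>_def)
  have \<delta>_le: "\<delta> \<le> 4 * U * T" unfolding \<delta>_def by (rule cSUP_least[OF ne diff_le])
  have \<delta>_nonneg: "\<delta> \<ge> 0" using \<delta>[of 0 0] T by (simp add: strip_def)
  have u_diff: "\<bar>u1 y s - u2 y s\<bar> \<le> \<delta>" if "(y, s) \<in> strip T \<inter> spacetime" for y s
    using \<delta>[of y s] that g1(3)[OF that] g2(3)[OF that] by simp

  \<comment> \<open>Outside this band both past suprema lie strictly on the same side of the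
    threshold, and there \<open>p1\<close> and \<open>p2\<close> have the same value 0 or 1. The
    undetermined values of \<open>p\<close> at the threshold itself fall into the band.\<close>
  have near: "ustar - \<delta> \<le> past_sup u1 x s" "past_sup u1 x s \<le> ustar + \<delta>"
    if s: "0 < s" "s \<le> T" and ne: "p1 x s \<noteq> p2 x s" for x s
  proof -
    have sub: "(x, r) \<in> strip T \<inter> spacetime" if "(x, r) \<in> strip s \<inter> spacetime" for r
      using that s by (auto simp: strip_def)
    have 1: "past_sup u1 x s \<le> past_sup u2 x s + \<delta>"
    proof (rule past_sup_le_add[OF s(1)])
      fix r assume r: "(x, r) \<in> strip s \<inter> spacetime"
      show "u2 x r \<le> 2 * U" "u1 x r \<le> u2 x r + \<delta>"
        using u_bound(2)[OF sub[OF r]] u_diff[OF sub[OF r]] by auto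
    qed
    have 2: "past_sup u2 x s \<le> past_sup u1 x s + \<delta>"
    proof (rule past_sup_le_add[OF s(1)])
      fix r assume r: "(x, r) \<in> strip s \<inter> spacetime"
      show "u1 x r \<le> 2 * U" "u2 x r \<le> u1 x r + \<delta>"
        using u_bound(1)[OF sub[OF r]] u_diff[OF sub[OF r]] by auto
    qed
    note th = threshold[OF mem(2)[OF s], of x]
    show "ustar - \<delta> \<le> past_sup u1 x s"
    proof (rule ccontr)
      assume "\<not> ?thesis"
      then have "past_sup u1 x s < ustar" "past_sup u2 x s < ustar" using 2 \<delta>_nonneg by auto
      then show False using th ne by simp
    qed
    show "past_sup u1 x s \<le> ustar + \<delta>"
    proof (rule ccontr)
      assume "\<not> ?thesis"
      then have "past_sup u1 x s > ustar" "past_sup u2 x s > ustar" using 1 \<delta>_nonneg by auto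
      then show False using th ne by simp
    qed
  qed

  define d where "d = 4 * \<delta> * sqrt T / c"
  have d: "d \<ge> 0" using \<delta>_nonneg T c by (simp add: d_def)
  have width: "x' - x \<le> d"
    if s: "0 < s" "s \<le> T" and x: "0 < x" "x < x'" and ne: "p1 x s \<noteq> p2 x s" "p1 x' s \<noteq> p2 x' s" for x x' s
  proof -
    have "x' - x \<le> 4 * \<delta> * sqrt s / c"
    proof (rule mismatch_width[where u = u1 and g = g1 and a = "2 * U * T" and L = "8 * sqrt 2 * U"
          and H = H and ustar = ustar, OF ab s(1)])
      show "u1 y r = g1 y r + psi \<alpha> \<beta> y r" if "(y, r) \<in> strip s \<inter> spacetime" for y r
        using that s by (intro g1(3)) (auto simp: strip_def)
      show "\<bar>g1 y r\<bar> \<le> 2 * U * T" if "(y, r) \<in> strip s" for y r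
        using that s by (intro g_small(1)) (auto simp: strip_def)
      show "g1 y 0 = 0" for y using g1(2)[of y 0] T by (simp add: strip_def)
      show "\<bar>g1 y r - g1 y' r\<bar> \<le> 8 * sqrt 2 * U * sqrt r * \<bar>y - y'\<bar>" if "0 < r" "r \<le> s" for y y' r
        using weak_heat_solution.w_lipschitz[OF g1(1) that(1), of y y'] that s by (simp add: mult_ac)
      show "\<delta> + 2 * U * T < Psi \<alpha> \<beta> \<alpha> - ustar" "\<delta> + 2 * U * T < ustar / 2"
        using \<delta>_le T(3,4) by (simp_all add: U_def)
      show "8 * sqrt 2 * U * s \<le> c / 2"
      proof -
        have "8 * sqrt 2 * U * s \<le> 8 * sqrt 2 * U * T" using s U by (intro mult_left_mono) auto
        then show ?thesis using T(5) by (rule order.trans)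
      qed
      show "u1 x r \<le> ustar + \<delta>" if "0 < r" "r \<le> s" for r
      proof -
        have "u1 x r \<le> past_sup u1 x s"
        proof (rule past_sup_upper[OF _ that])
          fix q assume "(x, q) \<in> strip s \<inter> spacetime"
          then show "u1 x q \<le> 2 * U" using u_bound(1)[of x q] s by (auto simp: strip_def)
        qed
        then show ?thesis using near(2)[OF s ne(1)] by simp
      qed
      show "ustar - \<delta> \<le> past_sup u1 x' s" by (rule near(1)[OF s ne(2)])
    qed (use c H x U \<delta>_nonneg in auto)
    also have "\<dots> \<le> d"
      unfolding d_def using s \<delta>_nonneg c by (intro divide_right_mono mult_left_mono) auto
    finally show ?thesis .
  qed

  \<comment> \<open>Mismatches at positive positions are at most \<open>d\<close> apart, so all of
    them lie within \<open>d\<close> of any single one; evenness adds the mirror image. Two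
    intervals of length \<open>2 * d\<close> give \<open>4 * d\<close>. The point 0 escapes the
    argument but is a null set.\<close>
  have cover: "\<exists>J\<in>sets lborel. emeasure lborel J \<le> ennreal (4 * d) \<and>
      (\<forall>y. y \<noteq> 0 \<longrightarrow> p1 y s \<noteq> p2 y s \<longrightarrow> y \<in> J)" if s: "0 < s" "s \<le> T" for s
  proof (cases "\<exists>b>0. p1 b s \<noteq> p2 b s")
    case True
    then obtain b where b: "b > 0" "p1 b s \<noteq> p2 b s" by blast
    define J where "J = {b - d..b + d} \<union> {- b - d..- b + d}"
    have "emeasure lborel J \<le> emeasure lborel {b - d..b + d} + emeasure lborel {- b - d..- b + d}"
      unfolding J_def by (rule emeasure_subadditive) auto
    also have "\<dots> = ennreal (4 * d)"
      using d by (simp add: emeasure_lborel_Icc_eq ennreal_plus[symmetric] del: ennreal_plus)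
    finally have "emeasure lborel J \<le> ennreal (4 * d)" .
    moreover have "y \<in> J" if y: "y \<noteq> 0" "p1 y s \<noteq> p2 y s" for y
    proof -
      have ne: "p1 \<bar>y\<bar> s \<noteq> p2 \<bar>y\<bar> s"
        using y even[OF mem(2)[OF s], of y] by (cases "y \<ge> 0") auto
      have "\<bar>\<bar>y\<bar> - b\<bar> \<le> d"
        using width[OF s b(1) _ b(2) ne] width[OF s _ _ ne b(2)] y(1) d
        by (cases "\<bar>y\<bar>" b rule: linorder_cases) auto
      then show "y \<in> J" unfolding J_def by (cases "y \<ge> 0") auto
    qed
    ultimately show ?thesis by (intro bexI[of _ J]) (auto simp: J_def)
  next
    case False
    have "p1 y s = p2 y s" if "y \<noteq> 0" for y
    proof (cases "y > 0")
      case False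
      then have "- y > 0" using that by simp
      then show ?thesis
        using even[OF mem(2)[OF s], of y] \<open>\<not> (\<exists>b>0. p1 b s \<noteq> p2 b s)\<close> by metis
    qed (use False in blast)
    then show ?thesis by (intro bexI[of _ "{}"]) auto
  qed

  have zero: "AE y in lborel. y \<noteq> (0 :: real)" by (rule AE_lborel_singleton)
  have contract: "\<bar>g1 x t - g2 x t\<bar> \<le> \<delta> / 2" if t: "0 < t" "t \<le> T" for x t
  proof -
    \<comment> \<open>Where \<open>p1\<close> and \<open>p2\<close> agree the sources differ by at
      most \<delta>; elsewhere each is at most \<open>2 * U\<close>, which gives
      \<open>K = 4 * U\<close>.\<close>
    have "\<bar>g1 x t - g2 x t\<bar> \<le> \<delta> * t + 2 * (4 * U * (4 * d)) * sqrt t"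
    proof (rule weak_heat_solutions_diff_le[OF g1(1) g2(1) t])
      show "AE s in lborel. s \<in> {0<..t} \<longrightarrow> (\<exists>J\<in>sets lborel. emeasure lborel J \<le> ennreal (4 * d) \<and>
          (AE y in lborel. \<bar>F1 y s - F2 y s\<bar> \<le> \<delta> + 4 * U * indicator J y))"
        using g1(4) g2(4)
      proof eventually_elim
        case (elim s)
        show ?case
        proof
          assume "s \<in> {0<..t}"
          then have s: "0 < s" "s \<le> T" using t by auto
          obtain J where J: "J \<in> sets lborel" "emeasure lborel J \<le> ennreal (4 * d)"
            "\<And>y. y \<noteq> 0 \<Longrightarrow> p1 y s \<noteq> p2 y s \<Longrightarrow> y \<in> J"
            using cover[OF s] by blast
          have "AE y in lborel. F1 y s = p1 y s * u1 y s" "AE y in lborel. F2 y s = p2 y s * u2 y s"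
            using elim s by auto
          with zero have "AE y in lborel. \<bar>F1 y s - F2 y s\<bar> \<le> \<delta> + 4 * U * indicator J y"
          proof eventually_elim
            case (elim y)
            have m: "(y, s) \<in> strip T \<inter> spacetime" using mem[OF s] by blast
            note p = p01[OF mem(2)[OF s], of y]
            show ?case
            proof (cases "p1 y s = p2 y s")
              case True
              have "\<bar>F1 y s - F2 y s\<bar> = \<bar>p1 y s\<bar> * \<bar>u1 y s - u2 y s\<bar>"
                using elim True by (simp add: abs_mult flip: right_diff_distrib)
              also have "\<dots> \<le> 1 * \<delta>" using p u_diff[OF m] by (intro mult_mono) auto
              also have "\<dots> \<le> \<delta> + 4 * U * indicator J y" using U by simp
              finally show ?thesis .
            next
              case False
              have "\<bar>p1 y s * u1 y s\<bar> \<le> 1 * (2 * U)" "\<bar>p2 y s * u2 y s\<bar> \<le> 1 * (2 * U)"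
                unfolding abs_mult using p u_bound[OF m] by (intro mult_mono; auto)+
              then have "\<bar>F1 y s - F2 y s\<bar> \<le> 4 * U" using elim by linarith
              moreover have "y \<in> J" using J(3) elim(1) False by blast
              ultimately show ?thesis using \<delta>_nonneg by simp
            qed
          qed
          with J show "\<exists>J\<in>sets lborel. emeasure lborel J \<le> ennreal (4 * d) \<and>
            (AE y in lborel. \<bar>F1 y s - F2 y s\<bar> \<le> \<delta> + 4 * U * indicator J y)" by blast
        qed
      qed
    qed (use d U in auto)
    also have "\<dots> \<le> \<delta> * T + 2 * (4 * U * (4 * d)) * sqrt T"
      using t \<delta>_nonneg d U by (intro add_mono mult_left_mono) auto
    \<comment> \<open>The width \<open>d\<close> contributes a second factor \<open>sqrt T\<close>,
      so the mismatch term is also linear in \<open>T\<close>; 128 is 32 times the 4 in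
      \<open>d\<close>.\<close>
    also have "\<dots> = \<delta> * (T * (1 + 128 * U / c))"
    proof -
      have "sqrt T * sqrt T = T" using T by simp
      then have "d * sqrt T = 4 * \<delta> / c * T" by (simp add: d_def)
      then have "2 * (4 * U * (4 * d)) * sqrt T = 32 * U * (4 * \<delta> / c * T)" by (simp add: mult.assoc)
      then show ?thesis using c(1) by (simp add: field_simps)
    qed
    also have "\<dots> \<le> \<delta> * (1 / 2)" using T(6) \<delta>_nonneg by (intro mult_left_mono) auto
    finally show ?thesis by simp
  qed
  have "\<delta> \<le> \<delta> / 2"
  proof -
    have "\<bar>(\<lambda>(y, s). g1 y s - g2 y s) z\<bar> \<le> \<delta> / 2" if z: "z \<in> strip T" for z
    proof (cases z)
      case (Pair y s)
      show ?thesis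
      \<comment> \<open>The contraction is available for positive times only; at time 0 both regular
        parts vanish.\<close>
      proof (cases "s = 0")
        case True
        then have "g1 y s = 0" "g2 y s = 0" using g1(2)[of y 0] g2(2)[of y 0] z Pair by auto
        then show ?thesis using Pair \<delta>_nonneg by simp
      qed (use contract[of s y] z Pair in \<open>auto simp: strip_def\<close>)
    qed
    then show ?thesis using cSUP_least[OF ne] unfolding \<delta>_def[symmetric] by (metis (no_types, lifting) \<delta>_def)
  qed
  then have \<delta>0: "\<delta> = 0" using \<delta>_nonneg by simp
  show "\<forall>(x, t) \<in> strip T \<inter> spacetime. u1 x t = u2 x t"
  proof (clarify)
    fix x t assume "(x, t) \<in> strip T" "(x, t) \<in> spacetime"
    then show "u1 x t = u2 x t" using u_diff[of x t] \<delta>0 by simp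
  qed

  \<comment> \<open>\<open>p\<close> is measurable on \<open>spacetime\<close> only, so it is
    extended by 0; this alters it within the strip at the origin alone.\<close>
  define f where "f p z = (if z \<in> strip T then if z \<in> spacetime then (\<lambda>(x, t). p x t) z else 0 else (0 :: real))"
    for p z
  have "closed (strip T)" unfolding strip_def by (intro closed_Times) auto
  then have strip_sets: "strip T \<in> sets lebesgue" by (simp add: borel_closed)
  have "spacetime \<in> sets borel"
    unfolding spacetime_def by (intro sets.Diff borel_closed closed_Times) auto
  then have spacetime_sets: "spacetime \<in> sets lebesgue" by simp
  have f_meas: "f p \<in> borel_measurable lebesgue" if "weak_solution \<alpha> \<beta> ustar (u, p)" for u p
  proof -
    have "(\<lambda>(x, t). p x t) \<in> borel_measurable (lebesgue_on spacetime)"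
      using that unfolding weak_solution_def Let_def by auto
    note borel_measurable_if_I[OF this spacetime_sets]
    from borel_measurable_if_I[OF measurable_restrict_space1[OF this] strip_sets] show ?thesis
      unfolding f_def[abs_def] .
  qed
  have "AE s in lborel. AE y in lborel. f p1 (y, s) = f p2 (y, s)"
    using zero
  proof eventually_elim
    case (elim s)
    show ?case
    proof (cases "0 < s \<and> s \<le> T")
      case True
      \<comment> \<open>Since \<delta> is 0, so is \<open>d\<close>, and the cover of the mismatch
        set at each time is a null set.\<close>
      then obtain J where J: "J \<in> sets lborel" "emeasure lborel J \<le> ennreal (4 * d)"
        "\<And>y. y \<noteq> 0 \<Longrightarrow> p1 y s \<noteq> p2 y s \<Longrightarrow> y \<in> J"
        using cover[of s] by blast
      have "J \<in> null_sets lborel" using J(1,2) by (simp add: d_def \<delta>0 null_sets_def)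
      then have "AE y in lborel. y \<notin> J" by (rule AE_not_in)
      with zero show ?thesis by eventually_elim (use J(3) in \<open>auto simp: f_def\<close>)
    next
      case False
      then have "(y, s) \<notin> strip T" for y using elim by (auto simp: strip_def)
      then show ?thesis by (simp add: f_def)
    qed
  qed
  from AE_lebesgue_eq_by_slices[OF f_meas[OF ws1] f_meas[OF ws2] this]
  have "AE z in lebesgue. f p1 z = f p2 z" .
  moreover have "AE z in lebesgue. z \<noteq> ((0, 0) :: real \<times> real)"
    using AE_lborel_singleton[of "(0, 0) :: real \<times> real"] by (simp add: AE_completion_iff)
  ultimately have "AE z in lebesgue. z \<in> strip T \<longrightarrow> (case z of (x, t) \<Rightarrow> p1 x t = p2 x t)"
    by eventually_elim (auto simp: f_def strip_def spacetime_def split: if_splits)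
  then show "AE (x, t) in lebesgue_on (strip T). p1 x t = p2 x t"
    using strip_sets by (simp add: AE_restrict_space_iff)
qed

section \<open>Choice of the time from the parameters\<close>

theorem theorem18:
  fixes \<alpha> \<beta> ustar :: real
  assumes "\<alpha> > 0" and "\<beta> > 0" and "ustar > 0"
    and "ustar < Psi \<alpha> \<beta> \<alpha>"
  shows "\<exists>T>0. \<forall>u1 p1 u2 p2.
    weak_solution \<alpha> \<beta> ustar (u1, p1) \<and> weak_solution \<alpha> \<beta> ustar (u2, p2) \<longrightarrow>
    (\<forall>(x, t) \<in> strip T \<inter> spacetime. u1 x t = u2 x t) \<and>
    (AE (x, t) in lebesgue_on (strip T). p1 x t = p2 x t)"
proof -
  define U where "U = Psi \<alpha> \<beta> \<alpha>"
  have U: "U > 0" "ustar < U" using assms by (auto simp: U_def)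
  \<comment> \<open>The other half of \<open>ustar\<close> is left for the errors in
    \<open>mismatch_width\<close>.\<close>
  obtain H where H: "H \<ge> \<alpha>" "Psi \<alpha> \<beta> H < ustar / 2"
    using Psi_eventually_small[OF assms(1,2), of "ustar / 2"] assms(3) by auto
  obtain c where c: "c > 0" "\<And>\<eta> \<theta>. \<alpha> \<le> \<eta> \<Longrightarrow> \<eta> \<le> \<theta> \<Longrightarrow> \<theta> \<le> H \<Longrightarrow>
      c * (\<theta> - \<eta>) \<le> Psi \<alpha> \<beta> \<eta> - Psi \<alpha> \<beta> \<theta>"
    using Psi_decreases_linearly[OF assms(1,2), of H] by metis
  define k where "k = 1 + 128 * U / c"
  have k: "k > 0" using U c(1) by (auto simp: k_def intro!: add_pos_pos)
  \<comment> \<open>One entry for each condition of \<open>uniqueness_on_strip\<close>. The entries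
    with 12 and 24 are half of what equality would allow, because those two inequalities are
    strict.\<close>
  define T where "T = Min {1 / 2, (U - ustar) / (12 * U), ustar / (24 * U), c / (16 * sqrt 2 * U), 1 / (2 * k)}"
  have T_le: "T \<le> 1 / 2" "T \<le> (U - ustar) / (12 * U)" "T \<le> ustar / (24 * U)"
    "T \<le> c / (16 * sqrt 2 * U)" "T \<le> 1 / (2 * k)"
    unfolding T_def by (rule Min_le; simp)+
  have T_pos: "T > 0"
    unfolding T_def using U c(1) k assms(3) by simp
  have T: "6 * U * T < U - ustar" "6 * U * T < ustar / 2" "8 * sqrt 2 * U * T \<le> c / 2" "T * k \<le> 1 / 2"
  proof -
    have "T * (12 * U) \<le> U - ustar" "T * (24 * U) \<le> ustar" "T * (16 * sqrt 2 * U) \<le> c" "T * (2 * k) \<le> 1"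
      using T_le(2-5) U(1) k by (simp_all add: pos_le_divide_eq)
    then show "6 * U * T < U - ustar" "6 * U * T < ustar / 2" "8 * sqrt 2 * U * T \<le> c / 2" "T * k \<le> 1 / 2"
      using U assms(3) by (simp_all add: mult_ac)
  qed
  note unique = uniqueness_on_strip[OF assms(1,2) c H(2) T_pos T_le(1) T[unfolded U_def k_def]]
  show ?thesis
    by (intro exI[of _ T] conjI allI impI T_pos; elim conjE) (rule unique; assumption)+
qed

end
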